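(* There is a bijection between vertex-pointed planar hypermaps and mobiles with the following properties. For $H$ a vertex-pointed hypermap endowed with its geodesic labelling and $M$ the corresponding mobile: each light face $f$ of $H$ corresponds to a right local max of $M$ of label $\max(f)+1$; each non-pointed vertex of $H$ corresponds to a white vertex of $M$ that is not a right local max and has the same label; and each dark face of $H$ of ccw-type $\tau$ corresponds to a black vertex of $M$ of cw-type $\overline{\tau}^{\uparrow}$. In particular, for each $p\ge 2$, the bijection restricts to a bijection between vertex-pointed $p$-hypermaps (hypermaps with all dark faces of degree $p$) and $p$-mobiles (mobiles with all black vertices of degree $p$).
   Context: Maps are connected graphs embedded in the sphere. A hypermap is a map with all vertices of even degree together with a proper bicolouring of its faces into dark and light faces (every edge has a dark face on one side and a light face on the other). Its canonical orientation orients each edge so that its incident dark face is on its right; the geodesic labelling of a hypermap pointed at $v$ assigns to each vertex $u$ the length of a shortest directed path from $v$ to $u$ in the canonical orientation. For a light face $f$, $\max(f)$ is the maximal label of its incident vertices; the ccw-type of a dark face is the cyclic list of labels of its vertices in counterclockwise order. A mobile is a plane tree with vertices properly bicoloured black and white, where white vertices carry labels in $\mathbb{Z}$ with minimal label $1$, and such that for any two neighbours $v,u$ of a black vertex, with $u$ immediately following $v$ in clockwise order around it, $\ell(u)\ge\ell(v)-1$. The cw-type of a black vertex is the cyclic list of labels of its neighbours in clockwise order. A white vertex $v$ is a right neighbour of a white vertex $u$ if $v$ immediately follows $u$ in counterclockwise order around a black vertex; $u$ is a right local max if every right neighbour $v$ of $u$ satisfies $\ell(v)\le\ell(u)$. For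 a cyclic integer sequence $\tau$ in which each element minus the preceding one is at least $-1$, the upper completion $c^{\uparrow}(\tau)$ is obtained by inserting $i+1,\ldots,j+1$ between any two consecutive elements $i,j$ with $j\ge i$, and the upper complement $\overline{\tau}^{\uparrow}$ is the cyclic sequence of the inserted elements $c^{\uparrow}(\tau)\setminus\tau$ taken in reverse order. *)

theory Defs
  imports "HOL-Combinatorics.Orbits"
begin

section \<open>Planar maps\<close>

text \<open>
  A map is encoded by its rotation system. A dart is an edge directed away from one of its
  ends (so a loop has two darts at the same vertex), \<open>opp\<close> reverses a dart, and \<open>rot\<close> sends a dart
  to the next dart in counterclockwise order around its initial vertex. A vertex is identified
  with the set of darts starting there, a face with the set of darts having it on their left.
\<close>

record 'a comb_map =
  darts :: "'a set"
  rot :: "'a \<Rightarrow> 'a"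
  opp :: "'a \<Rightarrow> 'a"

definition vertex_of :: "('a, 'z) comb_map_scheme \<Rightarrow> 'a \<Rightarrow> 'a set" where
  "vertex_of G d = orbit (rot G) d"

text \<open>
  To keep the face on the left, one arrives at the end of \<open>d\<close> and continues with the dart that
  precedes \<open>opp G d\<close> in counterclockwise order. Iterating \<open>face_next\<close> thus runs
  counterclockwise around the face.
\<close>

definition face_next :: "('a, 'z) comb_map_scheme \<Rightarrow> 'a \<Rightarrow> 'a" where
  "face_next G d = inv (rot G) (opp G d)"

definition face_of :: "('a, 'z) comb_map_scheme \<Rightarrow> 'a \<Rightarrow> 'a set" where
  "face_of G d = orbit (face_next G) d"

text \<open>
  The map without darts is the vertex map: its only vertex and its only face have no dart,
  so both are encoded by the empty set.
\<close>

definition verts :: "('a, 'z) comb_map_scheme \<Rightarrow> 'a set set" where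
  "verts G = (if darts G = {} then {{}} else vertex_of G ` darts G)"

definition faces :: "('a, 'z) comb_map_scheme \<Rightarrow> 'a set set" where
  "faces G = (if darts G = {} then {{}} else face_of G ` darts G)"

definition edges :: "('a, 'z) comb_map_scheme \<Rightarrow> 'a set set" where
  "edges G = (\<lambda>d. {d, opp G d}) ` darts G"

text \<open>A dart in \<open>v \<inter> f\<close> marks a corner of the face \<open>f\<close> at the vertex \<open>v\<close>.\<close>

definition incident :: "('a, 'z) comb_map_scheme \<Rightarrow> 'a set \<Rightarrow> 'a set \<Rightarrow> bool" where
  "incident G v f \<longleftrightarrow> v \<in> verts G \<and> f \<in> faces G \<and> (v \<inter> f \<noteq> {} \<or> darts G = {})"

text \<open>The last condition is Euler's formula for the sphere.\<close>

definition planar_map :: "('a, 'z) comb_map_scheme \<Rightarrow> bool" where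
  "planar_map G \<longleftrightarrow>
     finite (darts G) \<and> rot G permutes darts G \<and> opp G permutes darts G \<and>
     (\<forall>d\<in>darts G. opp G d \<noteq> d \<and> opp G (opp G d) = d) \<and>
     (\<forall>u\<in>verts G. \<forall>v\<in>verts G. (u, v) \<in> {(vertex_of G d, vertex_of G (opp G d)) |d. d \<in> darts G}\<^sup>*) \<and>
     card (verts G) + card (faces G) = card (edges G) + 2"

definition map_iso_by ::
  "('a \<Rightarrow> 'b) \<Rightarrow> ('a, 'y) comb_map_scheme \<Rightarrow> ('b, 'z) comb_map_scheme \<Rightarrow> bool" where
  "map_iso_by h G G' \<longleftrightarrow>
     bij_betw h (darts G) (darts G') \<and>
     (\<forall>d\<in>darts G. h (rot G d) = rot G' (h d) \<and> h (opp G d) = opp G' (h d))"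


section \<open>Pointed hypermaps\<close>

record 'a ptd_hypermap = "'a comb_map" +
  dark :: "'a set set"
  point :: "'a set"

definition light :: "('a, 'z) ptd_hypermap_scheme \<Rightarrow> 'a set set" where
  "light H = faces H - dark H"

text \<open>
  The condition \<open>{} \<notin> dark H\<close> only concerns the vertex map, whose face is by convention light.
\<close>

definition pointed_hypermap :: "('a, 'z) ptd_hypermap_scheme \<Rightarrow> bool" where
  "pointed_hypermap H \<longleftrightarrow>
     planar_map H \<and>
     (\<forall>v\<in>verts H. even (card v)) \<and>
     dark H \<subseteq> faces H \<and> {} \<notin> dark H \<and>
     (\<forall>d\<in>darts H. face_of H d \<in> dark H \<longleftrightarrow> face_of H (opp H d) \<notin> dark H) \<and>
     point H \<in> verts H"

text \<open>The face on the right of a dart is the face on the left of the opposite dart.\<close>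

definition oriented_adj :: "('a, 'z) ptd_hypermap_scheme \<Rightarrow> ('a set \<times> 'a set) set" where
  "oriented_adj H =
     {(vertex_of H d, vertex_of H (opp H d)) |d. d \<in> darts H \<and> face_of H (opp H d) \<in> dark H}"

definition geodesic_label :: "('a, 'z) ptd_hypermap_scheme \<Rightarrow> 'a set \<Rightarrow> int" where
  "geodesic_label H u = int (LEAST n. (point H, u) \<in> oriented_adj H ^^ n)"

definition max_label :: "('a, 'z) ptd_hypermap_scheme \<Rightarrow> 'a set \<Rightarrow> int" where
  "max_label H f = Max (geodesic_label H ` {v. incident H v f})"

text \<open>
  A cyclic list is represented by the set of lists obtained by reading it linearly from each
  possible starting position.
\<close>

definition ccw_type :: "('a, 'z) ptd_hypermap_scheme \<Rightarrow> 'a set \<Rightarrow> int list set" where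
  "ccw_type H f =
     (\<lambda>d. map (\<lambda>k. geodesic_label H (vertex_of H ((face_next H ^^ k) d))) [0..<card f]) ` f"

definition p_hypermap :: "nat \<Rightarrow> ('a, 'z) ptd_hypermap_scheme \<Rightarrow> bool" where
  "p_hypermap p H \<longleftrightarrow> pointed_hypermap H \<and> (\<forall>f\<in>dark H. card f = p)"

definition hypermap_iso :: "('a ptd_hypermap \<times> 'a ptd_hypermap) set" where
  "hypermap_iso = {(H, H'). pointed_hypermap H \<and> pointed_hypermap H' \<and>
     (\<exists>h. map_iso_by h H H' \<and> (`) h ` dark H = dark H' \<and> h ` point H = point H')}"


section \<open>Mobiles\<close>

text \<open>The values of \<open>label\<close> outside the white vertices are irrelevant.\<close>

record 'a mobile = "'a comb_map" +
  black :: "'a set set"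
  label :: "'a set \<Rightarrow> int"

definition white :: "('a, 'z) mobile_scheme \<Rightarrow> 'a set set" where
  "white M = verts M - black M"

definition plane_tree :: "('a, 'z) comb_map_scheme \<Rightarrow> bool" where
  "plane_tree G \<longleftrightarrow> planar_map G \<and> card (faces G) = 1"

text \<open>
  If \<open>d\<close> starts at a black vertex, the neighbour following the one reached by \<open>d\<close> is reached
  by \<open>rot M d\<close> in counterclockwise order and by \<open>inv (rot M) d\<close> in clockwise order.
\<close>

definition neighbour_label :: "('a, 'z) mobile_scheme \<Rightarrow> 'a \<Rightarrow> int" where
  "neighbour_label M d = label M (vertex_of M (opp M d))"

definition is_mobile :: "('a, 'z) mobile_scheme \<Rightarrow> bool" where
  "is_mobile M \<longleftrightarrow>
     plane_tree M \<and>
     black M \<subseteq> verts M \<and>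
     (\<forall>d\<in>darts M. vertex_of M d \<in> black M \<longleftrightarrow> vertex_of M (opp M d) \<notin> black M) \<and>
     (\<forall>v\<in>white M. label M v \<ge> 1) \<and> (\<exists>v\<in>white M. label M v = 1) \<and>
     (\<forall>b\<in>black M. \<forall>d\<in>b. neighbour_label M (inv (rot M) d) \<ge> neighbour_label M d - 1)"

definition cw_type :: "('a, 'z) mobile_scheme \<Rightarrow> 'a set \<Rightarrow> int list set" where
  "cw_type M b = (\<lambda>d. map (\<lambda>k. neighbour_label M ((inv (rot M) ^^ k) d)) [0..<card b]) ` b"

definition right_neighbour :: "('a, 'z) mobile_scheme \<Rightarrow> 'a set \<Rightarrow> 'a set \<Rightarrow> bool" where
  "right_neighbour M u v \<longleftrightarrow>
     (\<exists>b\<in>black M. \<exists>d\<in>b. u = vertex_of M (opp M d) \<and> v = vertex_of M (opp M (rot M d)))"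

definition right_local_max :: "('a, 'z) mobile_scheme \<Rightarrow> 'a set \<Rightarrow> bool" where
  "right_local_max M u \<longleftrightarrow>
     u \<in> white M \<and> (\<forall>v. right_neighbour M u v \<longrightarrow> label M v \<le> label M u)"

definition p_mobile :: "nat \<Rightarrow> ('a, 'z) mobile_scheme \<Rightarrow> bool" where
  "p_mobile p M \<longleftrightarrow> is_mobile M \<and> (\<forall>b\<in>black M. card b = p)"

definition mobile_iso :: "('a mobile \<times> 'a mobile) set" where
  "mobile_iso = {(M, M'). is_mobile M \<and> is_mobile M' \<and>
     (\<exists>h. map_iso_by h M M' \<and> (`) h ` black M = black M' \<and>
          (\<forall>v\<in>white M. label M' (h ` v) = label M v))}"


section \<open>Upper complement\<close>

definition inserted :: "int \<Rightarrow> int \<Rightarrow> int list" where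
  "inserted i j = (if j \<ge> i then [i + 1..j + 1] else [])"

text \<open>
  \<open>rotate1 \<tau>\<close> pairs each element with its cyclic successor. The flag tells the inserted elements
  from the original ones. Reading a cyclic list from another starting position only rotates its
  upper completion, and hence its upper complement.
\<close>

definition upper_completion :: "int list \<Rightarrow> (int \<times> bool) list" where
  "upper_completion \<tau> =
     concat (map2 (\<lambda>i j. (i, False) # map (\<lambda>k. (k, True)) (inserted i j)) \<tau> (rotate1 \<tau>))"

definition upper_complement :: "int list \<Rightarrow> int list" where
  "upper_complement \<tau> = rev (map fst (filter snd (upper_completion \<tau>)))"

end

theory Submission
  imports Defs
begin

text \<open>
  A hypermap and its mobile are two shadows of one bipartite map \<open>B\<close> in which adjacent labels differ
  by one. In a hypermap with geodesic labels, subdivide every edge \<open>j \<rightarrow> i\<close> with \<open>i \<le> j\<close> into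
  one up-step \<open>j \<rightarrow> j + 1\<close> and the down-steps \<open>j + 1 \<rightarrow> j \<rightarrow> \<dots> \<rightarrow> i\<close>. In every light face, zip each
  down-step with the matching up-step. This closes the light faces, and the tip of the zipped
  face \<open>f\<close> is a local maximum of label \<open>max(f) + 1\<close>. The faces of \<open>B\<close> are the completed dark faces,
  and the pointed vertex is the only local minimum of \<open>B\<close>.

  All three maps share the same darts and the same reversal \<open>i\<close>. Let \<open>U\<close> be the set of darts
  along which the labels of \<open>B\<close> increase, \<open>R\<close> the rotation of \<open>B\<close> and \<open>F = R \<circ> i\<close>. The first-return
  maps of \<open>R\<close> and \<open>F\<close> to \<open>U\<close> are the vertices and dark faces of the hypermap, and their
  first-return maps to the complement of \<open>U\<close> are the white and black vertices of the mobile. For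
  given labels, \<open>R\<close> can be recovered from either pair, and negating the labels exchanges the two
  situations. The light faces correspond to the local maxima of \<open>B\<close> and the faces of the mobile to
  its local minima. Hence planarity is preserved, and the mobile has a single face because \<open>B\<close> has a
  single local minimum.
\<close>

section \<open>First-return maps\<close>

text \<open>The difficulty is the reconstruction of \<open>R\<close>: a local maximum of
  \<open>B\<close> contains no dart of \<open>U\<close>, so the return maps to \<open>U\<close>
  never see it. What locates it is the quotient \<open>\<phi>\<close> with
  \<open>\<nu> (\<phi> e) = \<alpha> e\<close>. Composing \<open>R\<close> with the inverse of
  \<open>\<nu>\<close> cuts the vertices into pieces with at most one dart of \<open>U\<close>, and
  there a ballot rule holds: the reverse of \<open>e\<close> is followed by the reverse of the next
  edge of its \<open>\<phi>\<close>-cycle with label at least \<open>lab e\<close>, unless the cycle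
  climbs at once. This only asks that labels rise by at most one along \<open>\<phi>\<close>, which
  is the triangle inequality for geodesic labels on one side and the mobile inequality on the other.
  Since the reconstruction is unique, \<open>R\<close> and \<open>lab\<close> are invariants of
  either object, and isomorphisms can be moved through \<open>B\<close>. Degrees agree because a
  closed walk on the levels of \<open>B\<close> has as many up-steps as down-steps. The minimal
  mobile label 1 sits directly above the level 0 of the pointed vertex.\<close>

inductive hits :: "('a \<Rightarrow> 'a) \<Rightarrow> 'a set \<Rightarrow> 'a \<Rightarrow> 'a \<Rightarrow> bool" for f A where
  now: "f x \<in> A \<Longrightarrow> hits f A x (f x)"
| later: "f x \<notin> A \<Longrightarrow> hits f A (f x) y \<Longrightarrow> hits f A x y"

text \<open>\<open>hits\<close> is a relation because a trajectory may avoid \<open>A\<close>. The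
  search begins at \<open>f x\<close>, so for \<open>x\<close> in \<open>A\<close> the result is a
  true first return and not \<open>x\<close> itself.\<close>

lemma hits_iff: "hits f A x y \<longleftrightarrow> (if f x \<in> A then y = f x else hits f A (f x) y)"
  by (subst hits.simps) auto

lemma hits_det: "hits f A x y \<Longrightarrow> hits f A x z \<Longrightarrow> y = z"
proof (induction rule: hits.induct)
  case (now x) then show ?case by (subst (asm) hits_iff) auto
next
  case (later x y) then show ?case by (subst (asm) (2) hits_iff) auto
qed

lemma hits_in: "hits f A x y \<Longrightarrow> y \<in> A"
  by (induction rule: hits.induct) auto

lemma hits_closed:
  assumes "hits f A x y" "x \<in> Q" "\<And>z. z \<in> Q \<Longrightarrow> f z \<in> Q"
  shows "y \<in> Q"
  using assms by (induction rule: hits.induct) auto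

lemma hits_orbit: "hits f A x y \<Longrightarrow> y \<in> orbit f x"
  by (induction rule: hits.induct) (auto intro: orbit.base orbit_subset)

lemma hits_ex:
  assumes "y \<in> orbit f x" "y \<in> A"
  shows "\<exists>z. hits f A x z"
proof -
  obtain n where "y = (f ^^ n) x" "0 < n"
    using assms(1) by (auto simp: orbit_altdef)
  then show ?thesis
    using assms(2)
  proof (induction n arbitrary: x)
    case (Suc n)
    show ?case
    proof (cases "f x \<in> A")
      case False
      then have "0 < n" using Suc.prems by (cases n) auto
      then have "\<exists>z. hits f A (f x) z"
        using Suc.IH[of "f x"] Suc.prems by (simp add: funpow_swap1)
      then show ?thesis using False hits.later[of f x A] by blast
    qed (auto intro: hits.now)
  qed simp
qed

text \<open>The conjugation is required on an invariant set only. This covers both the transport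
  along a bijection of darts and, with \<open>h\<close> the identity, a change of \<open>f\<close>
  and \<open>A\<close> away from the trajectory.\<close>

lemma hits_map:
  assumes "hits f A x y" "x \<in> Q"
    and Q: "\<And>z. z \<in> Q \<Longrightarrow> f z \<in> Q" and eq: "\<And>z. z \<in> Q \<Longrightarrow> g (h z) = h (f z)"
    and AB: "\<And>z. z \<in> Q \<Longrightarrow> h z \<in> B \<longleftrightarrow> z \<in> A"
  shows "hits g B (h x) (h y)"
  using assms(1,2)
proof (induction rule: hits.induct)
  case (now x)
  then have "g (h x) \<in> B" using AB[OF Q] eq by metis
  then have "hits g B (h x) (g (h x))" by (rule hits.now)
  then show ?case using eq now by simp
next
  case (later x y)
  then have "hits g B (g (h x)) (h y)" using eq Q by simp
  moreover have "g (h x) \<notin> B" using later AB[OF Q] eq by metis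
  ultimately show ?case using hits.later by metis
qed

lemma hits_cong:
  assumes "hits f A x y" "x \<in> Q"
    and "\<And>z. z \<in> Q \<Longrightarrow> f z \<in> Q" "\<And>z. z \<in> Q \<Longrightarrow> g z = f z" "A \<inter> Q = B \<inter> Q"
  shows "hits g B x y"
  using hits_map[OF assms(1-3), of g "\<lambda>z. z" B] assms(4,5) by blast

text \<open>Since \<open>N\<close> moves only points of \<open>A\<close>, it acts when the search is
  already over. Taking for \<open>N\<close> the inverse of a return map makes all returns
  trivial.\<close>

lemma hits_comp:
  assumes "hits f A x y" "\<And>z. z \<in> A \<Longrightarrow> N z \<in> A" "\<And>z. z \<notin> A \<Longrightarrow> N z = z"
  shows "hits (N \<circ> f) A x (N y)"
  using assms
proof (induction rule: hits.induct)
  case (now x)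
  then have "(N \<circ> f) x \<in> A" by simp
  then show ?case using hits.now by fastforce
next
  case (later x y)
  then have "(N \<circ> f) x = f x" by simp
  with later show ?case by (subst hits_iff) (simp add: comp_def)
qed

text \<open>A search for the smaller target \<open>B\<close> can be resumed from the first hit of
  the larger one.\<close>

lemma hits_trans:
  assumes "hits f A x y" "B \<subseteq> A" "y \<notin> B" "hits f B y z"
  shows "hits f B x z"
  using assms
proof (induction rule: hits.induct)
  case (now x) then show ?case by (subst hits_iff) auto
next
  case (later x y) then show ?case by (subst hits_iff) auto
qed

text \<open>The path is walked backwards; its intermediate points avoid \<open>A\<close>. If
  \<open>x\<close> is outside \<open>A\<close> too, the backward search from \<open>y\<close> runs
  through \<open>x\<close> and ends where the search from \<open>x\<close> ends.\<close>

lemma hits_inverse: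
  assumes "hits f A x y" "\<And>z. g (f z) = z"
  shows "if x \<in> A then hits g A y x else \<forall>w. hits g A x w \<longrightarrow> hits g A y w"
  using assms
proof (induction rule: hits.induct)
  case (now x)
  then show ?case by (auto simp: hits_iff[of g A "f x"])
next
  case (later x y)
  then show ?case by (auto simp: hits_iff[of g A "f x"])
qed

lemma hits_inj:
  assumes "hits f A x y" "hits f A x' y" "x \<in> A" "x' \<in> A" "inj f"
  shows "x = x'"
  using hits_inverse[OF assms(1), of "inv f"] hits_inverse[OF assms(2), of "inv f"] assms(3-)
  by (auto intro: hits_det)

text \<open>The visits to \<open>A\<close> cut the orbit of \<open>f\<close> into pieces, and each
  piece is one step of \<open>g\<close>.\<close>

lemma orbit_hits:
  assumes "\<And>a. a \<in> A \<Longrightarrow> hits f A a (g a)" "a \<in> A"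
  shows "orbit f a \<inter> A = orbit g a"
proof (intro equalityI subsetI)
  fix y assume "y \<in> orbit f a \<inter> A"
  then obtain n where n: "y = (f ^^ n) a" "0 < n" "y \<in> A"
    by (auto simp: orbit_altdef)
  \<comment> \<open>The starting point is generalised to points outside \<open>A\<close>, because
    the induction removes single steps of \<open>f\<close>.\<close>
  have "\<And>x z. y = (f ^^ n) x \<Longrightarrow> 0 < n \<Longrightarrow> hits f A x z \<Longrightarrow> y = z \<or> y \<in> orbit g z"
  proof (induction n)
    case (Suc n)
    show ?case
    proof (cases "n = 0")
      case True
      then have "hits f A x y" using Suc.prems n(3) by (auto intro: hits.now)
      then show ?thesis using Suc.prems hits_det by metis
    next
      case False
      have y: "y = (f ^^ n) (f x)" using Suc.prems by (simp add: funpow_swap1)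
      show ?thesis
      proof (cases "f x \<in> A")
        case True
        then have "z = f x" using Suc.prems(3) by (auto simp: hits_iff[of f A x])
        moreover have "y = g (f x) \<or> y \<in> orbit g (g (f x))"
          using Suc.IH[OF y] False assms(1)[OF True] by auto
        ultimately show ?thesis by (auto intro: orbit.base orbit_subset)
      next
        case F: False
        then have "hits f A (f x) z" using Suc.prems(3) by (auto simp: hits_iff[of f A x])
        then show ?thesis using Suc.IH[OF y] False by auto
      qed
    qed
  qed simp
  from this[OF n(1,2) assms(1)[OF assms(2)]] show "y \<in> orbit g a"
    by (auto intro: orbit.base orbit_subset)
next
  fix y assume "y \<in> orbit g a"
  then show "y \<in> orbit f a \<inter> A"
  proof induction
    case base then show ?case using hits_orbit[OF assms(1)] hits_in[OF assms(1)] assms(2) by blast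
  next
    case (step y)
    then have "g y \<in> orbit f y" "g y \<in> A"
      using hits_orbit[OF assms(1)] hits_in[OF assms(1)] by blast+
    then show ?case using step orbit_trans by (metis IntD1 IntI)
  qed
qed

definition first_hit :: "('a \<Rightarrow> 'a) \<Rightarrow> 'a set \<Rightarrow> 'a \<Rightarrow> 'a" where
  "first_hit f A x = (THE y. hits f A x y)"

lemma first_hit_eq: "hits f A x y \<Longrightarrow> first_hit f A x = y"
  unfolding first_hit_def using hits_det by (metis (mono_tags, lifting) the_equality)

lemma hits_first_hit: "hits f A x y \<Longrightarrow> hits f A x (first_hit f A x)"
  using first_hit_eq by metis

section \<open>Orbits of finite permutations\<close>

lemma permutes_self_in_orbit: "f permutes D \<Longrightarrow> finite D \<Longrightarrow> x \<in> orbit f x"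
  by (meson permutation_permutes permutation_self_in_orbit)

lemma permutes_orbit_eq_iff:
  assumes "f permutes D" "finite D"
  shows "orbit f x = orbit f y \<longleftrightarrow> y \<in> orbit f x"
proof
  assume "y \<in> orbit f x"
  then show "orbit f x = orbit f y"
    using orbit_cyclic_eq3[OF cyclic_on_orbit[OF assms]] by metis
qed (use permutes_self_in_orbit[OF assms] in auto)

lemma permutes_hits_return:
  assumes "f permutes D" "finite D" "x \<in> A"
  shows "hits f A x (first_hit f A x)"
proof -
  obtain z where "hits f A x z"
    using hits_ex[OF permutes_self_in_orbit[OF assms(1,2)] assms(3)] by blast
  then show ?thesis by (rule hits_first_hit)
qed

lemma hits_permutes:
  assumes f: "inj f" and A: "finite A"
    and g: "\<And>a. a \<in> A \<Longrightarrow> hits f A a (g a)" "\<And>a. a \<notin> A \<Longrightarrow> g a = a"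
  shows "g permutes A"
proof (rule inj_imp_permutes)
  show "inj_on g A" using hits_inj[OF g(1) _ _ _ f] g(1) by (metis inj_onI)
  show "g x \<in> A" if "x \<in> A" for x using hits_in[OF g(1)[OF that]] .
qed (use A g in auto)

text \<open>An injective map of a finite set into itself is onto, so forward closure already gives
  closure under the inverse permutation.\<close>

lemma permutes_closed_image:
  assumes "f permutes D" "finite S" "\<And>x. x \<in> S \<Longrightarrow> f x \<in> S"
  shows "f x \<in> S \<longleftrightarrow> x \<in> S"
proof -
  have "f ` S = S"
    using assms by (intro endo_inj_surj) (auto intro: permutes_inj_on)
  then show ?thesis using permutes_inj[OF assms(1)] by (metis inj_image_mem_iff)
qed

lemma permutes_bij_betw:
  assumes "f permutes D" "finite S" "\<And>x. x \<in> S \<Longrightarrow> f x \<in> S"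
  shows "bij_betw f S S"
  using endo_inj_surj[of S f] permutes_inj_on[OF assms(1), of S] assms(2,3)
  by (auto simp: bij_betw_def)

lemma orbit_closed:
  assumes "y \<in> orbit f x" "x \<in> S" "\<And>z. z \<in> S \<Longrightarrow> f z \<in> S"
  shows "y \<in> S"
  using assms by induction auto

text \<open>Vertices and faces are images of darts. Two such families correspond as soon as they
  identify the same pairs of darts, and this is how the later bijections of vertices and faces
  arise.\<close>

lemma bij_betw_images:
  assumes "\<And>x y. x \<in> S \<Longrightarrow> y \<in> S \<Longrightarrow> f x = f y \<longleftrightarrow> g x = g y"
  shows "\<exists>k. bij_betw k (f ` S) (g ` S) \<and> (\<forall>x\<in>S. k (f x) = g x)"
proof -
  define k where "k = (\<lambda>u. g (SOME x. x \<in> S \<and> f x = u))"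
  have k: "k (f x) = g x" if "x \<in> S" for x
  proof -
    have "(SOME y. y \<in> S \<and> f y = f x) \<in> S \<and> f (SOME y. y \<in> S \<and> f y = f x) = f x"
      using that by (intro someI) auto
    then show ?thesis unfolding k_def using assms[OF _ that] by metis
  qed
  have "bij_betw k (f ` S) (g ` S)"
  proof (rule bij_betw_imageI)
    show "inj_on k (f ` S)" using assms k by (intro inj_onI) (metis imageE)
    show "k ` f ` S = g ` S" using k by (force simp: image_image)
  qed
  with k show ?thesis by auto
qed

lemma card_images:
  assumes "\<And>x y. x \<in> S \<Longrightarrow> y \<in> S \<Longrightarrow> f x = f y \<longleftrightarrow> g x = g y"
  shows "card (f ` S) = card (g ` S)"
proof -
  have "\<exists>k. bij_betw k (f ` S) (g ` S) \<and> (\<forall>x\<in>S. k (f x) = g x)"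
    by (rule bij_betw_images) (fact assms)
  then show ?thesis by (auto intro: bij_betw_same_card)
qed

section \<open>Labelled bipartite maps\<close>

text \<open>\<open>transpose q t \<circ> f\<close> inserts the fixed point \<open>q\<close> into a
  cycle just before \<open>t\<close>. A search that passes there makes a detour through
  \<open>q\<close>, which is no target.\<close>

lemma hits_transpose:
  assumes "hits f A x y" "q \<notin> A" "f q = q" "x \<noteq> q" "inj f"
  shows "hits (transpose q t \<circ> f) A x y"
  using assms
proof (induction rule: hits.induct)
  case (now x)
  have "f x \<noteq> q" using now by (metis injD)
  show ?case
  proof (cases "f x = t")
    case True
    then have "hits (transpose q t \<circ> f) A q (f x)"
      using now by (subst hits_iff) auto
    then show ?thesis using now True by (subst hits_iff) auto
  next
    case False
    then show ?thesis using now \<open>f x \<noteq> q\<close> by (subst hits_iff) (auto simp: transpose_def)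
  qed
next
  case (later x y)
  have "f x \<noteq> q" using later by (metis injD)
  then have IH: "hits (transpose q t \<circ> f) A (f x) y" using later.IH later.prems by blast
  show ?case
  proof (cases "f x = t")
    case True
    then have "(transpose q t \<circ> f) q = f x" using later by simp
    then have "hits (transpose q t \<circ> f) A q y"
      using IH later by (subst hits_iff) (simp add: comp_def)
    then show ?thesis using later True by (subst hits_iff) (simp add: comp_def)
  next
    case False
    then have "(transpose q t \<circ> f) x = f x" using \<open>f x \<noteq> q\<close> by simp
    then show ?thesis using IH later.hyps by (subst hits_iff) (simp add: comp_def)
  qed
qed

text \<open>
  The zipping of a light face, by insertion of its edges in decreasing order of labels: if \<open>e\<close> has
  least label, it is inserted before \<open>h = \<phi> e\<close> in a cycle of \<open>\<phi>\<close>, and the reverse of \<open>e\<close> is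
  inserted in a cycle of \<open>C\<close> before \<open>h\<close> or before the reverse of \<open>h\<close>, whichever has the right label.
\<close>

lemma zip_exists:
  fixes lab :: "'a \<Rightarrow> int"
  assumes "finite U" "\<And>x. i (i x) = x" "U \<inter> i ` U = {}"
    and "\<And>x. x \<in> U \<Longrightarrow> lab (i x) = lab x + 1"
    and "\<phi> permutes U" "\<And>x. x \<in> U \<Longrightarrow> lab (\<phi> x) \<le> lab x + 1"
  shows "\<exists>C. C permutes U \<union> i ` U \<and> (\<forall>x \<in> U \<union> i ` U. lab (C x) = lab x) \<and>
    (\<forall>x\<in>U. hits C U x x \<and> hits (C \<circ> i) U x (\<phi> x))"
  using assms(1,3-)
proof (induction U arbitrary: \<phi> rule: finite_ranking_induct[where f = "\<lambda>x. - lab x"])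
  case empty
  then show ?case by (intro exI[of _ id]) auto
next
  case (insert e S)
  note ii = assms(2)
  show ?case
  proof (cases "e \<in> S")
    case True
    then have "insert e S = S" by auto
    then show ?thesis using insert.IH insert.prems by metis
  next
    case eS: False
    have ie: "i e \<noteq> e" "i e \<notin> S" and iS: "\<And>x. x \<in> S \<Longrightarrow> i x \<notin> S" "\<And>x. x \<in> S \<Longrightarrow> i x \<noteq> e"
      using insert.prems(1) by auto
    have min: "lab e \<le> lab x" if "x \<in> S" for x using insert.hyps(2)[OF that] by simp
    define h where "h = \<phi> e"
    \<comment> \<open>The edge \<open>e\<close> is cut out of its cycle; its predecessor is joined
      to \<open>h\<close>.\<close>
    define \<phi>' where "\<phi>' = transpose e h \<circ> \<phi>"
    have \<phi>'_perm: "\<phi>' permutes S"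
      unfolding \<phi>'_def h_def by (rule permutes_insert_lemma) (fact insert.prems)
    have h_in: "h = e \<or> h \<in> S"
      using permutes_in_image[OF insert.prems(3), of e] by (auto simp: h_def)
    have \<phi>: "\<phi> x = transpose e h (\<phi>' x)" for x by (simp add: \<phi>'_def)
    have lab_h: "lab h = lab e \<or> lab h = lab e + 1"
      using h_in min[of h] insert.prems(4)[of e] by (auto simp: h_def)
    \<comment> \<open>The minimality of \<open>e\<close> is essential here: the predecessor of
      \<open>e\<close> has label at least \<open>lab e\<close>, so its new step to \<open>h\<close>
      still rises by at most one.\<close>
    have lab_\<phi>': "lab (\<phi>' x) \<le> lab x + 1" if "x \<in> S" for x
    proof (cases "\<phi> x = e")
      case True
      then show ?thesis using lab_h min[OF that] by (auto simp: \<phi>'_def)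
    next
      case False
      moreover have "\<phi> x \<noteq> h"
        using permutes_inj[OF insert.prems(3)] eS that by (auto simp: h_def dest: injD)
      ultimately show ?thesis
        using insert.prems(4)[of x] that by (simp add: \<phi>'_def transpose_def)
    qed
    have "\<exists>C. C permutes S \<union> i ` S \<and> (\<forall>x \<in> S \<union> i ` S. lab (C x) = lab x) \<and>
        (\<forall>x\<in>S. hits C S x x \<and> hits (C \<circ> i) S x (\<phi>' x))"
      by (rule insert.IH) (use insert.prems(1,2) \<phi>'_perm lab_\<phi>' in auto)
    then obtain C' where C': "C' permutes S \<union> i ` S" "\<forall>x \<in> S \<union> i ` S. lab (C' x) = lab x"
      "\<And>x. x \<in> S \<Longrightarrow> hits C' S x x" "\<And>x. x \<in> S \<Longrightarrow> hits (C' \<circ> i) S x (\<phi>' x)"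
      by blast
    \<comment> \<open>The dart \<open>i e\<close> has label \<open>lab e + 1\<close> and must join a
      vertex of this label: the start of \<open>h\<close> if \<open>h\<close> is that high,
      otherwise its upper end. For \<open>h = e\<close> the choice is \<open>i e\<close> and the
      transposition is the identity.\<close>
    define t where "t = (if lab h = lab e then i h else h)"
    define C where "C = transpose (i e) t \<circ> C'"
    define F' where "F' = C' \<circ> i"
    have F: "C \<circ> i = transpose (i e) t \<circ> F'" by (simp add: C_def F'_def comp_assoc)
    have e_notin: "e \<notin> S \<union> i ` S" "i e \<notin> S \<union> i ` S"
      using eS ie iS ii by (auto, metis)
    have fixC: "C' e = e" "C' (i e) = i e"
      using e_notin by (auto intro: permutes_not_in[OF C'(1)])
    have t_ne: "t \<noteq> e" using h_in ie iS by (auto simp: t_def)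
    have t_cases: "t = i e \<and> h = e \<or> t = h \<and> h \<in> S \<or> t = i h \<and> h \<in> S \<and> lab h = lab e"
      using h_in by (auto simp: t_def)
    have lab_t: "lab t = lab (i e)"
      using lab_h h_in insert.prems(2) by (auto simp: t_def)
    have perm: "C permutes insert e S \<union> i ` insert e S"
      unfolding C_def
    proof (rule permutes_compose)
      show "C' permutes insert e S \<union> i ` insert e S" by (rule permutes_subset[OF C'(1)]) auto
      show "transpose (i e) t permutes insert e S \<union> i ` insert e S"
        using t_cases by (intro permutes_swap_id) auto
    qed
    have lab_C': "lab (C' x) = lab x" for x
      using C'(2) permutes_not_in[OF C'(1), of x] by metis
    have lab_C: "lab (C x) = lab x" for x
      using lab_C'[of x] lab_t by (auto simp: C_def transpose_def)
    have C'_in: "C' x \<in> S \<union> i ` S \<longleftrightarrow> x \<in> S \<union> i ` S" for x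
      by (rule permutes_in_image[OF C'(1)])
    have ret: "hits C (insert e S) x x" if "x \<in> insert e S" for x
    proof (cases "x = e")
      case True
      have "C e = e" using fixC t_ne ie by (simp add: C_def transpose_def)
      then show ?thesis using True hits.now[of C e "insert e S"] by simp
    next
      case False
      then have "x \<in> S" using that by simp
      then have "hits C' (insert e S) x x"
        using e_notin C'_in by (intro hits_cong[OF C'(3), where Q = "S \<union> i ` S"]) auto
      moreover have "x \<noteq> i e" using \<open>x \<in> S\<close> ie by auto
      ultimately show ?thesis
        unfolding C_def using ie fixC permutes_inj[OF C'(1)] by (intro hits_transpose) auto
    qed
    have injF': "inj F'"
      unfolding F'_def using permutes_inj[OF C'(1)] ii by (metis comp_apply injD injI)
    have F'_in: "F' x \<in> S \<union> i ` S" if "x \<in> S \<union> i ` S" for x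
      unfolding F'_def comp_apply C'_in using that ii by auto
    have F'_e: "F' (i e) = e" "F' e = i e" by (simp_all add: F'_def ii fixC)
    \<comment> \<open>If \<open>h\<close> also has the least label, no reverse of an edge can share
      its vertex, because these all start at least one level higher. So \<open>h\<close> is alone in
      its cycle of \<open>C'\<close>.\<close>
    have F'_ih: "F' (i h) = h" if "h \<in> S" "lab h = lab e"
    proof -
      have "C' h \<in> S"
      proof (rule ccontr)
        assume "C' h \<notin> S"
        then have "C' h \<in> i ` S" using C'_in[of h] that(1) by blast
        then obtain s where "s \<in> S" "C' h = i s" by blast
        then show False using lab_C'[of h] insert.prems(2)[of s] min[of s] that by auto
      qed
      then have "C' h = h" using C'(3)[OF that(1)] by (subst (asm) hits_iff) auto
      then show ?thesis by (simp add: F'_def ii)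
    qed
    \<comment> \<open>For \<open>F'\<close>, every entrance to \<open>h\<close> passes through
      \<open>t\<close>; now the walk is diverted there to \<open>i e\<close> and on to
      \<open>e\<close>. Thus a return to \<open>h\<close> becomes a return to \<open>e\<close>,
      which undoes the cut. A walk that begins at \<open>t\<close> outside \<open>S\<close> starts
      behind the diversion and is excluded.\<close>
    have step: "hits (C \<circ> i) (insert e S) x (transpose e h y)"
      if "hits F' S x y" "x \<in> S \<union> i ` S" "x \<in> S \<or> x \<noteq> t" for x y
      using that
    proof (induction rule: hits.induct)
      case (now x)
      have Fx: "F' x \<noteq> i e" "F' x \<noteq> e" using F'_in[OF now(2)] e_notin by metis+
      show ?case
      proof (cases "F' x = t")
        case True
        then have th: "t = h" "h \<in> S" using now t_cases ie iS by auto
        then have "hits (C \<circ> i) (insert e S) (i e) e"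
          using F'_e ie e_notin t_ne by (subst hits_iff) (auto simp: F transpose_def)
        then show ?thesis using True th ie by (subst hits_iff) (auto simp: F)
      next
        case False
        have "F' x \<noteq> h"
        proof
          assume "F' x = h"
          then have "t = i h \<and> h \<in> S \<and> lab h = lab e" using False t_cases Fx by auto
          moreover from this have "x = i h" using injF' F'_ih \<open>F' x = h\<close> by (metis injD)
          ultimately show False using now.prems iS by auto
        qed
        then show ?thesis using now False Fx by (subst hits_iff) (auto simp: F transpose_def)
      qed
    next
      case (later x y)
      have Fx: "F' x \<noteq> i e" "F' x \<noteq> e" using F'_in[OF later.prems(1)] e_notin by metis+
      show ?case
      proof (cases "F' x = t")
        case True
        then have th: "t = i h" "h \<in> S" "lab h = lab e" using later t_cases Fx by auto
        then have "y = h" using later(2) True F'_ih by (subst (asm) hits_iff) auto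
        have "hits (C \<circ> i) (insert e S) (i e) e"
          using F'_e ie e_notin t_ne by (subst hits_iff) (auto simp: F transpose_def)
        then show ?thesis using True th ie \<open>y = h\<close> by (subst hits_iff) (auto simp: F)
      next
        case False
        then have "hits (C \<circ> i) (insert e S) (F' x) (transpose e h y)"
          using later.IH[OF F'_in[OF later.prems(1)]] by blast
        moreover have "(C \<circ> i) x = F' x" using False Fx by (simp add: F transpose_def)
        ultimately show ?thesis using later.hyps Fx by (subst hits_iff) (simp add: comp_def)
      qed
    qed
    have "hits (C \<circ> i) (insert e S) x (\<phi> x)" if "x \<in> insert e S" for x
    proof (cases "x = e")
      case False
      then have "x \<in> S" using that by simp
      then show ?thesis unfolding \<phi>[of x]
        using C'(4)[of x] by (intro step) (auto simp: F'_def)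
    next
      case True
      \<comment> \<open>From \<open>e\<close> the walk enters the old cycle at \<open>t\<close>,
        which is \<open>h\<close> or one step before it.\<close>
      have Fe: "(C \<circ> i) e = t" using F'_e by (simp add: F)
      from t_cases show ?thesis
      proof (elim disjE conjE)
        assume h: "t = i e" "h = e"
        then have "hits (C \<circ> i) (insert e S) (i e) e"
          using F'_e by (subst hits_iff) (auto simp: F)
        then show ?thesis using True Fe h ie by (subst hits_iff) (auto simp: h_def[symmetric])
      next
        assume h: "t = h" "h \<in> S"
        then show ?thesis using True Fe by (subst hits_iff) (auto simp: h_def[symmetric])
      next
        assume h: "t = i h" "h \<in> S" "lab h = lab e"
        have "h \<noteq> i e" using h(2) e_notin by auto
        moreover have "h \<noteq> t" using h(1,2) iS(1)[of h] by metis
        ultimately have "hits (C \<circ> i) (insert e S) t h"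
          using h F'_ih by (subst hits_iff) (auto simp: F transpose_def)
        moreover have "t \<notin> insert e S" using h t_ne iS by auto
        ultimately show ?thesis using True Fe by (subst hits_iff) (auto simp: h_def[symmetric])
      qed
    qed
    with perm lab_C ret show ?thesis by blast
  qed
qed

text \<open>
  The bipartite map \<open>B\<close>: \<open>lab d\<close> is the label of the initial vertex of the dart \<open>d\<close>, and \<open>F\<close> runs
  around the face on the right of a dart.
\<close>

locale level_map =
  fixes D U :: "'a set" and i R :: "'a \<Rightarrow> 'a" and lab :: "'a \<Rightarrow> int"
  assumes finite_D: "finite D" and U_sub: "U \<subseteq> D"
    and i_perm: "i permutes D" and i_i: "d \<in> D \<Longrightarrow> i (i d) = d"
    and i_U: "d \<in> D \<Longrightarrow> i d \<in> U \<longleftrightarrow> d \<notin> U"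
    and R_perm: "R permutes D" and lab_R: "d \<in> D \<Longrightarrow> lab (R d) = lab d"
    and lab_i: "d \<in> U \<Longrightarrow> lab (i d) = lab d + 1"
begin

abbreviation "F \<equiv> \<lambda>d. R (i d)"

lemma i_D [simp]: "i d \<in> D \<longleftrightarrow> d \<in> D" and R_D [simp]: "R d \<in> D \<longleftrightarrow> d \<in> D"
  using permutes_in_image[OF i_perm] permutes_in_image[OF R_perm] by auto

lemma F_perm: "F permutes D"
  using permutes_compose[OF i_perm R_perm] by (simp add: comp_def)

lemma finite_U: "finite U" using finite_subset[OF U_sub finite_D] .

lemma U_D: "d \<in> U \<Longrightarrow> d \<in> D" using U_sub by auto

lemma i_inj: "i x = i y \<longleftrightarrow> x = y" using permutes_inj[OF i_perm] by (auto dest: injD)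

lemma R_inj: "R x = R y \<longleftrightarrow> x = y" using permutes_inj[OF R_perm] by (auto dest: injD)

lemma lab_i': "d \<in> D \<Longrightarrow> d \<notin> U \<Longrightarrow> lab (i d) = lab d - 1"
  using lab_i[of "i d"] i_i[of d] i_U[of d] by simp

text \<open>After the first step, at level \<open>lab (i d)\<close>, the walk loses one level at
  each dart outside \<open>U\<close>. So equality leaves no time for a further step.\<close>

lemma hits_F_lab:
  assumes "hits F U d y" "d \<in> D"
  shows "lab y \<le> lab (i d) \<and> (lab y = lab (i d) \<longrightarrow> F d = y)"
  using assms
proof (induction rule: hits.induct)
  case (now x) then show ?case by (simp add: lab_R)
next
  case (later x y)
  then have "lab y \<le> lab (i (F x))" "F x \<notin> U" "F x \<in> D" by auto
  then have "lab y \<le> lab (F x) - 1" using lab_i' by simp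
  then show ?case using later.prems by (simp add: lab_R)
qed

text \<open>A face without up-darts would lose a level at every step and could never close.\<close>

lemma F_meets_U:
  assumes "d \<in> D" shows "\<exists>y. hits F U d y"
proof (rule ccontr)
  assume no: "\<not> ?thesis"
  have orb: "d \<in> orbit F d" by (rule permutes_self_in_orbit[OF F_perm finite_D])
  have out: "(F ^^ n) d \<in> D - U" for n
  proof -
    have "(F ^^ n) d \<in> orbit F d" by (rule funpow_in_orbit[OF orb])
    then show ?thesis
      using no hits_ex[of "(F ^^ n) d" F d U] permutes_orbit_subset[OF F_perm assms] by auto
  qed
  have "lab ((F ^^ n) d) = lab d - int n" for n
  proof (induction n)
    case (Suc n)
    then show ?case using out[of n] by (simp add: lab_R lab_i')
  qed simp
  moreover have "\<exists>n. d = (F ^^ n) d \<and> 0 < n" using orb unfolding orbit_altdef mem_Collect_eq .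
  ultimately show False by (metis diff_eq_eq add_cancel_right_right of_nat_0_eq_iff less_irrefl)
qed

lemma return_maps:
  obtains n a where "n permutes U" "a permutes U" "\<And>x. x \<in> U \<Longrightarrow> hits R U x (n x)"
    "\<And>x. x \<in> U \<Longrightarrow> hits F U x (a x)"
proof -
  define ret where "ret f = (\<lambda>x. if x \<in> U then first_hit f U x else x)" for f
  have hits: "hits f U x (ret f x)" if "x \<in> U" "f permutes D" for f x
    using that permutes_hits_return[OF that(2) finite_D that(1)] by (simp add: ret_def)
  have "ret f permutes U" if "f permutes D" for f
    by (rule hits_permutes[OF permutes_inj[OF that] finite_U hits[OF _ that]]) (auto simp: ret_def)
  then show ?thesis using that[of "ret R" "ret F"] hits R_perm F_perm by blast
qed

text \<open>Turning the levels upside down exchanges up-darts and down-darts. This is what makes one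
  theory serve both hypermaps and mobiles.\<close>

lemma dual: "level_map D (D - U) i R (\<lambda>d. - lab d)"
  by unfold_locales
    (use finite_D i_perm i_i i_U R_perm lab_R lab_i' permutes_in_image[OF i_perm] in auto)

text \<open>The increments of \<open>lab\<close> around a closed face sum to zero. This is the
  source of the equality between the degree of a dark face and that of its black vertex.\<close>

lemma card_F_orbit:
  assumes "d \<in> D"
  shows "card (orbit F d \<inter> U) = card (orbit F d - U)"
proof -
  have cyc: "cyclic_on F (orbit F d)" by (rule cyclic_on_orbit[OF F_perm finite_D])
  have sub: "orbit F d \<subseteq> D" by (rule permutes_orbit_subset[OF F_perm assms])
  have fin: "finite (orbit F d)" using sub finite_D by (rule finite_subset)
  have bij: "bij_betw F (orbit F d) (orbit F d)"
  proof (rule bij_betw_imageI)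
    show inj: "inj_on F (orbit F d)" using permutes_inj_on[OF F_perm] .
    show "F ` orbit F d = orbit F d"
      using cyclic_on_inI[OF cyc] inj fin by (intro endo_inj_surj) auto
  qed
  have "(\<Sum>x\<in>orbit F d. lab (F x)) = (\<Sum>x\<in>orbit F d. lab x)"
    by (rule sum.reindex_bij_betw[OF bij])
  also have "(\<Sum>x\<in>orbit F d. lab (F x)) =
      (\<Sum>x\<in>orbit F d. lab x + (if x \<in> U then 1 else - 1))"
    using sub by (intro sum.cong) (auto simp: lab_R lab_i lab_i')
  finally have "(\<Sum>x\<in>orbit F d. if x \<in> U then 1 else - 1 :: int) = 0"
    by (simp add: sum.distrib)
  then show ?thesis
    using fin by (simp add: sum.If_cases Diff_eq)
qed

end

text \<open>
  The case where each vertex has at most one upward dart. The general case reduces to it by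
  composing \<open>R\<close> with the inverse of its first-return map to \<open>U\<close>.
\<close>

locale noose_map = level_map +
  fixes \<phi> :: "'a \<Rightarrow> 'a"
  assumes R_ret: "e \<in> U \<Longrightarrow> hits R U e e" and F_ret: "e \<in> U \<Longrightarrow> hits F U e (\<phi> e)"
begin

lemma \<phi>_U: "e \<in> U \<Longrightarrow> \<phi> e \<in> U" using hits_in F_ret by metis

abbreviation "upper k \<equiv> {z \<in> U. k \<le> lab z}"

text \<open>
  Once the face traversal has come down along \<open>i x\<close>, it visits only labels below that of \<open>x\<close>
  before it reaches \<open>x\<close>. This makes \<open>R\<close> a function of \<open>\<phi>\<close> and of the labels.
\<close>

lemma descend:
  "x \<in> U \<Longrightarrow> hits F U (i x) y \<Longrightarrow> y = x \<or> lab y < lab x \<and> hits \<phi> (upper (lab x)) y x"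
proof (induction "nat (lab x - Min (lab ` D))" arbitrary: x y rule: less_induct)
  case (less x y)
  \<comment> \<open>A down-dart \<open>p\<close> at the level of \<open>x\<close> has its reverse
    \<open>u\<close> one level lower, so the induction applies to \<open>u\<close>; the hypothesis
    on \<open>i p\<close> then continues the search from \<open>u\<close> to
    \<open>x\<close>.\<close>
  have below: "lab y < lab x \<and> hits \<phi> (upper (lab x)) y x"
    if p: "p \<in> D" "p \<notin> U" "lab p = lab x" and y: "hits F U p y"
      and ux: "hits \<phi> (upper (lab x)) (i p) x" for p y
  proof -
    define u where "u = i p"
    have u: "u \<in> U" "i u = p" "lab u = lab x - 1"
      using p lab_i'[of p] by (auto simp: u_def i_i i_U)
    have "y = u \<or> lab y < lab u \<and> hits \<phi> (upper (lab u)) y u"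
    proof (rule less.hyps)
      have "Min (lab ` D) \<le> lab u" using finite_D U_D[OF u(1)] by auto
      then show "nat (lab u - Min (lab ` D)) < nat (lab x - Min (lab ` D))" using u(3) by simp
    qed (use u y in auto)
    moreover have "upper (lab x) \<subseteq> upper (lab u)" "u \<notin> upper (lab x)" using u(3) by auto
    ultimately show ?thesis
      using u(3) ux[folded u_def] hits_trans[of \<phi> "upper (lab u)" y u "upper (lab x)" x] by auto
  qed
  \<comment> \<open>Induction along the rest of the \<open>R\<close>-cycle back to \<open>x\<close>:
    for each down-dart \<open>p\<close> on the way, \<open>x\<close> is the first edge of level
    \<open>lab x\<close> or more that follows \<open>i p\<close> in its
    \<open>\<phi>\<close>-cycle.\<close>
  have inner: "lab y < lab x \<and> hits \<phi> (upper (lab x)) y x"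
    if "hits R U p z" "z = x" "p \<in> D" "p \<notin> U" "lab p = lab x" "hits F U p y" for p z y
    using that
  proof (induction arbitrary: y rule: hits.induct)
    case (now p)
    then have ip: "i p \<in> U" "i (i p) = p" by (simp_all add: i_U i_i)
    have "\<phi> (i p) = R p" using F_ret[OF ip(1)] ip(2) now.hyps by (subst (asm) hits_iff) auto
    then have "hits \<phi> (upper (lab x)) (i p) x" using now ip by (subst hits_iff) auto
    then show ?case using below now.prems by blast
  next
    case (later p z)
    then have ip: "i p \<in> U" "i (i p) = p" by (simp_all add: i_U i_i)
    have "hits F U (R p) (\<phi> (i p))" using F_ret[OF ip(1)] ip(2) later.hyps by (subst (asm) hits_iff) auto
    then have "lab (\<phi> (i p)) < lab x \<and> hits \<phi> (upper (lab x)) (\<phi> (i p)) x"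
      using later by (intro later.IH) (auto simp: lab_R)
    then have "hits \<phi> (upper (lab x)) (i p) x" by (subst hits_iff) auto
    then show ?case using below later.prems by blast
  qed
  have Fix: "F (i x) = R x" using U_D[OF less.prems(1)] by (simp add: i_i)
  show ?case
  proof (cases "R x \<in> U")
    case True
    then have "R x = x" using R_ret[OF less.prems(1)] by (subst (asm) hits_iff) auto
    then show ?thesis using less.prems Fix by (subst (asm) hits_iff) auto
  next
    case False
    then have "hits R U (R x) x" using R_ret[OF less.prems(1)] by (subst (asm) hits_iff) auto
    moreover have "hits F U (R x) y" using False less.prems(2) Fix by (subst (asm) hits_iff) auto
    ultimately have "lab y < lab x \<and> hits \<phi> (upper (lab x)) y x"
      using False less.prems U_D by (intro inner[of "R x" x]) (auto simp: lab_R)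
    then show ?thesis ..
  qed
qed

text \<open>The climbing half of the ballot rule: an up-dart right after \<open>i e\<close> ends the
  face walk from \<open>e\<close> at once.\<close>

lemma R_i_in:
  assumes e: "e \<in> U" "R (i e) \<in> U"
  shows "R (i e) = \<phi> e \<and> lab (\<phi> e) = lab e + 1"
proof -
  have "\<phi> e = R (i e)" using F_ret[OF e(1)] e by (subst (asm) hits_iff) simp
  then show ?thesis using lab_R[of "i e"] lab_i[of e] U_D[of e] e by simp
qed

text \<open>The other half: if \<open>i e\<close> is followed by a down-dart \<open>i e'\<close>,
  the face walk from \<open>e\<close> comes down along it, and \<open>descend\<close> at
  \<open>e'\<close> locates \<open>e'\<close> in the \<open>\<phi>\<close>-cycle of
  \<open>e\<close>.\<close>

lemma R_i_out:
  assumes "e \<in> U" "R (i e) \<notin> U"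
  shows "i (R (i e)) \<in> U" "lab (i (R (i e))) = lab e" "lab (\<phi> e) \<le> lab e"
    "hits \<phi> (upper (lab e)) e (i (R (i e)))"
proof -
  define e' where "e' = i (R (i e))"
  have e': "e' \<in> U" "i e' = R (i e)" "lab e' = lab e"
    using assms U_D[OF assms(1)] by (auto simp: e'_def i_U i_i lab_i' lab_R lab_i)
  have "hits F U (i e') (\<phi> e)"
    using F_ret[OF assms(1)] assms(2) e'(2) by (subst (asm) hits_iff) auto
  from descend[OF e'(1) this] have *: "\<phi> e = e' \<or> lab (\<phi> e) < lab e' \<and> hits \<phi> (upper (lab e)) (\<phi> e) e'"
    using e' by auto
  then have "hits \<phi> (upper (lab e)) e e'" using e' by (subst hits_iff) auto
  with * e' show "i (R (i e)) \<in> U" "lab (i (R (i e))) = lab e" "lab (\<phi> e) \<le> lab e"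
    "hits \<phi> (upper (lab e)) e (i (R (i e)))"
    unfolding e'_def[symmetric] by auto
qed

lemma \<phi>_inj: "inj_on \<phi> U"
proof (rule inj_onI)
  fix x y assume "x \<in> U" "y \<in> U" "\<phi> x = \<phi> y"
  then have "hits F U x (\<phi> x)" "hits F U y (\<phi> x)" using F_ret by metis+
  then show "x = y" using hits_inj permutes_inj[OF F_perm] \<open>x \<in> U\<close> \<open>y \<in> U\<close> by metis
qed

text \<open>By the ballot rule, either \<open>R (i a)\<close> or its reverse is an iterate of
  \<open>\<phi>\<close> at \<open>a\<close>.\<close>

lemma closed_i:
  assumes "A \<subseteq> U" "\<And>a. a \<in> A \<Longrightarrow> \<phi> a \<in> A" "a \<in> A"
  shows "R (i a) \<in> A \<union> i ` A"
proof (cases "R (i a) \<in> U")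
  case True then show ?thesis using R_i_in[of a] assms by auto
next
  case False
  then have "i (R (i a)) \<in> A"
    using R_i_out(4)[of a] assms hits_closed[of \<phi> _ a _ A] by blast
  moreover have "i (i (R (i a))) = R (i a)" using assms U_D by (auto simp: i_i)
  ultimately show ?thesis by (metis UnI2 imageI)
qed

text \<open>The ballot rule is silent at an up-dart \<open>x\<close> of \<open>A\<close>. But
  \<open>U - A\<close> is closed under \<open>\<phi>\<close> as well, so if the next dart belonged
  to an edge of \<open>U - A\<close>, the walk around the vertex could only return to
  \<open>U\<close> inside \<open>U - A\<close>, whereas it returns to \<open>x\<close>.\<close>

lemma closed:
  assumes A: "A \<subseteq> U" "\<And>a. a \<in> A \<Longrightarrow> \<phi> a \<in> A" and x: "x \<in> A \<union> i ` A"
  shows "R x \<in> A \<union> i ` A"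
proof (cases "x \<in> A")
  case False
  then show ?thesis using x closed_i[OF A] by auto
next
  case xA: True
  show ?thesis
  proof (cases "R x \<in> U")
    case True
    moreover have "hits R U x x" using R_ret xA A(1) by blast
    ultimately have "R x = x" by (subst (asm) hits_iff) auto
    then show ?thesis using xA by simp
  next
    case False
    define B where "B = U - A"
    have finA: "finite A" using A(1) finite_U finite_subset by blast
    have "\<phi> ` A = A"
      using A finA inj_on_subset[OF \<phi>_inj A(1)] by (intro endo_inj_surj) auto
    then have B: "B \<subseteq> U" "\<And>b. b \<in> B \<Longrightarrow> \<phi> b \<in> B"
      using \<phi>_U \<phi>_inj A(1) unfolding B_def by (auto dest: inj_onD)
    have ret: "b \<in> B" if "hits R U p b" "p \<in> i ` B" for p b
      using that
    proof (induction rule: hits.induct)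
      case (now p)
      then obtain b where "b \<in> B" "p = i b" by blast
      then have "R p \<in> B \<union> i ` B" using closed_i[OF B] by blast
      moreover have "R p \<notin> i ` B" using now.hyps B(1) U_D by (auto simp: i_U)
      ultimately show ?case by blast
    next
      case (later p b)
      then have "R p \<in> B \<union> i ` B" using closed_i[OF B] by auto
      then show ?case using later B(1) by auto
    qed
    have xD: "x \<in> D" using xA A(1) U_D by auto
    have "i (R x) \<in> U" "i (i (R x)) = R x" using False xD by (auto simp: i_U i_i)
    moreover have "i (R x) \<notin> B"
    proof
      assume "i (R x) \<in> B"
      then have "R x \<in> i ` B" using xD by (metis R_D i_i imageI)
      moreover have "hits R U (R x) x"
      proof -
        have "hits R U x x" using R_ret xA A(1) by blast
        then show ?thesis using False by (subst (asm) hits_iff) auto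
      qed
      ultimately show False using ret xA by (auto simp: B_def)
    qed
    ultimately have "i (R x) \<in> A" unfolding B_def by auto
    then show ?thesis using \<open>i (i (R x)) = R x\<close> by (metis UnI2 imageI)
  qed
qed

lemma \<phi>_orbit_U: "e \<in> U \<Longrightarrow> orbit \<phi> e \<subseteq> U"
  using orbit_closed[of _ \<phi> e U] \<phi>_U by auto

text \<open>At the highest edges of a \<open>\<phi>\<close>-cycle the climbing case cannot occur, so
  \<open>R\<close> goes from reverse to reverse through the successive highest edges. Their common
  upper end is the tip of the zipped face.\<close>

lemma top_orbit:
  assumes e: "e \<in> U" "\<And>y. y \<in> orbit \<phi> e \<Longrightarrow> lab y \<le> lab e"
  shows "orbit R (i e) = i ` {y \<in> orbit \<phi> e. lab y = lab e}"
proof -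
  have finO: "finite (orbit \<phi> e)" using \<phi>_orbit_U[OF e(1)] finite_U finite_subset by blast
  have self: "e \<in> orbit \<phi> e"
  proof -
    have "(\<lambda>x. if x \<in> U then \<phi> x else x) permutes U"
      using hits_permutes[OF permutes_inj[OF F_perm] finite_U] F_ret by simp
    then have "e \<in> orbit (\<lambda>x. if x \<in> U then \<phi> x else x) e"
      using permutes_self_in_orbit finite_U by metis
    also have "\<dots> = orbit \<phi> e"
      using e(1) \<phi>_U by (intro orbit_cong0[of e U]) auto
    finally show ?thesis .
  qed
  define A where "A = {y \<in> orbit \<phi> e. lab y = lab e}"
  have AU: "A \<subseteq> U" using \<phi>_orbit_U[OF e(1)] by (auto simp: A_def)
  define g where "g = i \<circ> R \<circ> i"
  have g: "g a \<in> A" "hits \<phi> A a (g a)" "R (i a) = i (g a)" if "a \<in> A" for a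
  proof -
    have a: "a \<in> U" "a \<in> orbit \<phi> e" "lab a = lab e" using that AU by (auto simp: A_def)
    have out: "R (i a) \<notin> U"
      using R_i_in[OF a(1)] e(2)[OF orbit.step[OF a(2)]] a(3) by auto
    have h: "hits \<phi> (upper (lab e)) a (g a)" and l: "lab (g a) = lab e"
      using R_i_out[OF a(1) out] a(3) by (simp_all add: g_def)
    have "g a \<in> orbit \<phi> e" using hits_orbit[OF h] a(2) orbit_trans by metis
    then show "g a \<in> A" using l by (simp add: A_def)
    show "R (i a) = i (g a)" using U_D[OF a(1)] by (simp add: g_def i_i)
    show "hits \<phi> A a (g a)"
    proof (rule hits_cong[OF h a(2)])
      show "upper (lab e) \<inter> orbit \<phi> e = A \<inter> orbit \<phi> e"
        using e(2) \<phi>_orbit_U[OF e(1)] by (auto simp: A_def intro: antisym)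
    qed (auto intro: orbit.step)
  qed
  have eA: "e \<in> A" using self by (simp add: A_def)
  have "orbit \<phi> e \<inter> A = orbit g e" by (rule orbit_hits[OF g(2) eA])
  then have "A = orbit g e" by (auto simp: A_def)
  moreover have "i ` orbit g e = orbit R (i e)"
  proof (rule orbit_inverse)
    show "e \<in> orbit g e" using eA calculation by simp
    show "R (i x) = i (g x)" if "x \<in> orbit g e" for x using g(3) that calculation by simp
  qed
  ultimately show ?thesis by (simp add: A_def)
qed

lemma top_of_orbit:
  assumes x: "x \<in> D" "orbit R x \<inter> U = {}" and y: "y \<in> orbit \<phi> (i x)"
  shows "lab y \<le> lab (i x)"
proof -
  have xo: "x \<in> orbit R x" by (rule permutes_self_in_orbit[OF R_perm finite_D])
  have sub: "orbit R x \<subseteq> D" by (rule permutes_orbit_subset[OF R_perm x(1)])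
  define B where "B = i ` orbit R x"
  have labx: "lab z = lab x" if "z \<in> orbit R x" for z
    using that sub x(1) by (induction) (auto simp: lab_R)
  have B: "u \<in> U" "lab u = lab (i x)" "i (R (i u)) \<in> B" "R (i u) \<notin> U" if uB: "u \<in> B" for u
  proof -
    obtain z where z: "z \<in> orbit R x" "u = i z" using uB by (auto simp: B_def)
    have zz: "z \<in> D" "z \<notin> U" "x \<notin> U" "R z \<in> orbit R x" using z sub x(2) xo by (auto intro: orbit.step)
    show "u \<in> U" using z zz by (simp add: i_U)
    show "lab u = lab (i x)" using z zz labx[OF z(1)] x(1) by (simp add: lab_i')
    show "i (R (i u)) \<in> B" using z zz by (simp add: i_i B_def)
    show "R (i u) \<notin> U" using z zz x(2) by (auto simp: i_i)
  qed
  \<comment> \<open>The invariant along the cycle: an edge no higher than \<open>i x\<close> whose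
    next edge at that level or above lies in \<open>B\<close>. Elements of \<open>B\<close> have
    exactly this level, so the cycle never rises above it.\<close>
  define Z where "Z = {z \<in> U. lab z \<le> lab (i x) \<and> (\<exists>u\<in>B. hits \<phi> (upper (lab (i x))) z u)}"
  have BZ: "u \<in> Z" if "u \<in> B" for u
    using B[OF that] R_i_out(4)[of u] by (auto simp: Z_def)
  have "y \<in> Z"
  proof (rule orbit_closed[OF y])
    show "i x \<in> Z" using BZ xo by (simp add: B_def)
    fix z assume z: "z \<in> Z"
    then obtain u where u: "u \<in> B" "hits \<phi> (upper (lab (i x))) z u" by (auto simp: Z_def)
    show "\<phi> z \<in> Z"
    proof (cases "\<phi> z \<in> upper (lab (i x))")
      case True
      then have "\<phi> z = u" using u(2) by (subst (asm) hits_iff) auto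
      then show ?thesis using BZ u by simp
    next
      case False
      moreover have "\<phi> z \<in> U" using z \<phi>_U by (auto simp: Z_def)
      moreover have "hits \<phi> (upper (lab (i x))) (\<phi> z) u" using False u(2) by (subst (asm) hits_iff) auto
      ultimately show ?thesis using u by (auto simp: Z_def)
    qed
  qed
  then show ?thesis by (simp add: Z_def)
qed

end

lemma permutes_if_bij_betw:
  "bij_betw f U U \<Longrightarrow> (\<lambda>x. if x \<in> U then f x else x) permutes U"
  by (intro bij_imp_permutes) (auto cong: bij_betw_cong)

section \<open>Light faces and local maxima\<close>

context noose_map
begin

lemma \<phi>_perm: "(\<lambda>x. if x \<in> U then \<phi> x else x) permutes U"
  using hits_permutes[OF permutes_inj[OF F_perm] finite_U] F_ret by simp

lemma \<phi>_orbit_if: "e \<in> U \<Longrightarrow> orbit (\<lambda>x. if x \<in> U then \<phi> x else x) e = orbit \<phi> e"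
  using \<phi>_U by (intro orbit_cong0[of e U]) auto

lemma \<phi>_orbit_eq:
  assumes "e \<in> U" "m \<in> orbit \<phi> e"
  shows "orbit \<phi> m = orbit \<phi> e"
proof -
  have "m \<in> U" using assms \<phi>_orbit_U by auto
  then show ?thesis
    using permutes_orbit_eq_iff[OF \<phi>_perm finite_U, of e m] assms \<phi>_orbit_if by simp
qed

lemma \<phi>_orbit_self: "e \<in> U \<Longrightarrow> e \<in> orbit \<phi> e"
  using permutes_self_in_orbit[OF \<phi>_perm finite_U, of e] \<phi>_orbit_if by simp

lemma light_orbit:
  assumes "f \<in> orbit \<phi> ` U"
  obtains e where "e \<in> U" "f = orbit \<phi> e" "lab e = Max (lab ` f)" "e \<in> f"
    "orbit R (i e) = i ` {x \<in> f. lab x = Max (lab ` f)}"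
proof -
  obtain a where a: "a \<in> U" "f = orbit \<phi> a" using assms by auto
  have fin: "finite f" using a \<phi>_orbit_U finite_U finite_subset by metis
  have "f \<noteq> {}" using a orbit_nonempty by simp
  then have "Max (lab ` f) \<in> lab ` f" using fin by (intro Max_in) auto
  then obtain e where e: "e \<in> f" "lab e = Max (lab ` f)" by auto
  have eU: "e \<in> U" using e a \<phi>_orbit_U by auto
  have fe: "f = orbit \<phi> e" using \<phi>_orbit_eq[of a e] a e by simp
  have "lab y \<le> lab e" if "y \<in> orbit \<phi> e" for y using that e fe fin by simp
  from top_orbit[OF eU this] show ?thesis using that[of e] eU fe e by auto
qed

text \<open>A light face goes to the reverses of its highest edges, which form a single vertex by
  \<open>top_orbit\<close>. By \<open>top_of_orbit\<close> every vertex without up-darts arises in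
  this way.\<close>

lemma light_bij:
  "bij_betw (\<lambda>f. i ` {x \<in> f. lab x = Max (lab ` f)}) (orbit \<phi> ` U) {T \<in> orbit R ` D. T \<inter> U = {}}"
proof (rule bij_betw_imageI)
  let ?k = "\<lambda>f. i ` {x \<in> f. lab x = Max (lab ` f)}"
  show "inj_on ?k (orbit \<phi> ` U)"
  proof (rule inj_onI)
    fix f g assume fg: "f \<in> orbit \<phi> ` U" "g \<in> orbit \<phi> ` U" "?k f = ?k g"
    obtain e where e: "e \<in> U" "f = orbit \<phi> e" "lab e = Max (lab ` f)" "e \<in> f"
      using light_orbit[OF fg(1)] by metis
    have "i e \<in> ?k f" using e by simp
    then have "i e \<in> ?k g" using fg(3) by simp
    then have "e \<in> g" by (auto simp: i_inj)
    moreover obtain a where "a \<in> U" "g = orbit \<phi> a" using fg(2) by auto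
    ultimately show "f = g" using e(2) \<phi>_orbit_eq[of a e] by simp
  qed
  show "?k ` orbit \<phi> ` U = {T \<in> orbit R ` D. T \<inter> U = {}}"
  proof (intro equalityI subsetI)
    fix T assume "T \<in> ?k ` orbit \<phi> ` U"
    then obtain f where f: "f \<in> orbit \<phi> ` U" "T = ?k f" by blast
    obtain e where e: "e \<in> U" "f = orbit \<phi> e" "orbit R (i e) = T"
      using light_orbit[OF f(1)] f(2) by metis
    have "f \<subseteq> U" using e \<phi>_orbit_U by simp
    then have "T \<inter> U = {}" using f(2) U_D by (auto simp: i_U)
    then show "T \<in> {T \<in> orbit R ` D. T \<inter> U = {}}" using e U_D by auto
  next
    fix T assume "T \<in> {T \<in> orbit R ` D. T \<inter> U = {}}"
    then obtain x where x: "x \<in> D" "T = orbit R x" "T \<inter> U = {}" by auto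
    have "x \<in> T" using x permutes_self_in_orbit[OF R_perm finite_D] by simp
    then have ix: "i x \<in> U" using x by (auto simp: i_U)
    have le: "lab y \<le> lab (i x)" if "y \<in> orbit \<phi> (i x)" for y
      using top_of_orbit[OF x(1) _ that] x by simp
    have "finite (orbit \<phi> (i x))" using ix \<phi>_orbit_U finite_U finite_subset by metis
    then have "Max (lab ` orbit \<phi> (i x)) = lab (i x)"
      using le \<phi>_orbit_self[OF ix] by (intro Max_eqI) auto
    moreover have "orbit R (i (i x)) = i ` {y \<in> orbit \<phi> (i x). lab y = lab (i x)}"
      using top_orbit[OF ix le] .
    ultimately have "T = ?k (orbit \<phi> (i x))" using x by (simp add: i_i)
    then show "T \<in> ?k ` orbit \<phi> ` U" using ix by blast
  qed
qed

lemma lab_light: "f \<in> orbit \<phi> ` U \<Longrightarrow> x \<in> i ` {x \<in> f. lab x = Max (lab ` f)} \<Longrightarrow> lab x = Max (lab ` f) + 1"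
  using \<phi>_orbit_U by (auto simp: lab_i subset_iff)

end

text \<open>
  In a hypermap, \<open>\<nu>\<close>, \<open>\<alpha>\<close> and \<open>\<phi>\<close> run around the vertices, the dark faces and the light faces,
  an edge being represented by its dart with the light face on its left.
\<close>

locale split_map = level_map +
  fixes \<nu> \<alpha> \<phi> :: "'a \<Rightarrow> 'a"
  assumes R_hits: "e \<in> U \<Longrightarrow> hits R U e (\<nu> e)" and F_hits: "e \<in> U \<Longrightarrow> hits F U e (\<alpha> e)"
    and \<phi>_U: "e \<in> U \<Longrightarrow> \<phi> e \<in> U" and \<nu>_\<phi>: "e \<in> U \<Longrightarrow> \<nu> (\<phi> e) = \<alpha> e"
begin

text \<open>The map \<open>\<nu>\<close> matters on \<open>U\<close> only; the identity elsewhere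
  turns it into a permutation. Its inverse cuts each vertex that meets \<open>U\<close> into pieces
  with one up-dart each.\<close>

definition "N = (\<lambda>x. if x \<in> U then \<nu> x else x)"
definition "C = inv N \<circ> R"

lemma N_perm: "N permutes U"
  by (rule hits_permutes[OF permutes_inj[OF R_perm] finite_U]) (auto simp: N_def R_hits)

lemma N_C: "N (C x) = R x"
  by (simp add: C_def permutes_inverses[OF N_perm])

lemma inv_N: "x \<in> U \<Longrightarrow> inv N (\<nu> x) = x" "inv N x \<in> U \<longleftrightarrow> x \<in> U" "x \<notin> U \<Longrightarrow> inv N x = x"
  using permutes_inverses(2)[OF N_perm, of x] permutes_in_image[OF permutes_inv[OF N_perm], of x]
    permutes_not_in[OF permutes_inv[OF N_perm], of x]
  by (auto simp: N_def)

lemma \<nu>_U: "e \<in> U \<Longrightarrow> \<nu> e \<in> U" using hits_in[OF R_hits] .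
lemma \<alpha>_U: "e \<in> U \<Longrightarrow> \<alpha> e \<in> U" using hits_in[OF F_hits] .

lemma lab_hits_R: "hits R A x y \<Longrightarrow> x \<in> D \<Longrightarrow> lab y = lab x"
  by (induction rule: hits.induct) (auto simp: lab_R)

lemma lab_inv_N: "x \<in> D \<Longrightarrow> lab (inv N x) = lab x"
proof (cases "x \<in> U")
  case True
  then have y: "inv N x \<in> U" using inv_N by simp
  have "\<nu> (inv N x) = x" using permutes_inverses(1)[OF N_perm, of x] y by (simp add: N_def)
  then show ?thesis using lab_hits_R[OF R_hits[OF y]] U_D[OF y] by simp
qed (simp add: inv_N)

text \<open>Multiplying by \<open>inv N\<close> also multiplies the return maps by it:
  \<open>\<nu>\<close> becomes the identity and \<open>\<alpha>\<close> becomes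
  \<open>\<phi>\<close>.\<close>

sublocale noose: noose_map D U i C lab \<phi>
proof
  show "C permutes D"
    unfolding C_def
    by (rule permutes_compose[OF R_perm permutes_subset[OF permutes_inv[OF N_perm] U_sub]])
  show "lab (C d) = lab d" if "d \<in> D" for d
    using that by (simp add: C_def lab_inv_N lab_R)
  show "hits C U e e" if "e \<in> U" for e
  proof -
    have "hits (inv N \<circ> R) U e (inv N (\<nu> e))"
      by (rule hits_comp[OF R_hits[OF that]]) (auto simp: inv_N)
    then show ?thesis using that by (simp add: C_def inv_N)
  qed
  show "hits (\<lambda>d. C (i d)) U e (\<phi> e)" if "e \<in> U" for e
  proof -
    have "hits (inv N \<circ> (\<lambda>d. R (i d))) U e (inv N (\<alpha> e))"
      by (rule hits_comp[OF F_hits[OF that]]) (auto simp: inv_N)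
    moreover have "inv N (\<alpha> e) = \<phi> e" using inv_N(1)[OF \<phi>_U[OF that]] \<nu>_\<phi>[OF that] by simp
    ultimately show ?thesis by (simp add: C_def comp_def)
  qed
qed (use finite_D U_sub i_perm i_i i_U lab_i in auto)

text \<open>\<open>N\<close> fixes every dart outside \<open>U\<close>, so vertices without up-darts
  survive the cutting unchanged.\<close>

lemma missing_orbits:
  "{T \<in> orbit R ` D. T \<inter> U = {}} = {T \<in> orbit C ` D. T \<inter> U = {}}"
proof -
  have "orbit R x = orbit C x" if "orbit R x \<inter> U = {} \<or> orbit C x \<inter> U = {}" for x
    using that
  proof
    assume *: "orbit R x \<inter> U = {}"
    show ?thesis
    proof (rule orbit_cong[symmetric])
      show "x \<in> orbit R x" by (rule permutes_self_in_orbit[OF R_perm finite_D])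
      show "C s = R s" if "s \<in> orbit R x" for s
        using * orbit.step[OF that] by (simp add: C_def inv_N(3) disjoint_iff)
    qed
  next
    assume *: "orbit C x \<inter> U = {}"
    show ?thesis
    proof (rule orbit_cong)
      show "x \<in> orbit C x" by (rule permutes_self_in_orbit[OF noose.R_perm finite_D])
      show "R s = C s" if "s \<in> orbit C x" for s
        using * orbit.step[OF that] N_C[of s] by (simp add: N_def disjoint_iff)
    qed
  qed
  then show ?thesis by auto
qed

lemma light_bij:
  "bij_betw (\<lambda>f. i ` {x \<in> f. lab x = Max (lab ` f)}) (orbit \<phi> ` U) {T \<in> orbit R ` D. T \<inter> U = {}}"
  unfolding missing_orbits by (rule noose.light_bij)

text \<open>A finite set closed under \<open>\<nu>\<close> is closed under its inverse, hence under
  \<open>\<phi>\<close>, and the case of nooses applies.\<close>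

lemma closed:
  assumes A: "A \<subseteq> U" "\<And>a. a \<in> A \<Longrightarrow> \<nu> a \<in> A" "\<And>a. a \<in> A \<Longrightarrow> \<alpha> a \<in> A" and x: "x \<in> A \<union> i ` A"
  shows "R x \<in> A \<union> i ` A"
proof -
  have finA: "finite A" using A(1) finite_U finite_subset by blast
  have N: "N z \<in> A \<longleftrightarrow> z \<in> A" for z
    by (rule permutes_closed_image[OF N_perm finA]) (use A in \<open>auto simp: N_def\<close>)
  have "\<phi> a \<in> A" if "a \<in> A" for a
    using N[of "\<phi> a"] A that \<phi>_U[of a] \<nu>_\<phi>[of a] by (auto simp: N_def)
  then have "C x \<in> A \<union> i ` A" using noose.closed[OF A(1) _ x] by blast
  moreover have "N z = z" if "z \<in> i ` A" for z using that A(1) U_D by (auto simp: N_def i_U)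
  ultimately show ?thesis using N_C[of x] N[of "C x"] by (metis UnE UnI1 UnI2)
qed

lemma \<nu>_orbit: "e \<in> U \<Longrightarrow> orbit \<nu> e = orbit R e \<inter> U"
  using orbit_hits[of U R \<nu> e] R_hits by simp

lemma \<alpha>_orbit: "e \<in> U \<Longrightarrow> orbit \<alpha> e = orbit F e \<inter> U"
  using orbit_hits[of U F \<alpha> e] F_hits by simp

lemma lab_\<alpha>: "e \<in> U \<Longrightarrow> lab (\<alpha> e) \<le> lab e + 1"
  using hits_F_lab[OF F_hits] lab_i U_D by fastforce

text \<open>A rise by the full step of one leaves no room for down-darts between \<open>e\<close>
  and \<open>\<alpha> e\<close>. This turns a property of labels into adjacency in
  \<open>B\<close>.\<close>

lemma up_step: "e \<in> U \<Longrightarrow> lab (\<alpha> e) = lab e + 1 \<Longrightarrow> R (i e) = \<alpha> e"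
  using hits_F_lab[OF F_hits] lab_i U_D by fastforce

end

text \<open>On down-darts, \<open>R_i_in\<close> and \<open>R_i_out\<close> express \<open>C\<close>
  through \<open>\<phi>\<close> and the labels, which \<open>h\<close> respects. At an up-dart
  \<open>C\<close> is then forced, since it has to start the cycle that leads back to this
  dart.\<close>

lemma noose_map_unique:
  assumes "noose_map D U i C lab \<phi>" "noose_map D' U' i' C' lab' \<phi>'"
    and h: "bij_betw h D D'" "\<And>d. d \<in> D \<Longrightarrow> h (i d) = i' (h d)" "\<And>d. d \<in> D \<Longrightarrow> h d \<in> U' \<longleftrightarrow> d \<in> U"
    and hl: "\<And>d. d \<in> U \<Longrightarrow> lab' (h d) = lab d" and h\<phi>: "\<And>e. e \<in> U \<Longrightarrow> h (\<phi> e) = \<phi>' (h e)"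
    and d: "d \<in> D"
  shows "h (C d) = C' (h d)"
proof -
  interpret A: noose_map D U i C lab \<phi> by fact
  interpret B: noose_map D' U' i' C' lab' \<phi>' by fact
  have hD: "h d \<in> D'" if "d \<in> D" for d using h(1) that by (auto dest: bij_betwE)
  have hinj: "x = y" if "h x = h y" "x \<in> D" "y \<in> D" for x y
    using h(1) that by (auto simp: bij_betw_def dest: inj_onD)
  have hU: "h e \<in> U'" if "e \<in> U" for e using that A.U_D h(3) by auto
  have up: "h (C (i e)) = C' (i' (h e))" if e: "e \<in> U" for e
  proof (cases "C (i e) \<in> U")
    case True
    from A.R_i_in[OF e True] have *: "C (i e) = \<phi> e" "lab (\<phi> e) = lab e + 1" by auto
    have "lab' (\<phi>' (h e)) = lab' (h e) + 1"
      using * e h\<phi>[OF e] hl[OF e] hl[OF A.\<phi>_U[OF e]] by simp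
    then have "C' (i' (h e)) \<in> U'" using B.R_i_out(3)[OF hU[OF e]] by force
    then show ?thesis using B.R_i_in[OF hU[OF e]] * h\<phi>[OF e] by simp
  next
    case False
    define e' where "e' = i (C (i e))"
    from A.R_i_out[OF e False] have e': "e' \<in> U" "lab e' = lab e" "lab (\<phi> e) \<le> lab e"
      "hits \<phi> (A.upper (lab e)) e e'" by (simp_all add: e'_def)
    have Ce: "C (i e) = i e'" using A.U_D[OF e] by (simp add: e'_def A.i_i)
    have "lab' (\<phi>' (h e)) \<le> lab' (h e)"
      using e' e h\<phi>[OF e] hl[OF e] hl[OF A.\<phi>_U[OF e]] by simp
    then have out: "C' (i' (h e)) \<notin> U'" using B.R_i_in[OF hU[OF e]] by force
    have "hits \<phi>' (B.upper (lab' (h e))) (h e) (h e')"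
      by (rule hits_map[OF e'(4) e]) (use A.\<phi>_U h\<phi> hl hU e in auto)
    then have "i' (C' (i' (h e))) = h e'"
      using B.R_i_out(4)[OF hU[OF e] out] hits_det by metis
    then have "C' (i' (h e)) = i' (h e')" using hD[OF A.U_D[OF e]] by (metis B.R_D B.i_D B.i_i)
    then show ?thesis using Ce h(2)[OF A.U_D[OF e'(1)]] by simp
  qed
  show ?thesis
  proof (cases "d \<in> U")
    case False
    then show ?thesis using up[of "i d"] d by (simp add: A.i_U A.i_i h(2)[symmetric])
  next
    case dU: True
    have "C' (h d) \<in> D'" using hD[OF d] by simp
    then obtain z where z: "z \<in> D" "h z = C' (h d)" using h(1) by (metis bij_betw_imp_surj_on imageE)
    \<comment> \<open>The dart \<open>b\<close> is the \<open>C\<close>-predecessor of the dart that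
      \<open>h\<close> sends to \<open>C' (h d)\<close>. It is an up-dart by injectivity of
      \<open>C'\<close>, and it equals \<open>d\<close> because both are found as the first up-dart
      met from there.\<close>
    obtain b where b: "b \<in> D" "C b = z"
      using permutes_image[OF A.R_perm] z(1) by (metis imageE)
    have bU: "b \<in> U"
    proof (rule ccontr)
      assume "b \<notin> U"
      then have "h (C b) = C' (h b)" using up[of "i b"] b by (simp add: A.i_U A.i_i h(2)[symmetric])
      then have "h b = h d" using b z B.R_inj by simp
      then show False using hinj b d dU \<open>b \<notin> U\<close> by blast
    qed
    have "b = d"
    proof (cases "z \<in> U")
      case True
      have "z = b" using A.R_ret[OF bU] b True by (subst (asm) hits_iff) auto
      moreover have "h z = h d" using B.R_ret[OF hU[OF dU]] z True h(3)[OF z(1)] by (subst (asm) hits_iff) auto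
      ultimately show ?thesis using hinj b d by blast
    next
      case False
      have "hits C U z b" using A.R_ret[OF bU] b False by (subst (asm) hits_iff) auto
      have "hits C' U' (h d) (h d)" using B.R_ret hU dU by blast
      moreover have "C' (h d) \<notin> U'" using z False h(3) by metis
      ultimately have d': "hits C' U' (h z) (h d)" using z(2) by (subst (asm) hits_iff) simp
      have tr: "hits C' U' (h p) (h y)" if "hits C U p y" "p \<in> D" "p \<notin> U" for p y
        using that
      proof (induction rule: hits.induct)
        case (now p)
        have "h (C p) = C' (h p)" using up[of "i p"] now by (simp add: A.i_U A.i_i h(2)[symmetric])
        then show ?case using now h(3)[of "C p"] by (subst hits_iff) auto
      next
        case (later p y)
        have "h (C p) = C' (h p)" using up[of "i p"] later by (simp add: A.i_U A.i_i h(2)[symmetric])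
        then show ?case using later h(3)[of "C p"] by (subst hits_iff) auto
      qed
      have "hits C' U' (h z) (h b)" using tr[OF \<open>hits C U z b\<close> z(1) False] .
      then have "h b = h d" using d' hits_det by metis
      then show ?thesis using hinj b d by blast
    qed
    then show ?thesis using z b by simp
  qed
qed

text \<open>The relation \<open>\<nu> (\<phi> e) = \<alpha> e\<close> and injectivity of
  \<open>\<nu>\<close> show that \<open>h\<close> respects \<open>\<phi>\<close>. The cut maps then
  agree, and \<open>N\<close> glues them back.\<close>

lemma split_map_unique:
  assumes "split_map D U i R lab \<nu> \<alpha> \<phi>" "split_map D' U' i' R' lab' \<nu>' \<alpha>' \<phi>'"
    and h: "bij_betw h D D'" "\<And>d. d \<in> D \<Longrightarrow> h (i d) = i' (h d)" "\<And>d. d \<in> D \<Longrightarrow> h d \<in> U' \<longleftrightarrow> d \<in> U"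
    and hl: "\<And>d. d \<in> U \<Longrightarrow> lab' (h d) = lab d" and h\<nu>: "\<And>e. e \<in> U \<Longrightarrow> h (\<nu> e) = \<nu>' (h e)"
    and h\<alpha>: "\<And>e. e \<in> U \<Longrightarrow> h (\<alpha> e) = \<alpha>' (h e)"
    and d: "d \<in> D"
  shows "h (R d) = R' (h d)" "lab' (h d) = lab d"
proof -
  interpret A: split_map D U i R lab \<nu> \<alpha> \<phi> by fact
  interpret B: split_map D' U' i' R' lab' \<nu>' \<alpha>' \<phi>' by fact
  have hD: "h d \<in> D'" if "d \<in> D" for d using h(1) that by (auto dest: bij_betwE)
  have hU: "h e \<in> U'" if "e \<in> U" for e using that A.U_D h(3) by auto
  have N: "h (A.N x) = B.N (h x)" if "x \<in> D" for x
    using that h\<nu> h(3) by (simp add: A.N_def B.N_def)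
  have h\<phi>: "h (\<phi> e) = \<phi>' (h e)" if "e \<in> U" for e
  proof -
    have "B.N (h (\<phi> e)) = h (\<alpha> e)"
      using N[of "\<phi> e"] A.\<phi>_U[OF that] A.U_D A.\<nu>_\<phi>[OF that] by (simp add: A.N_def)
    also have "\<dots> = B.N (\<phi>' (h e))"
      using h\<alpha> that B.\<phi>_U[OF hU[OF that]] B.\<nu>_\<phi>[OF hU[OF that]] by (simp add: B.N_def)
    finally show ?thesis using permutes_inj[OF B.N_perm] by (auto dest: injD)
  qed
  have "h (A.C d) = B.C (h d)"
    by (rule noose_map_unique[OF A.noose.noose_map_axioms B.noose.noose_map_axioms h hl h\<phi> d])
  then show "h (R d) = R' (h d)"
    using N[of "A.C d"] A.noose.R_D[of d] d A.N_C B.N_C by simp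
  show "lab' (h d) = lab d"
  proof (cases "d \<in> U")
    case False
    then have "i d \<in> U" using d by (simp add: A.i_U)
    then have "lab' (h (i d)) = lab (i d)" by (rule hl)
    then show ?thesis using d False h(2,3) hD[OF d] A.lab_i' B.lab_i' by simp
  qed (rule hl)
qed

text \<open>\<open>zip_exists\<close> supplies the cut map, whose labels along \<open>\<phi>\<close>
  rise by at most one because \<open>\<nu>\<close> preserves labels. Gluing with \<open>N\<close>
  multiplies its return maps by \<open>\<nu>\<close>.\<close>

lemma split_map_exists:
  fixes lab :: "'a \<Rightarrow> int"
  assumes D: "finite D" "U \<subseteq> D" "i permutes D" "\<And>d. d \<in> D \<Longrightarrow> i (i d) = d"
    "\<And>d. d \<in> D \<Longrightarrow> i d \<in> U \<longleftrightarrow> d \<notin> U"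
    and bij: "bij_betw \<nu> U U" "bij_betw \<alpha> U U"
    and lab: "\<And>e. e \<in> U \<Longrightarrow> lab (\<nu> e) = lab e" "\<And>e. e \<in> U \<Longrightarrow> lab (\<alpha> e) \<le> lab e + 1"
    and \<phi>: "\<And>e. e \<in> U \<Longrightarrow> \<phi> e \<in> U \<and> \<nu> (\<phi> e) = \<alpha> e"
  shows "\<exists>R lab'. split_map D U i R lab' \<nu> \<alpha> \<phi> \<and> (\<forall>e\<in>U. lab' e = lab e)"
proof -
  \<comment> \<open>On a down-dart the label is forced by the upward step of its reverse.\<close>
  define l where "l d = (if d \<in> U then lab d else lab (i d) + 1)" for d
  define N where "N = (\<lambda>x. if x \<in> U then \<nu> x else x)"
  have N: "N permutes U" unfolding N_def by (rule permutes_if_bij_betw[OF bij(1)])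
  have finU: "finite U" using D finite_subset by blast
  have ii: "i (i x) = x" for x
    using D(4)[of x] permutes_not_in[OF D(3), of x] by (cases "x \<in> D") simp_all
  have "inj_on \<phi> U"
  proof (rule inj_onI)
    fix x y assume xy: "x \<in> U" "y \<in> U" "\<phi> x = \<phi> y"
    then have "\<alpha> x = \<alpha> y" using \<phi>[of x] \<phi>[of y] by simp
    then show "x = y" using bij(2) xy by (auto simp: bij_betw_def dest: inj_onD)
  qed
  then have "bij_betw \<phi> U U"
    using \<phi> endo_inj_surj[OF finU, of \<phi>] by (auto simp: bij_betw_def)
  then have P: "(\<lambda>x. if x \<in> U then \<phi> x else x) permutes U" by (rule permutes_if_bij_betw)
  have DU: "U \<union> i ` U = D"
  proof (intro equalityI subsetI)
    fix x assume "x \<in> D"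
    then show "x \<in> U \<union> i ` U" using D(5)[of x] ii by (metis UnI1 UnI2 imageI)
  qed (use D(2) permutes_in_image[OF D(3)] in auto)
  have "\<exists>C. C permutes U \<union> i ` U \<and> (\<forall>x \<in> U \<union> i ` U. l (C x) = l x) \<and>
      (\<forall>x\<in>U. hits C U x x \<and> hits (C \<circ> i) U x (if x \<in> U then \<phi> x else x))"
  proof (rule zip_exists[OF finU ii _ _ P])
    show "U \<inter> i ` U = {}" using D by auto
    show "l (i x) = l x + 1" if "x \<in> U" for x using that D ii by (auto simp: l_def)
    show "l (if x \<in> U then \<phi> x else x) \<le> l x + 1" if "x \<in> U" for x
      using that \<phi>[OF that] lab(1)[of "\<phi> x"] lab(2)[of x] by (simp add: l_def)
  qed
  then obtain C where C: "C permutes D" "\<And>x. x \<in> D \<Longrightarrow> l (C x) = l x" "\<And>x. x \<in> U \<Longrightarrow> hits C U x x"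
    "\<And>x. x \<in> U \<Longrightarrow> hits (C \<circ> i) U x (\<phi> x)"
    unfolding DU by auto
  have N_U: "N z \<in> U" if "z \<in> U" for z using permutes_in_image[OF N] that by simp
  have N_out: "N z = z" if "z \<notin> U" for z using that by (simp add: N_def)
  have "split_map D U i (N \<circ> C) l \<nu> \<alpha> \<phi>"
  proof
    show "N \<circ> C permutes D" by (rule permutes_compose[OF C(1) permutes_subset[OF N D(2)]])
    show "l ((N \<circ> C) d) = l d" if "d \<in> D" for d
      using C(2)[OF that] lab(1)[of "C d"] N_U[of "C d"] by (auto simp: N_def l_def split: if_splits)
    show "l (i d) = l d + 1" if "d \<in> U" for d using that D ii by (auto simp: l_def)
    show "hits (N \<circ> C) U e (\<nu> e)" if "e \<in> U" for e
      using hits_comp[OF C(3)[OF that] N_U N_out] that by (simp add: N_def)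
    show "hits (\<lambda>d. (N \<circ> C) (i d)) U e (\<alpha> e)" if "e \<in> U" for e
      using hits_comp[OF C(4)[OF that] N_U N_out] that \<phi>[OF that] by (simp add: N_def comp_def)
  qed (use D \<phi> in auto)
  moreover have "\<forall>e\<in>U. l e = lab e" by (simp add: l_def)
  ultimately show ?thesis by blast
qed

section \<open>Hypermaps\<close>

text \<open>Transitivity of the group generated by \<open>f\<close> and \<open>g\<close>: for
  permutations of a finite set, closure under forward steps is enough.\<close>

definition transitive_on :: "'a set \<Rightarrow> ('a \<Rightarrow> 'a) \<Rightarrow> ('a \<Rightarrow> 'a) \<Rightarrow> bool" where
  "transitive_on D f g \<longleftrightarrow> (\<forall>S\<subseteq>D. S \<noteq> {} \<longrightarrow> (\<forall>x\<in>S. f x \<in> S \<and> g x \<in> S) \<longrightarrow> S = D)"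

text \<open>\<open>U\<close> contains one dart of each edge, so it orients the map and counts its
  edges.\<close>

locale dart_map =
  fixes G :: "('a, 'z) comb_map_scheme" and D U :: "'a set" and i :: "'a \<Rightarrow> 'a"
  assumes D_def: "D = darts G" and i_def: "i = opp G"
    and finD: "finite D" and U_D: "U \<subseteq> D" and rot_perm: "rot G permutes D"
    and i_perm: "i permutes D" and i_i: "d \<in> D \<Longrightarrow> i (i d) = d"
    and i_U: "d \<in> D \<Longrightarrow> i d \<in> U \<longleftrightarrow> d \<notin> U"
begin

lemma i_D [simp]: "i d \<in> D \<longleftrightarrow> d \<in> D" and rot_D [simp]: "rot G d \<in> D \<longleftrightarrow> d \<in> D"
  using permutes_in_image[OF i_perm] permutes_in_image[OF rot_perm] by auto

lemma inv_rot [simp]: "inv (rot G) (rot G d) = d" "rot G (inv (rot G) d) = d"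
  using permutes_inverses[OF rot_perm] by auto

lemma inv_rot_D [simp]: "inv (rot G) d \<in> D \<longleftrightarrow> d \<in> D"
  using permutes_in_image[OF permutes_inv[OF rot_perm]] .

lemma rot_inj: "rot G x = rot G y \<longleftrightarrow> x = y"
  using permutes_inj[OF rot_perm] by (auto dest: injD)

lemma i_inj: "i x = i y \<longleftrightarrow> x = y"
  using permutes_inj[OF i_perm] by (auto dest: injD)

lemma face_next_perm: "face_next G permutes D"
proof -
  have "face_next G = inv (rot G) \<circ> i" by (simp add: fun_eq_iff face_next_def i_def)
  then show ?thesis using permutes_compose[OF i_perm permutes_inv[OF rot_perm]] by simp
qed

lemma i_neq: "d \<in> D \<Longrightarrow> i d \<noteq> d"
  using i_U by metis

lemma vertex_eq: "vertex_of G x = vertex_of G y \<longleftrightarrow> y \<in> vertex_of G x"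
  unfolding vertex_of_def by (rule permutes_orbit_eq_iff[OF rot_perm finD])

lemma face_eq: "face_of G x = face_of G y \<longleftrightarrow> y \<in> face_of G x"
  unfolding face_of_def by (rule permutes_orbit_eq_iff[OF face_next_perm finD])

lemma vertex_self: "x \<in> vertex_of G x"
  unfolding vertex_of_def by (rule permutes_self_in_orbit[OF rot_perm finD])

lemma face_self: "x \<in> face_of G x"
  unfolding face_of_def by (rule permutes_self_in_orbit[OF face_next_perm finD])

lemma vertex_sub: "x \<in> D \<Longrightarrow> vertex_of G x \<subseteq> D"
  unfolding vertex_of_def by (rule permutes_orbit_subset[OF rot_perm])

lemma face_sub: "x \<in> D \<Longrightarrow> face_of G x \<subseteq> D"
  unfolding face_of_def by (rule permutes_orbit_subset[OF face_next_perm])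

lemma vertex_rot: "vertex_of G (rot G x) = vertex_of G x"
  using vertex_eq[of x "rot G x"] by (auto simp: vertex_of_def intro: orbit.base)

lemma face_face_next: "face_of G (face_next G x) = face_of G x"
  using face_eq[of x "face_next G x"] by (auto simp: face_of_def intro: orbit.base)

lemma card_edges: "card (edges G) = card U"
proof -
  have "edges G = (\<lambda>d. {d, i d}) ` U"
  proof (intro equalityI subsetI)
    fix e assume "e \<in> edges G"
    then obtain d where d: "d \<in> D" "e = {d, i d}" by (auto simp: edges_def D_def i_def)
    show "e \<in> (\<lambda>d. {d, i d}) ` U"
    proof (cases "d \<in> U")
      case False
      then have "i d \<in> U" "e = {i d, i (i d)}" using d by (auto simp: i_U i_i)
      then show ?thesis by blast
    qed (use d in blast)
  qed (use U_D in \<open>auto simp: edges_def D_def i_def\<close>)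
  moreover have "inj_on (\<lambda>d. {d, i d}) U"
  proof (rule inj_onI)
    fix x y assume xy: "x \<in> U" "y \<in> U" "{x, i x} = {y, i y}"
    have "x \<noteq> i y" using xy U_D i_U[of y] by auto
    then show "x = y" using xy by blast
  qed
  ultimately show ?thesis by (simp add: card_image)
qed

text \<open>Connectivity is restated on darts, because the dart set and \<open>i\<close> are what
  the hypermap, the mobile and \<open>B\<close> share, while their vertices differ.\<close>

lemma connected_iff:
  assumes "D \<noteq> {}"
  shows "(\<forall>u\<in>verts G. \<forall>v\<in>verts G.
      (u, v) \<in> {(vertex_of G d, vertex_of G (opp G d)) |d. d \<in> darts G}\<^sup>*) \<longleftrightarrow>
    transitive_on D (rot G) i" (is "?L \<longleftrightarrow> ?R")
proof -
  define E where "E = {(vertex_of G d, vertex_of G (opp G d)) |d. d \<in> darts G}"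
  have verts: "verts G = vertex_of G ` D" using assms by (simp add: verts_def D_def)
  show ?thesis unfolding E_def[symmetric]
  proof
    assume L: "\<forall>u\<in>verts G. \<forall>v\<in>verts G. (u, v) \<in> E\<^sup>*"
    show ?R unfolding transitive_on_def
    proof (intro allI impI)
      fix S assume S: "S \<subseteq> D" "S \<noteq> {}" "\<forall>x\<in>S. rot G x \<in> S \<and> i x \<in> S"
      then obtain d where d: "d \<in> S" by auto
      have orb: "vertex_of G x \<subseteq> S" if "x \<in> S" for x
        using orbit_closed[of _ "rot G" x S] that S(3) by (auto simp: vertex_of_def)
      have reach: "w \<subseteq> S" if "(vertex_of G d, w) \<in> E\<^sup>*" for w
        using that
      proof (induction rule: rtrancl_induct)
        case base then show ?case using orb d by simp
      next
        case (step y z)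
        then obtain x where x: "y = vertex_of G x" "z = vertex_of G (i x)" by (auto simp: E_def i_def)
        then have "x \<in> S" using step.IH vertex_self by auto
        then show ?case using x orb S(3) by simp
      qed
      show "S = D"
      proof (intro equalityI subsetI)
        fix x assume "x \<in> D"
        then have "vertex_of G x \<subseteq> S" using L d S(1) verts by (intro reach) auto
        then show "x \<in> S" using vertex_self by auto
      qed (use S in auto)
    qed
  next
    assume R: ?R
    show "\<forall>u\<in>verts G. \<forall>v\<in>verts G. (u, v) \<in> E\<^sup>*"
    proof (intro ballI)
      fix u v assume "u \<in> verts G" "v \<in> verts G"
      then obtain d e where de: "d \<in> D" "u = vertex_of G d" "e \<in> D" "v = vertex_of G e"
        by (auto simp: verts)
      define S where "S = {x \<in> D. (u, vertex_of G x) \<in> E\<^sup>*}"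
      have "i x \<in> S" if "x \<in> S" for x
      proof -
        have "(vertex_of G x, vertex_of G (i x)) \<in> E" using that by (auto simp: S_def E_def D_def i_def)
        then show ?thesis using that by (auto simp: S_def intro: rtrancl_into_rtrancl)
      qed
      moreover have "rot G x \<in> S" if "x \<in> S" for x using that by (auto simp: S_def vertex_rot)
      moreover have "d \<in> S" using de by (simp add: S_def)
      ultimately have "S = D" using R unfolding transitive_on_def by (metis (no_types, lifting) S_def emptyE mem_Collect_eq subsetI)
      then show "(u, v) \<in> E\<^sup>*" using de by (auto simp: S_def)
    qed
  qed
qed

lemma planar_map_iff:
  assumes "D \<noteq> {}"
  shows "planar_map G \<longleftrightarrow> transitive_on D (rot G) i \<and>
    card (vertex_of G ` D) + card (face_of G ` D) = card U + 2"
  using assms finD rot_perm i_perm i_neq i_i card_edges connected_iff[OF assms]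
  unfolding planar_map_def
  by (simp add: verts_def faces_def D_def[symmetric] i_def[symmetric])

end

text \<open>For a hypermap, \<open>U\<close> consists of the darts with their light face on the left.\<close>

locale alternating_map = dart_map +
  assumes rot_U: "d \<in> D \<Longrightarrow> rot G d \<in> U \<longleftrightarrow> d \<notin> U"
begin

abbreviation "\<nu> \<equiv> \<lambda>d. rot G (rot G d)"
abbreviation "\<alpha> \<equiv> \<lambda>d. rot G (i d)"

lemma inv_rot_U: "d \<in> D \<Longrightarrow> inv (rot G) d \<in> U \<longleftrightarrow> d \<notin> U"
  using rot_U[of "inv (rot G) d"] by auto

lemma face_next_U: "d \<in> D \<Longrightarrow> face_next G d \<in> U \<longleftrightarrow> d \<in> U"
  by (simp add: face_next_def i_def[symmetric] inv_rot_U i_U)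

lemma \<nu>_face_next: "d \<in> U \<Longrightarrow> \<nu> (face_next G d) = \<alpha> d"
  by (simp add: face_next_def i_def)

lemma \<nu>_bij: "bij_betw \<nu> U U"
  using permutes_bij_betw[OF permutes_compose[OF rot_perm rot_perm], of U] finite_subset[OF U_D finD] U_D
  by (simp add: comp_def rot_U subset_iff)

lemma \<alpha>_bij: "bij_betw \<alpha> U U"
  using permutes_bij_betw[OF permutes_compose[OF i_perm rot_perm], of U] finite_subset[OF U_D finD] U_D
  by (simp add: comp_def rot_U i_U subset_iff)

lemma vertex_\<nu>: "e \<in> U \<Longrightarrow> vertex_of G e \<inter> U = orbit \<nu> e"
  unfolding vertex_of_def
proof (rule orbit_hits)
  fix a assume "a \<in> U"
  then show "hits (rot G) U a (\<nu> a)"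
    using U_D rot_U[of a] rot_U[of "rot G a"] by (auto simp: hits_iff[of "rot G" U a] hits_iff[of "rot G" U "rot G a"])
qed

lemma face_\<phi>: "face_of G e = orbit (face_next G) e"
  by (simp add: face_of_def)

lemma face_\<phi>_sub: "e \<in> D \<Longrightarrow> face_of G e \<subseteq> U \<longleftrightarrow> e \<in> U" "e \<in> D \<Longrightarrow> face_of G e \<inter> U = {} \<longleftrightarrow> e \<notin> U"
proof -
  have "face_of G e \<subseteq> U" if "e \<in> U"
    using orbit_closed[of _ "face_next G" e U] that face_next_U U_D by (auto simp: face_of_def)
  moreover have "face_of G e \<subseteq> D - U" if "e \<in> D - U"
    using orbit_closed[of _ "face_next G" e "D - U"] that face_next_U permutes_in_image[OF face_next_perm]
    by (auto simp: face_of_def)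
  ultimately show "e \<in> D \<Longrightarrow> face_of G e \<subseteq> U \<longleftrightarrow> e \<in> U"
     "e \<in> D \<Longrightarrow> face_of G e \<inter> U = {} \<longleftrightarrow> e \<notin> U"
    using face_self[of e] by auto
qed

text \<open>The dark face on the right of \<open>e\<close> is on the left of \<open>i e\<close> and
  is traversed there in the opposite sense, so \<open>i\<close> conjugates the face walk with the
  inverse of \<open>\<alpha>\<close>.\<close>

lemma face_\<alpha>:
  assumes "e \<in> U" shows "face_of G (i e) = i ` orbit \<alpha> e"
proof -
  define \<beta> where "\<beta> = (\<lambda>d. i (face_next G (i d)))"
  have \<beta>: "\<beta> = (\<lambda>d. i (inv (rot G) d))" if "\<forall>d. i (i d) = d"
    using that by (simp add: \<beta>_def face_next_def i_def)
  have ii: "i (i d) = d" for d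
    using i_i[of d] permutes_not_in[OF i_perm, of d] by (cases "d \<in> D") simp_all
  have perm: "(\<lambda>d. rot G (i d)) permutes D"
    using permutes_compose[OF i_perm rot_perm] by (simp add: comp_def)
  have inv: "inv (\<lambda>d. rot G (i d)) = \<beta>"
    using \<beta> ii by (intro inv_unique_comp) (auto simp: fun_eq_iff)
  have "orbit \<alpha> e = orbit \<beta> e"
    using orbit_inv_eq[of \<alpha> e] inv perm finD by (metis permutation_permutes)
  moreover have "i ` orbit \<beta> e = orbit (face_next G) (i e)"
  proof (rule orbit_inverse)
    show "e \<in> orbit \<beta> e"
      using permutes_self_in_orbit[OF perm finD, of e] \<open>orbit \<alpha> e = orbit \<beta> e\<close> by simp
    show "face_next G (i x) = i (\<beta> x)" for x by (simp add: \<beta>_def ii)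
  qed
  ultimately show ?thesis by (simp add: face_of_def)
qed

lemma vertex_image: "vertex_of G ` D = vertex_of G ` U"
proof (intro equalityI subsetI)
  fix v assume "v \<in> vertex_of G ` D"
  then obtain d where d: "d \<in> D" "v = vertex_of G d" by auto
  show "v \<in> vertex_of G ` U"
  proof (cases "d \<in> U")
    case False
    then have "rot G d \<in> U" using d by (simp add: rot_U)
    then show ?thesis using d vertex_rot[of d] by (metis imageI)
  qed (use d in auto)
qed (use U_D in auto)

lemma dart_cases: "D = U \<union> i ` U"
proof (intro equalityI subsetI)
  fix x assume "x \<in> D"
  then show "x \<in> U \<union> i ` U" using i_U[of x] i_i[of x] by (metis UnI1 UnI2 imageI)
qed (use U_D in auto)

lemma card_faces:
  "card (face_of G ` D) = card (orbit (face_next G) ` U) + card (orbit \<alpha> ` U)"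
proof -
  have "face_of G ` D = face_of G ` U \<union> face_of G ` (i ` U)" by (metis dart_cases image_Un)
  moreover have "face_of G ` U \<inter> face_of G ` (i ` U) = {}"
  proof -
    have "face_of G x \<noteq> face_of G (i y)" if "x \<in> U" "y \<in> U" for x y
      using that face_\<phi>_sub(1)[of x] face_\<phi>_sub(1)[of "i y"] U_D i_U by auto
    then show ?thesis by auto
  qed
  moreover have "card (face_of G ` (i ` U)) = card (orbit \<alpha> ` U)"
  proof -
    have "face_of G ` (i ` U) = (`) i ` (orbit \<alpha> ` U)"
      using face_\<alpha> by (auto simp: image_image)
    moreover have "inj_on ((`) i) (orbit \<alpha> ` U)"
      using permutes_inj[OF i_perm] by (simp add: inj_image_eq_iff inj_on_def)
    ultimately show ?thesis by (simp add: card_image)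
  qed
  ultimately show ?thesis
    using finD U_D by (simp add: card_Un_disjoint finite_subset face_\<phi>)
qed

end

section \<open>Counting orbits and transferring connectivity\<close>

context split_map
begin

lemma R_orbit_self: "x \<in> orbit R x"
  by (rule permutes_self_in_orbit[OF R_perm finite_D])

lemma R_orbit_eq: "orbit R x = orbit R y \<longleftrightarrow> y \<in> orbit R x"
  by (rule permutes_orbit_eq_iff[OF R_perm finite_D])

lemma F_orbit_eq: "orbit F x = orbit F y \<longleftrightarrow> y \<in> orbit F x"
  by (rule permutes_orbit_eq_iff[OF F_perm finite_D])

lemma F_orbit_self: "x \<in> orbit F x"
  by (rule permutes_self_in_orbit[OF F_perm finite_D])

lemma lab_orbit: "y \<in> orbit R x \<Longrightarrow> x \<in> D \<Longrightarrow> lab y = lab x"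
  using orbit_closed[of y R x "{z \<in> D. lab z = lab x}"] by (auto simp: lab_R)

lemma \<nu>_orbit_eq: "x \<in> U \<Longrightarrow> y \<in> U \<Longrightarrow> orbit \<nu> x = orbit \<nu> y \<longleftrightarrow> orbit R x = orbit R y"
  using R_orbit_self R_orbit_eq[of x y] by (auto simp: \<nu>_orbit)

lemma \<alpha>_orbit_eq: "x \<in> U \<Longrightarrow> y \<in> U \<Longrightarrow> orbit \<alpha> x = orbit \<alpha> y \<longleftrightarrow> orbit F x = orbit F y"
  using F_orbit_self F_orbit_eq[of x y] by (auto simp: \<alpha>_orbit)

lemma F_orbits_U: "orbit F ` D = orbit F ` U"
proof (intro equalityI subsetI)
  fix T assume "T \<in> orbit F ` D"
  then obtain d where d: "d \<in> D" "T = orbit F d" by auto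
  obtain y where "hits F U d y" using F_meets_U[OF d(1)] by auto
  then have "y \<in> U" "y \<in> orbit F d" using hits_in hits_orbit by metis+
  then show "T \<in> orbit F ` U" using d F_orbit_eq by blast
qed (use U_D in auto)

text \<open>A vertex of \<open>B\<close> either has an up-dart and is a \<open>\<nu>\<close>-cycle,
  or has none and is a \<open>\<phi>\<close>-cycle by \<open>light_bij\<close>. Every face has an
  up-dart by \<open>F_meets_U\<close>, so faces are \<open>\<alpha>\<close>-cycles.\<close>

lemma card_vertices_faces:
  "card (orbit \<nu> ` U) + card (orbit \<phi> ` U) = card (orbit R ` D)"
  "card (orbit \<alpha> ` U) = card (orbit F ` D)"
proof -
  have "card (orbit \<nu> ` U) = card (orbit R ` U)"
    by (rule card_images) (rule \<nu>_orbit_eq)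
  moreover have "card (orbit \<phi> ` U) = card {T \<in> orbit R ` D. T \<inter> U = {}}"
    using light_bij by (rule bij_betw_same_card)
  moreover have "orbit R ` D = orbit R ` U \<union> {T \<in> orbit R ` D. T \<inter> U = {}}"
  proof (intro equalityI subsetI)
    fix T assume T: "T \<in> orbit R ` D"
    show "T \<in> orbit R ` U \<union> {T \<in> orbit R ` D. T \<inter> U = {}}"
    proof (cases "T \<inter> U = {}")
      case False
      then obtain x d where "x \<in> T" "x \<in> U" "T = orbit R d" using T by auto
      then show ?thesis using R_orbit_eq[of d x] by auto
    qed (use T in simp)
  qed (use U_D in auto)
  moreover have "orbit R ` U \<inter> {T \<in> orbit R ` D. T \<inter> U = {}} = {}"
    using R_orbit_self by auto
  ultimately show "card (orbit \<nu> ` U) + card (orbit \<phi> ` U) = card (orbit R ` D)"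
    using finite_D finite_U card_Un_disjoint[of "orbit R ` U" "{T \<in> orbit R ` D. T \<inter> U = {}}"]
    by simp
  show "card (orbit \<alpha> ` U) = card (orbit F ` D)"
    unfolding F_orbits_U by (rule card_images) (rule \<alpha>_orbit_eq)
qed

text \<open>Closed sets of \<open>B\<close> are described by \<open>\<nu>\<close> and
  \<open>\<alpha>\<close> alone. The same description of the sets closed under \<open>rot G\<close>
  then makes connectivity equivalent on both sides.\<close>

lemma closed_iff:
  assumes S: "S \<subseteq> D" "\<And>x. x \<in> S \<Longrightarrow> i x \<in> S"
  shows "(\<forall>x\<in>S. R x \<in> S) \<longleftrightarrow> (\<forall>x\<in>S \<inter> U. \<nu> x \<in> S \<and> \<alpha> x \<in> S)"
proof
  assume R: "\<forall>x\<in>S. R x \<in> S"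
  show "\<forall>x\<in>S \<inter> U. \<nu> x \<in> S \<and> \<alpha> x \<in> S"
  proof
    fix x assume x: "x \<in> S \<inter> U"
    then show "\<nu> x \<in> S \<and> \<alpha> x \<in> S"
      using hits_closed[OF R_hits, of x S] hits_closed[OF F_hits, of x S] R S(2) by auto
  qed
next
  assume A: "\<forall>x\<in>S \<inter> U. \<nu> x \<in> S \<and> \<alpha> x \<in> S"
  have eq: "S = S \<inter> U \<union> i ` (S \<inter> U)"
  proof (intro equalityI subsetI)
    fix x assume x: "x \<in> S"
    then have "x \<in> U \<or> i x \<in> S \<inter> U \<and> i (i x) = x" using S by (auto simp: i_U i_i subset_iff)
    then show "x \<in> S \<inter> U \<union> i ` (S \<inter> U)" using x by (metis IntI UnI1 UnI2 imageI)
  qed (use S(2) in auto)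
  have "R x \<in> S \<inter> U \<union> i ` (S \<inter> U)" if "x \<in> S \<inter> U \<union> i ` (S \<inter> U)" for x
    by (rule closed[OF _ _ _ that]) (use A \<nu>_U \<alpha>_U in auto)
  then show "\<forall>x\<in>S. R x \<in> S" unfolding eq[symmetric] by blast
qed

end

context alternating_map
begin

lemma rot_closed_iff:
  assumes S: "S \<subseteq> D" "\<And>x. x \<in> S \<Longrightarrow> i x \<in> S"
  shows "(\<forall>x\<in>S. rot G x \<in> S) \<longleftrightarrow> (\<forall>x\<in>S \<inter> U. \<nu> x \<in> S \<and> \<alpha> x \<in> S)"
proof
  assume A: "\<forall>x\<in>S \<inter> U. \<nu> x \<in> S \<and> \<alpha> x \<in> S"
  have fin: "finite (S \<inter> U)" using finD S finite_subset by (metis finite_Int)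
  define a where "a = (\<lambda>x. if x \<in> U then \<alpha> x else x)"
  have a: "a permutes U" unfolding a_def by (rule permutes_if_bij_betw[OF \<alpha>_bij])
  have a_iff: "a x \<in> S \<inter> U \<longleftrightarrow> x \<in> S \<inter> U" for x
    by (rule permutes_closed_image[OF a fin])
      (use A \<alpha>_bij in \<open>auto simp: a_def dest: bij_betwE\<close>)
  show "\<forall>x\<in>S. rot G x \<in> S"
  proof
    fix x assume x: "x \<in> S"
    then have xD: "x \<in> D" using S by auto
    show "rot G x \<in> S"
    proof (cases "x \<in> U")
      case False
      then show ?thesis using A S(2)[OF x] xD by (force simp: i_U i_i)
    next
      case True
      \<comment> \<open>From an up-dart, \<open>rot G x\<close> is reached through the inverse of
        \<open>\<alpha>\<close>.\<close>
      have "i (rot G x) \<in> U" "\<alpha> (i (rot G x)) = \<nu> x" using True xD by (simp_all add: i_U rot_U i_i)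
      then have "a (i (rot G x)) \<in> S \<inter> U"
        using A x True xD by (simp add: a_def rot_U)
      then have "i (rot G x) \<in> S" unfolding a_iff by simp
      then show ?thesis using S(2)[of "i (rot G x)"] xD by (simp add: i_i)
    qed
  qed
qed (use S in auto)

lemma even_vertex:
  assumes "d \<in> D" shows "even (card (vertex_of G d))"
proof -
  define V where "V = vertex_of G d"
  have V: "V \<subseteq> D" "finite V" using vertex_sub[OF assms] finD finite_subset by (auto simp: V_def)
  have cyc: "cyclic_on (rot G) V"
    unfolding V_def vertex_of_def by (rule cyclic_on_orbit[OF rot_perm finD])
  have "bij_betw (rot G) (V \<inter> U) (V - U)"
  proof (rule bij_betw_imageI)
    show "inj_on (rot G) (V \<inter> U)" by (rule inj_onI) (simp add: rot_inj)
    show "rot G ` (V \<inter> U) = V - U"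
    proof (intro equalityI subsetI)
      fix x assume x: "x \<in> V - U"
      then have "inv (rot G) x \<in> V" using cyclic_on_f_in[OF rot_perm cyc, of "inv (rot G) x"] by simp
      moreover have "inv (rot G) x \<in> U" using x V by (auto simp: inv_rot_U)
      ultimately show "x \<in> rot G ` (V \<inter> U)" by (intro image_eqI[of _ _ "inv (rot G) x"]) auto
    qed (use cyclic_on_inI[OF cyc] V rot_U in auto)
  qed
  then have "card (V \<inter> U) = card (V - U)" by (rule bij_betw_same_card)
  moreover have "card V = card (V \<inter> U) + card (V - U)"
    using card_Un_disjoint[of "V \<inter> U" "V - U"] V(2) by (simp add: Int_Diff_Un Int_Diff_disjoint)
  ultimately show ?thesis by (simp add: V_def)
qed

end

lemma transitive_on_cong:
  assumes "\<And>S. S \<subseteq> D \<Longrightarrow> (\<And>x. x \<in> S \<Longrightarrow> g x \<in> S) \<Longrightarrow> (\<forall>x\<in>S. f x \<in> S) \<longleftrightarrow> (\<forall>x\<in>S. f' x \<in> S)"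
  shows "transitive_on D f g \<longleftrightarrow> transitive_on D f' g"
  unfolding transitive_on_def using assms by (metis (no_types, lifting))

text \<open>This finds the dart at which a vertex of \<open>B\<close> turns from down-darts to
  up-darts, or the other way round.\<close>

lemma hits_last:
  assumes "hits f A x y" "x \<notin> A"
  shows "\<exists>z. z \<notin> A \<and> f z = y \<and> (z = x \<or> z \<in> orbit f x)"
  using assms
proof (induction rule: hits.induct)
  case (now x) then show ?case by blast
next
  case (later x y)
  then obtain z where "z \<notin> A" "f z = y" "z = f x \<or> z \<in> orbit f (f x)" by blast
  then show ?case by (auto intro: orbit.base orbit_subset)
qed

locale hyper_map = a: alternating_map G D U i +
  s: split_map D U i R lab "\<lambda>d. rot G (rot G d)" "\<lambda>d. rot G (i d)" "face_next G"
  for G :: "('a, 'z) comb_map_scheme" and D U i R lab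
begin

lemma transitive: "transitive_on D (rot G) i \<longleftrightarrow> transitive_on D R i"
  by (rule transitive_on_cong) (simp add: s.closed_iff a.rot_closed_iff)

text \<open>Light faces change sides in Euler's formula: they are faces of \<open>G\<close> but
  vertices of \<open>B\<close>. The sum of both counts and the number of edges stay the
  same.\<close>

lemma planar_iff:
  assumes "D \<noteq> {}"
  shows "planar_map G \<longleftrightarrow> transitive_on D R i \<and>
    card (orbit R ` D) + card (orbit (\<lambda>d. R (i d)) ` D) = card U + 2"
proof -
  have "card (vertex_of G ` D) = card (orbit (\<lambda>d. rot G (rot G d)) ` U)"
    unfolding a.vertex_image
  proof (rule card_images)
    fix x y assume "x \<in> U" "y \<in> U"
    then show "vertex_of G x = vertex_of G y \<longleftrightarrow>
        orbit (\<lambda>d. rot G (rot G d)) x = orbit (\<lambda>d. rot G (rot G d)) y"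
      using a.vertex_\<nu>[of x] a.vertex_\<nu>[of y] a.vertex_eq[of x y] a.vertex_self[of y] by blast
  qed
  then show ?thesis
    using a.planar_map_iff[OF assms] a.card_faces s.card_vertices_faces transitive by auto
qed

lemma vertex_R: "e \<in> U \<Longrightarrow> vertex_of G e \<inter> U = orbit R e \<inter> U"
  using a.vertex_\<nu> s.\<nu>_orbit by simp

lemma vertex_eq_R: "x \<in> U \<Longrightarrow> y \<in> U \<Longrightarrow> vertex_of G x = vertex_of G y \<longleftrightarrow> orbit R x = orbit R y"
  using vertex_R[of x] a.vertex_eq[of x y] s.R_orbit_eq[of x y] by blast

end

section \<open>Geodesic distances and the bipartite map of a hypermap\<close>

definition distance :: "('v \<times> 'v) set \<Rightarrow> 'v \<Rightarrow> 'v \<Rightarrow> nat" where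
  "distance r p u = (LEAST n. (p, u) \<in> r ^^ n)"

lemma geodesic_label_distance: "geodesic_label H u = int (distance (oriented_adj H) (point H) u)"
  by (simp add: geodesic_label_def distance_def)

lemma distance_path: "(p, u) \<in> r\<^sup>* \<Longrightarrow> (p, u) \<in> r ^^ distance r p u"
  unfolding distance_def by (rule LeastI_ex) (simp add: rtrancl_imp_relpow)

lemma distance_le: "(p, u) \<in> r ^^ n \<Longrightarrow> distance r p u \<le> n"
  unfolding distance_def by (rule Least_le)

lemma distance_self [simp]: "distance r p p = 0"
  using distance_le[where u = p and n = 0] by force

lemma distance_step: "(p, u) \<in> r\<^sup>* \<Longrightarrow> (u, v) \<in> r \<Longrightarrow> distance r p v \<le> distance r p u + 1"
  using distance_le[where u = v and n = "distance r p u + 1"] distance_path[of p u r] by auto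

lemma distance_pred:
  assumes "(p, u) \<in> r\<^sup>*" "u \<noteq> p"
  obtains w where "(w, u) \<in> r" "(p, w) \<in> r\<^sup>*" "distance r p u = distance r p w + 1"
proof -
  obtain n where n: "distance r p u = Suc n"
    using distance_path[OF assms(1)] assms(2) by (cases "distance r p u") auto
  obtain w where w: "(p, w) \<in> r ^^ n" "(w, u) \<in> r"
    using distance_path[OF assms(1)] n by auto
  have "(p, w) \<in> r\<^sup>*" using w relpow_imp_rtrancl by metis
  moreover have "distance r p u = distance r p w + 1"
    using distance_le[OF w(1)] distance_step[OF calculation w(2)] n by simp
  ultimately show ?thesis using that w(2) by blast
qed

text \<open>
  Planarity of \<open>B\<close> by Euler's formula, and a single local minimum, of label \<open>0\<close>.
\<close>

definition balanced :: "'a set \<Rightarrow> 'a set \<Rightarrow> ('a \<Rightarrow> 'a) \<Rightarrow> ('a \<Rightarrow> 'a) \<Rightarrow> ('a \<Rightarrow> int) \<Rightarrow> bool" where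
  "balanced D U i R lab \<longleftrightarrow> D = {} \<or>
     transitive_on D R i \<and> card (orbit R ` D) + card (orbit (\<lambda>d. R (i d)) ` D) = card U + 2 \<and>
     card {T \<in> orbit R ` D. T \<subseteq> U} = 1 \<and> (\<forall>d\<in>U. 0 \<le> lab d) \<and> (\<exists>d\<in>U. lab d = 0)"

text \<open>The labels are prescribed on \<open>U\<close> only: there the start in \<open>B\<close>
  has the label of a vertex of \<open>H\<close>, whereas a dart outside \<open>U\<close> may start
  at the tip of a light face.\<close>

definition hyp_code :: "('a, 'z) ptd_hypermap_scheme \<Rightarrow> 'a set \<Rightarrow> ('a \<Rightarrow> int) \<Rightarrow> ('a \<Rightarrow> 'a) \<Rightarrow> bool" where
  "hyp_code H U lab R \<longleftrightarrow> hyper_map H (darts H) U (opp H) R lab \<and>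
     U = {d \<in> darts H. face_of H (opp H d) \<in> dark H} \<and>
     (\<forall>d\<in>U. lab d = geodesic_label H (vertex_of H d))"

lemma pointed_alternating:
  assumes "pointed_hypermap H"
  shows "alternating_map H (darts H) {d \<in> darts H. face_of H (opp H d) \<in> dark H} (opp H)"
proof -
  define U where "U = {d \<in> darts H. face_of H (opp H d) \<in> dark H}"
  have pm: "finite (darts H)" "rot H permutes darts H" "opp H permutes darts H"
    "\<And>d. d \<in> darts H \<Longrightarrow> opp H (opp H d) = d"
    using assms by (auto simp: pointed_hypermap_def planar_map_def)
  have dark: "\<And>d. d \<in> darts H \<Longrightarrow> face_of H d \<in> dark H \<longleftrightarrow> face_of H (opp H d) \<notin> dark H"
    using assms by (auto simp: pointed_hypermap_def)
  have inD: "opp H d \<in> darts H \<longleftrightarrow> d \<in> darts H" "rot H d \<in> darts H \<longleftrightarrow> d \<in> darts H" for d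
    using permutes_in_image[OF pm(2)] permutes_in_image[OF pm(3)] by auto
  interpret dart_map H "darts H" U "opp H"
  proof
    show "opp H d \<in> U \<longleftrightarrow> d \<notin> U" if "d \<in> darts H" for d
      using that dark[OF that] by (simp add: U_def inD pm(4))
  qed (use pm in \<open>simp_all add: U_def\<close>)
  have "rot H d \<in> U \<longleftrightarrow> d \<notin> U" if "d \<in> darts H" for d
  proof -
    \<comment> \<open>The corner from \<open>d\<close> counterclockwise to \<open>rot H d\<close>
      lies in the face on the left of \<open>d\<close>, which is the face on the right of
      \<open>rot H d\<close>.\<close>
    have "face_next H (opp H (rot H d)) = d" using that by (simp add: face_next_def pm(4) inD)
    then have "face_of H (opp H (rot H d)) = face_of H d"
      using face_face_next[of "opp H (rot H d)"] by simp
    then show ?thesis using dark[OF that] that by (simp add: U_def inD)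
  qed
  then show ?thesis unfolding U_def[symmetric] by unfold_locales
qed

text \<open>Connectivity implies directed reachability, because every edge lies on the directed
  boundary of its dark face and can be undone by going around it. On darts this is
  \<open>rot_closed_iff\<close> for finite sets.\<close>

lemma pointed_reachable:
  assumes H: "pointed_hypermap H" and d: "d \<in> darts H"
  shows "(point H, vertex_of H d) \<in> (oriented_adj H)\<^sup>*"
proof -
  define U where "U = {d \<in> darts H. face_of H (opp H d) \<in> dark H}"
  interpret alternating_map H "darts H" U "opp H"
    unfolding U_def by (rule pointed_alternating[OF H])
  have ne: "darts H \<noteq> {}" using d by auto
  have "planar_map H" using H by (simp add: pointed_hypermap_def)
  then have tr: "transitive_on (darts H) (rot H) (opp H)" using planar_map_iff[OF ne] by simp
  define A where "A = {e \<in> U. (point H, vertex_of H e) \<in> (oriented_adj H)\<^sup>*}"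
  define S where "S = A \<union> opp H ` A"
  have A: "A \<subseteq> U" by (auto simp: A_def)
  have S: "S \<subseteq> darts H" "S \<inter> U = A"
    using A U_D by (auto simp: S_def i_U subset_iff)
  have iS: "opp H x \<in> S" if "x \<in> S" for x
    using that A U_D by (auto simp: S_def i_i subset_iff)
  have "\<nu> x \<in> A \<and> \<alpha> x \<in> A" if "x \<in> A" for x
  proof
    have xU: "x \<in> U" using that A by auto
    show "\<nu> x \<in> A" using that xU U_D by (auto simp: A_def vertex_rot rot_U)
    have "(vertex_of H x, vertex_of H (opp H x)) \<in> oriented_adj H"
      using xU by (auto simp: oriented_adj_def U_def)
    then show "\<alpha> x \<in> A"
      using that xU U_D by (auto simp: A_def vertex_rot rot_U i_U intro: rtrancl_into_rtrancl)
  qed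
  then have "\<forall>x\<in>S. rot H x \<in> S"
    using rot_closed_iff[OF S(1) iS] S(2) by (simp add: S_def)
  moreover obtain e where e: "e \<in> U" "point H = vertex_of H e"
  proof -
    have "point H \<in> vertex_of H ` darts H"
      using H ne by (simp add: pointed_hypermap_def verts_def)
    then show ?thesis using that unfolding vertex_image by auto
  qed
  moreover from e have "e \<in> S" by (simp add: S_def A_def)
  ultimately have "S = darts H" using tr S(1) iS unfolding transitive_on_def by blast
  then show ?thesis
  proof (cases "d \<in> U")
    case False
    then have "rot H d \<in> U" using d by (simp add: rot_U)
    then have "rot H d \<in> A" using \<open>S = darts H\<close> S(2) d by auto
    then show ?thesis by (simp add: A_def vertex_rot)
  qed (use \<open>S = darts H\<close> S(2) d in \<open>auto simp: A_def\<close>)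
qed

lemma hyp_code_exists:
  assumes H: "pointed_hypermap H"
  shows "\<exists>U lab R. hyp_code H U lab R"
proof -
  define U where "U = {d \<in> darts H. face_of H (opp H d) \<in> dark H}"
  interpret alternating_map H "darts H" U "opp H"
    unfolding U_def by (rule pointed_alternating[OF H])
  have "\<exists>R lab'. split_map (darts H) U (opp H) R lab' \<nu> \<alpha> (face_next H) \<and>
      (\<forall>e\<in>U. lab' e = geodesic_label H (vertex_of H e))"
  proof (rule split_map_exists)
    fix e assume e: "e \<in> U"
    then have eD: "e \<in> darts H" using U_D by auto
    have "(vertex_of H e, vertex_of H (opp H e)) \<in> oriented_adj H"
      using e by (auto simp: oriented_adj_def U_def)
    then show "geodesic_label H (vertex_of H (\<alpha> e)) \<le> geodesic_label H (vertex_of H e) + 1"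
      using distance_step[OF pointed_reachable[OF H eD]]
      by (force simp: geodesic_label_distance vertex_rot)
    show "face_next H e \<in> U \<and> \<nu> (face_next H e) = \<alpha> e"
      using e eD face_next_U \<nu>_face_next by simp
  qed (use finD U_D i_perm i_i i_U \<nu>_bij \<alpha>_bij vertex_rot in auto)
  then obtain R lab where R: "split_map (darts H) U (opp H) R lab \<nu> \<alpha> (face_next H)"
    "\<forall>e\<in>U. lab e = geodesic_label H (vertex_of H e)" by blast
  have "hyper_map H (darts H) U (opp H) R lab"
    using alternating_map_axioms R(1) by (simp add: hyper_map_def)
  then show ?thesis using R(2) unfolding hyp_code_def U_def[symmetric] by blast
qed

context level_map
begin

text \<open>A down-dart at level 0 would have an up-dart of level -1 as its reverse.\<close>

lemma lowest_orbit:
  assumes "d \<in> U" "lab d = 0" "\<And>e. e \<in> U \<Longrightarrow> 0 \<le> lab e"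
  shows "orbit R d \<subseteq> U"
proof
  fix x assume x: "x \<in> orbit R d"
  then have xD: "x \<in> {z \<in> D. lab z = lab d}"
    by (rule orbit_closed) (use assms U_D in \<open>auto simp: lab_R\<close>)
  show "x \<in> U"
  proof (rule ccontr)
    assume "x \<notin> U"
    then have "i x \<in> U" "lab (i x) = - 1" using xD assms by (simp_all add: i_U lab_i')
    then show False using assms(3) by force
  qed
qed

end

context hyper_map
begin

text \<open>Around a vertex of \<open>B\<close> that is not a local minimum, some down-dart is
  followed by an up-dart. Its reverse is an edge of the hypermap arriving from one level below, a
  possible last edge of a geodesic.\<close>

lemma in_edge:
  assumes "d \<in> U" "\<not> orbit R d \<subseteq> U"
  obtains e where "e \<in> U" "lab e = lab d - 1" "vertex_of G (i e) = vertex_of G d"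
proof -
  obtain x where x: "x \<in> orbit R d" "x \<notin> U" using assms by auto
  have "d \<in> orbit R x" using x s.R_orbit_eq[of d x] s.R_orbit_self[of d] by auto
  then obtain y where y: "hits R U x y" using hits_ex assms(1) by metis
  obtain z where z: "z \<notin> U" "R z = y" "z = x \<or> z \<in> orbit R x" using hits_last[OF y x(2)] by auto
  have zd: "z \<in> orbit R d" using z(3) x(1) orbit_trans by metis
  then have zD: "z \<in> D" using permutes_orbit_subset[OF s.R_perm] s.U_D[OF assms(1)] by auto
  have yU: "y \<in> U" using hits_in[OF y] .
  define e where "e = i z"
  have e: "e \<in> U" "i e = z" using z(1) zD by (simp_all add: e_def s.i_U s.i_i)
  have "lab e = lab d - 1"
    using s.lab_i'[OF zD z(1)] s.lab_orbit[OF zd] s.U_D[OF assms(1)] by (simp add: e_def)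
  moreover have "rot G (i e) = y"
    using s.F_hits[OF e(1)] yU z(2) e(2) by (subst (asm) hits_iff) auto
  then have "vertex_of G (i e) = vertex_of G y" using a.vertex_rot[of "i e"] by simp
  moreover have "y \<in> orbit R d" using z(2) zd by (auto intro: orbit.step)
  then have "vertex_of G y = vertex_of G d"
    using vertex_eq_R[OF assms(1) yU] s.R_orbit_eq[of d y] by simp
  ultimately show ?thesis using that e(1) by simp
qed

end

text \<open>The last edge of a geodesic rises by one, so by \<open>up_step\<close> its reverse is a
  down-dart at the vertex of \<open>B\<close> where it arrives. Hence only the pointed vertex can be
  a local minimum.\<close>

lemma hyp_balanced:
  assumes H: "pointed_hypermap H" and code: "hyp_code H U lab R"
  shows "balanced (darts H) U (opp H) R lab"
    and "d \<in> U \<Longrightarrow> vertex_of H d = point H \<longleftrightarrow> orbit R d \<subseteq> U"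
proof -
  interpret hyper_map H "darts H" U "opp H" R lab
    using code unfolding hyp_code_def by blast
  have lab: "\<And>d. d \<in> U \<Longrightarrow> lab d = int (distance (oriented_adj H) (point H) (vertex_of H d))"
    and U: "U = {d \<in> darts H. face_of H (opp H d) \<in> dark H}"
    using code by (auto simp: hyp_code_def geodesic_label_distance)
  have pointed: "vertex_of H d = point H \<longleftrightarrow> orbit R d \<subseteq> U" if d: "d \<in> U" for d
  proof
    assume "vertex_of H d = point H"
    then show "orbit R d \<subseteq> U" using lab d by (intro s.lowest_orbit) auto
  next
    assume sub: "orbit R d \<subseteq> U"
    show "vertex_of H d = point H"
    proof (rule ccontr)
      assume np: "vertex_of H d \<noteq> point H"
      have "(point H, vertex_of H d) \<in> (oriented_adj H)\<^sup>*"
        using pointed_reachable[OF H] s.U_D[OF d] by auto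
      then obtain w where w: "(w, vertex_of H d) \<in> oriented_adj H"
        "distance (oriented_adj H) (point H) (vertex_of H d) = distance (oriented_adj H) (point H) w + 1"
        using distance_pred np by metis
      then obtain e where e: "e \<in> U" "w = vertex_of H e" "vertex_of H d = vertex_of H (opp H e)"
        by (auto simp: oriented_adj_def U)
      have eD: "e \<in> darts H" using s.U_D e(1) by auto
      have \<alpha>: "rot H (opp H e) \<in> U" using e(1) eD by (simp add: a.rot_U a.i_U)
      have v: "vertex_of H (rot H (opp H e)) = vertex_of H d" using e by (simp add: a.vertex_rot)
      have "lab (rot H (opp H e)) = lab e + 1" using lab \<alpha> d e w v by simp
      then have "R (opp H e) = rot H (opp H e)" using s.up_step e(1) by blast
      moreover have "rot H (opp H e) \<in> orbit R d"
        using v vertex_eq_R[OF d \<alpha>] s.R_orbit_eq[of d "rot H (opp H e)"] by simp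
      ultimately have "opp H e \<in> orbit R d"
        using cyclic_on_f_in[OF s.R_perm cyclic_on_orbit[OF s.R_perm s.finite_D]] by metis
      then show False using sub e(1) eD a.i_U by auto
    qed
  qed
  then show "d \<in> U \<Longrightarrow> vertex_of H d = point H \<longleftrightarrow> orbit R d \<subseteq> U" .
  show "balanced (darts H) U (opp H) R lab"
  proof (cases "darts H = {}")
    case ne: False
    have "planar_map H" "point H \<in> vertex_of H ` darts H"
      using H ne by (auto simp: pointed_hypermap_def verts_def)
    then obtain d where d: "d \<in> U" "vertex_of H d = point H" unfolding a.vertex_image by auto
    have "{T \<in> orbit R ` darts H. T \<subseteq> U} = {orbit R d}"
    proof (intro equalityI subsetI)
      fix T assume "T \<in> {T \<in> orbit R ` darts H. T \<subseteq> U}"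
      then obtain x where x: "T = orbit R x" "orbit R x \<subseteq> U" by auto
      then have xU: "x \<in> U" using s.R_orbit_self by auto
      then show "T \<in> {orbit R d}" using x pointed[OF xU] d vertex_eq_R[OF xU d(1)] by simp
    qed (use d pointed s.U_D in auto)
    then have "card {T \<in> orbit R ` darts H. T \<subseteq> U} = 1" by simp
    moreover have "\<exists>d\<in>U. lab d = 0" using lab[OF d(1)] d by (intro bexI[of _ d]) auto
    moreover have "\<forall>d\<in>U. 0 \<le> lab d" using lab by simp
    ultimately show ?thesis
      using planar_iff[OF ne] \<open>planar_map H\<close> unfolding balanced_def by blast
  qed (simp add: balanced_def)
qed

text \<open>Labels rise by at most one along an edge, so they are at most the distance. Conversely,
  \<open>in_edge\<close> lowers the label by one until the unique local minimum is reached, which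
  yields a path of length \<open>lab d\<close>.\<close>

lemma (in hyper_map) geodesic:
  assumes bal: "card {T \<in> orbit R ` D. T \<subseteq> U} = 1" "\<And>d. d \<in> U \<Longrightarrow> 0 \<le> lab d" "e0 \<in> U" "lab e0 = 0"
    and p: "p \<in> U" "orbit R p \<subseteq> U"
    and r: "r = {(vertex_of G d, vertex_of G (i d)) |d. d \<in> U}"
    and d: "d \<in> U"
  shows "lab d = int (distance r (vertex_of G p) (vertex_of G d))"
proof -
  obtain T where T: "{T \<in> orbit R ` D. T \<subseteq> U} = {T}" using bal(1) card_1_singletonE by blast
  have unique: "orbit R x = orbit R p" if "x \<in> U" "orbit R x \<subseteq> U" for x
  proof -
    have "orbit R x \<in> {T \<in> orbit R ` D. T \<subseteq> U}" "orbit R p \<in> {T \<in> orbit R ` D. T \<subseteq> U}"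
      using that p s.U_D by auto
    then show ?thesis unfolding T by simp
  qed
  have lab_same: "lab x = lab y" if "x \<in> U" "y \<in> U" "vertex_of G x = vertex_of G y" for x y
    using vertex_eq_R that s.R_orbit_eq[of x y] s.lab_orbit[of y x] s.U_D by auto
  have "orbit R e0 \<subseteq> U" using s.lowest_orbit bal by blast
  then have lab_p: "lab p = 0"
    using unique[OF bal(3)] s.lab_orbit[of p e0] s.R_orbit_eq[of e0 p] bal s.U_D by simp
  have le: "lab x \<le> int n" if "(vertex_of G p, v) \<in> r ^^ n" "x \<in> U" "vertex_of G x = v" for n v x
    using that
  proof (induction n arbitrary: v x)
    case 0
    then show ?case using lab_same[of x p] p lab_p by simp
  next
    case (Suc n)
    then obtain w where w: "(vertex_of G p, w) \<in> r ^^ n" "(w, v) \<in> r" by auto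
    then obtain e where e: "e \<in> U" "w = vertex_of G e" "v = vertex_of G (i e)" by (auto simp: r)
    have "lab e \<le> int n" using Suc.IH[OF w(1) e(1)] e by simp
    moreover have "lab x = lab (rot G (i e))"
      using e Suc.prems s.U_D by (intro lab_same) (auto simp: a.rot_U a.i_U a.vertex_rot)
    moreover have "lab (rot G (i e)) \<le> lab e + 1" using s.lab_\<alpha>[OF e(1)] .
    ultimately show ?case by simp
  qed
  have path: "(vertex_of G p, vertex_of G x) \<in> r ^^ n" if "x \<in> U" "lab x = int n" for x n
    using that
  proof (induction n arbitrary: x)
    case 0
    then have "orbit R x \<subseteq> U" using s.lowest_orbit bal by auto
    then show ?case using unique 0 vertex_eq_R[OF p(1), of x] by auto
  next
    case (Suc n)
    have "\<not> orbit R x \<subseteq> U"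
    proof
      assume "orbit R x \<subseteq> U"
      then have "lab x = lab p" using unique Suc.prems s.R_orbit_eq[of p x] s.lab_orbit[of x p] p s.U_D by simp
      then show False using lab_p Suc.prems by simp
    qed
    then obtain e where e: "e \<in> U" "lab e = lab x - 1" "vertex_of G (i e) = vertex_of G x"
      using in_edge Suc.prems by blast
    then have "(vertex_of G p, vertex_of G e) \<in> r ^^ n" using Suc by auto
    moreover have "(vertex_of G e, vertex_of G x) \<in> r" using e by (force simp: r)
    ultimately show ?case by auto
  qed
  obtain k where k: "lab d = int k" using bal(2)[OF d] nonneg_int_cases by blast
  note pk = path[OF d k]
  have "int k \<le> int (distance r (vertex_of G p) (vertex_of G d))"
    using le[OF distance_path[OF relpow_imp_rtrancl[OF pk]] d refl] k by simp
  then show ?thesis using distance_le[OF pk] k by simp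
qed

text \<open>The vertex map is separate because \<open>B\<close> then has no dart at which a local
  minimum could be found.\<close>

lemma hyp_construct_empty:
  fixes i :: "'a \<Rightarrow> 'a"
  assumes "level_map {} U i R lab"
  shows "\<exists>H :: 'a ptd_hypermap. pointed_hypermap H \<and> darts H = {} \<and> opp H = i \<and> hyp_code H U lab R"
proof -
  interpret level_map "{}" U i R lab by fact
  define H :: "'a ptd_hypermap" where "H = \<lparr>darts = {}, rot = id, opp = i, dark = {}, point = {}\<rparr>"
  have U: "U = {}" using U_sub by simp
  have "pointed_hypermap H"
    using i_perm by (simp add: pointed_hypermap_def planar_map_def H_def verts_def faces_def edges_def)
  moreover have "hyper_map H (darts H) U (opp H) R lab"
    by unfold_locales (use i_perm R_perm in \<open>auto simp: H_def U\<close>)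
  ultimately show ?thesis
    by (intro exI[of _ H]) (simp add: hyp_code_def H_def U)
qed

lemma hyp_construct:
  fixes i :: "'a \<Rightarrow> 'a"
  assumes lm: "level_map D U i R lab" and bal: "balanced D U i R lab"
  shows "\<exists>H :: 'a ptd_hypermap. pointed_hypermap H \<and> darts H = D \<and> opp H = i \<and> hyp_code H U lab R"
proof (cases "D = {}")
  case True
  then show ?thesis using hyp_construct_empty lm by auto
next
  case ne: False
  interpret level_map D U i R lab by fact
  have bal': "transitive_on D R i" "card (orbit R ` D) + card (orbit (\<lambda>d. R (i d)) ` D) = card U + 2"
    "card {T \<in> orbit R ` D. T \<subseteq> U} = 1" "\<And>d. d \<in> U \<Longrightarrow> 0 \<le> lab d" "\<exists>d\<in>U. lab d = 0"
    using bal ne by (auto simp: balanced_def)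
  obtain n a where n_perm: "n permutes U" and a_perm: "a permutes U"
    and n: "\<And>x. x \<in> U \<Longrightarrow> hits R U x (n x)" and a: "\<And>x. x \<in> U \<Longrightarrow> hits F U x (a x)"
    using return_maps by blast
  have in_U: "n x \<in> U \<longleftrightarrow> x \<in> U" "a x \<in> U \<longleftrightarrow> x \<in> U" "inv a x \<in> U \<longleftrightarrow> x \<in> U" "inv n x \<in> U \<longleftrightarrow> x \<in> U" for x
    using permutes_in_image n_perm a_perm permutes_inv by metis+
  have inv_a [simp]: "a (inv a x) = x" "inv a (a x) = x" for x
    using permutes_inverses[OF a_perm] by auto
  \<comment> \<open>Forced by \<open>\<alpha> d = rot (i d)\<close> outside \<open>U\<close>, and on
    \<open>U\<close> by solving \<open>rot (rot d) = n d\<close>.\<close>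
  define rt where "rt = (\<lambda>d. if d \<in> U then i (inv a (n d)) else if d \<in> D then a (i d) else d)"
  have rt_U: "rt d \<in> U \<longleftrightarrow> d \<notin> U" and rt_D: "rt d \<in> D" if "d \<in> D" for d
  proof -
    have "i (inv a (n d)) \<in> D - U" if "d \<in> U"
      using that in_U U_D[of "inv a (n d)"] by (auto simp: i_U)
    moreover have "a (i d) \<in> U" if "d \<notin> U" using that \<open>d \<in> D\<close> in_U i_U by simp
    ultimately show "rt d \<in> U \<longleftrightarrow> d \<notin> U" "rt d \<in> D"
      using that U_D by (auto simp: rt_def)
  qed
  have rt_perm: "rt permutes D"
  proof (rule inj_imp_permutes[OF _ finite_D])
    show "inj_on rt D"
    proof (rule inj_onI)
      fix x y assume xy: "x \<in> D" "y \<in> D" "rt x = rt y"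
      then have "x \<in> U \<longleftrightarrow> y \<in> U" using rt_U by metis
      then consider "x \<in> U" "y \<in> U" | "x \<notin> U" "y \<notin> U" by blast
      then show "x = y"
      proof cases
        case 1
        then have "inv a (n x) = inv a (n y)" using xy by (simp add: rt_def i_inj)
        then show ?thesis using permutes_inj[OF n_perm] inv_a(1) by (metis injD)
      next
        case 2
        then have "a (i x) = a (i y)" using xy by (simp add: rt_def)
        then show ?thesis using inv_a(2) i_inj by metis
      qed
    qed
  qed (use rt_D in \<open>auto simp: rt_def dest: U_D\<close>)
  \<comment> \<open>The dark faces and the pointed vertex are orbits of the new rotation, so a
    preliminary record is built to name them.\<close>
  define H0 :: "'a ptd_hypermap" where "H0 = \<lparr>darts = D, rot = rt, opp = i, dark = {}, point = {}\<rparr>"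
  obtain p where p: "p \<in> U" "orbit R p \<subseteq> U"
  proof -
    obtain T where "T \<in> {T \<in> orbit R ` D. T \<subseteq> U}"
      using bal'(3) by (metis card_1_singletonE insertI1)
    then obtain p where "orbit R p \<subseteq> U" by auto
    then show ?thesis using that permutes_self_in_orbit[OF R_perm finite_D, of p] by auto
  qed
  define H :: "'a ptd_hypermap" where
    "H = H0 \<lparr>dark := face_of H0 ` (i ` U), point := vertex_of H0 p\<rparr>"
  have H_sel: "darts H = D" "rot H = rt" "opp H = i" by (simp_all add: H_def H0_def)
  have faces: "face_of H = face_of H0" "vertex_of H = vertex_of H0"
  proof -
    have "face_next H = face_next H0" by (rule ext) (simp add: face_next_def H_def H0_def)
    then show "face_of H = face_of H0" by (intro ext) (simp only: face_of_def)
    show "vertex_of H = vertex_of H0" by (rule ext) (simp add: vertex_of_def H_def H0_def)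
  qed
  have dark: "dark H = face_of H ` (i ` U)" "point H = vertex_of H p"
    unfolding faces by (simp_all add: H_def)
  interpret A: alternating_map H D U i
    by unfold_locales
      (use finite_D U_sub rt_perm i_perm i_i i_U rt_U in \<open>auto simp: H_sel\<close>)
  have S: "split_map D U i R lab (\<lambda>d. rot H (rot H d)) (\<lambda>d. rot H (i d)) (face_next H)"
  proof
    fix e assume e: "e \<in> U"
    have eD: "e \<in> D" using U_D[OF e] .
    have "inv a (n e) \<in> U" using e in_U by simp
    then have "rt (rt e) = n e" using e U_D[of "inv a (n e)"] by (simp add: rt_def i_U i_i)
    then show "hits R U e (rot H (rot H e))" using n[OF e] by (simp add: H_sel)
    have "rt (i e) = a e" using e eD by (simp add: rt_def i_U i_i)
    then show "hits F U e (rot H (i e))" using a[OF e] by (simp add: H_sel)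
    show "face_next H e \<in> U" using A.face_next_U e eD by simp
    show "rot H (rot H (face_next H e)) = rot H (i e)" using A.\<nu>_face_next[OF e] by simp
  qed
  interpret hyper_map H D U i R lab
    using A.alternating_map_axioms S by (simp add: hyper_map_def)
  have U_eq: "U = {d \<in> darts H. face_of H (opp H d) \<in> dark H}"
  proof -
    have "face_of H (i d) \<in> dark H \<longleftrightarrow> d \<in> U" if "d \<in> D" for d
    proof
      assume "face_of H (i d) \<in> dark H"
      then obtain e where e: "e \<in> U" "face_of H (i d) = face_of H (i e)" by (auto simp: dark)
      then have "face_of H (i d) \<inter> U = {}" using A.face_\<phi>_sub(2)[of "i e"] U_D i_U by auto
      then have "i d \<notin> U" using A.face_\<phi>_sub(2)[of "i d"] that by simp
      then show "d \<in> U" using that by (simp add: i_U)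
    qed (simp add: dark)
    then show ?thesis using U_sub by (auto simp: H_sel)
  qed
  have "planar_map H" using planar_iff[OF ne] bal'(1,2) by simp
  moreover have "point H \<in> verts H" using p U_D ne by (simp add: verts_def dark H_sel)
  moreover have "dark H \<subseteq> faces H" using ne U_D by (auto simp: dark faces_def H_sel)
  moreover have "{} \<notin> dark H" using A.face_self by (auto simp: dark)
  moreover have "\<forall>d\<in>darts H. face_of H d \<in> dark H \<longleftrightarrow> face_of H (opp H d) \<notin> dark H"
  proof
    fix d assume "d \<in> darts H"
    then have that: "d \<in> D" by (simp add: H_sel)
    have *: "face_of H (i z) \<in> dark H \<longleftrightarrow> z \<in> U" if "z \<in> D" for z
      using that U_eq by (auto simp: H_sel)
    show "face_of H d \<in> dark H \<longleftrightarrow> face_of H (opp H d) \<notin> dark H"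
      using *[of d] *[of "i d"] that by (simp add: H_sel i_U i_i)
  qed
  moreover have "\<forall>v\<in>verts H. even (card v)"
    using ne A.even_vertex by (auto simp: verts_def H_sel)
  ultimately have pointed: "pointed_hypermap H"
    unfolding pointed_hypermap_def by blast
  obtain e0 where e0: "e0 \<in> U" "lab e0 = 0" using bal'(5) by auto
  have r: "oriented_adj H = {(vertex_of H d, vertex_of H (i d)) |d. d \<in> U}"
    unfolding oriented_adj_def using U_eq by (auto simp: H_sel)
  have "\<forall>d\<in>U. lab d = geodesic_label H (vertex_of H d)"
    unfolding geodesic_label_distance dark(2)
    using geodesic[OF bal'(3,4) e0 p r] by blast
  then have "hyp_code H U lab R"
    using hyper_map_axioms U_eq by (simp add: hyp_code_def H_sel)
  then show ?thesis using pointed H_sel by blast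
qed

section \<open>Mobiles\<close>

text \<open>For a mobile, \<open>U\<close> consists of the darts starting at the black vertices.\<close>

locale bicoloured_map = dart_map +
  assumes rot_U: "d \<in> D \<Longrightarrow> rot G d \<in> U \<longleftrightarrow> d \<in> U"
begin

abbreviation "\<alpha> \<equiv> \<lambda>d. i (inv (rot G) (i d))"
abbreviation "\<phi> \<equiv> \<lambda>d. face_next G (face_next G d)"

lemma i_i_all [simp]: "i (i d) = d"
  using i_i[of d] permutes_not_in[OF i_perm, of d] by (cases "d \<in> D") simp_all

lemma inv_rot_U: "d \<in> D \<Longrightarrow> inv (rot G) d \<in> U \<longleftrightarrow> d \<in> U"
  using rot_U[of "inv (rot G) d"] by auto

lemma face_next_U: "d \<in> D \<Longrightarrow> face_next G d \<in> U \<longleftrightarrow> d \<notin> U"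
  by (simp add: face_next_def i_def[symmetric] inv_rot_U i_U)

lemma face_next_D: "face_next G d \<in> D \<longleftrightarrow> d \<in> D"
  by (simp add: face_next_def i_def[symmetric])

text \<open>The relation of \<open>\<nu>\<close>, \<open>\<phi>\<close> and \<open>\<alpha>\<close>
  in \<open>split_map\<close>, with \<open>rot G\<close> as \<open>\<nu>\<close>. Two steps along a
  face lead from one white vertex to the next.\<close>

lemma rot_\<phi>: "rot G (\<phi> d) = \<alpha> d"
  by (simp add: face_next_def i_def[symmetric])

lemma rot_bij: "bij_betw (rot G) (D - U) (D - U)"
  using permutes_bij_betw[OF rot_perm, of "D - U"] finD by (simp add: rot_U)

lemma \<alpha>_perm: "\<alpha> permutes D"
  using permutes_compose[OF permutes_compose[OF i_perm permutes_inv[OF rot_perm]] i_perm]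
  by (simp add: comp_def)

lemma \<alpha>_bij: "bij_betw \<alpha> (D - U) (D - U)"
  using permutes_bij_betw[OF \<alpha>_perm, of "D - U"] finD by (simp add: inv_rot_U i_U)

text \<open>Through \<open>i\<close>, the map \<open>\<alpha>\<close> becomes the clockwise rotation
  at a black vertex, so its cycles are the black vertices seen from their neighbours.\<close>

lemma vertex_i: "vertex_of G (i x) = i ` orbit \<alpha> x"
proof -
  have "permutation (rot G)" using rot_perm finD by (metis permutation_permutes)
  then have "vertex_of G (i x) = orbit (inv (rot G)) (i x)"
    by (simp add: vertex_of_def orbit_inv_eq)
  also have "\<dots> = i ` orbit \<alpha> x"
  proof (rule orbit_inverse[symmetric])
    show "x \<in> orbit \<alpha> x" by (rule permutes_self_in_orbit[OF \<alpha>_perm finD])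
  qed simp
  finally show ?thesis .
qed

lemma vertex_sub_U: "x \<in> U \<Longrightarrow> vertex_of G x \<subseteq> U" "x \<in> D - U \<Longrightarrow> vertex_of G x \<subseteq> D - U"
  using orbit_closed[of _ "rot G" x U] orbit_closed[of _ "rot G" x "D - U"] U_D rot_U
  by (auto simp: vertex_of_def)

lemma face_\<phi>:
  assumes "x \<in> D - U" shows "face_of G x \<inter> (D - U) = orbit \<phi> x"
  unfolding face_of_def
proof (rule orbit_hits)
  show "hits (face_next G) (D - U) a (\<phi> a)" if "a \<in> D - U" for a
    using that by (auto simp: hits_iff[of "face_next G" "D - U" a]
      hits_iff[of "face_next G" "D - U" "face_next G a"] face_next_U face_next_D)
qed (fact assms)

lemma U_i_image: "U = i ` (D - U)"
proof (intro equalityI subsetI)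
  fix x assume "x \<in> U"
  then have "i x \<in> D - U" using U_D i_U by auto
  then show "x \<in> i ` (D - U)" by (metis i_i_all imageI)
qed (auto simp: i_U)

lemma card_verts_faces:
  "card (vertex_of G ` D) = card (orbit (rot G) ` (D - U)) + card (orbit \<alpha> ` (D - U))"
  "card (face_of G ` D) = card (orbit \<phi> ` (D - U))"
proof -
  have "D = (D - U) \<union> i ` (D - U)" using U_i_image U_D by auto
  then have "vertex_of G ` D = vertex_of G ` (D - U) \<union> vertex_of G ` (i ` (D - U))"
    by (metis image_Un)
  moreover have "vertex_of G ` (D - U) \<inter> vertex_of G ` (i ` (D - U)) = {}"
  proof -
    have "vertex_of G x \<noteq> vertex_of G (i y)" if "x \<in> D - U" "y \<in> D - U" for x y
      using vertex_sub_U(1)[of "i y"] vertex_sub_U(2)[of x] that vertex_self[of x] i_U[of y] by auto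
    then show ?thesis by auto
  qed
  moreover have "card (vertex_of G ` (i ` (D - U))) = card (orbit \<alpha> ` (D - U))"
  proof -
    have "vertex_of G ` (i ` (D - U)) = (`) i ` (orbit \<alpha> ` (D - U))"
      by (simp add: image_image vertex_i)
    moreover have "inj_on ((`) i) (orbit \<alpha> ` (D - U))"
      using permutes_inj[OF i_perm] by (simp add: inj_image_eq_iff inj_on_def)
    ultimately show ?thesis by (simp add: card_image)
  qed
  moreover have "vertex_of G ` (D - U) = orbit (rot G) ` (D - U)" by (simp add: vertex_of_def)
  ultimately show "card (vertex_of G ` D) = card (orbit (rot G) ` (D - U)) + card (orbit \<alpha> ` (D - U))"
    using finD by (simp add: card_Un_disjoint)
  have "face_of G ` D = face_of G ` (D - U)"
  proof (intro equalityI subsetI)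
    fix f assume "f \<in> face_of G ` D"
    then obtain d where d: "d \<in> D" "f = face_of G d" by auto
    show "f \<in> face_of G ` (D - U)"
    proof (cases "d \<in> U")
      case True
      then have "face_next G d \<in> D - U" using d by (simp add: face_next_U face_next_D)
      then show ?thesis using d face_face_next[of d] by (metis imageI)
    qed (use d in auto)
  qed auto
  moreover have "card (face_of G ` (D - U)) = card (orbit \<phi> ` (D - U))"
  proof (rule card_images)
    fix x y assume "x \<in> D - U" "y \<in> D - U"
    then show "face_of G x = face_of G y \<longleftrightarrow> orbit \<phi> x = orbit \<phi> y"
      using face_\<phi>[of x] face_\<phi>[of y] face_eq[of x y] face_self[of y] by blast
  qed
  ultimately show "card (face_of G ` D) = card (orbit \<phi> ` (D - U))" by simp
qed

lemma rot_closed_iff: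
  assumes S: "S \<subseteq> D" "\<And>x. x \<in> S \<Longrightarrow> i x \<in> S"
  shows "(\<forall>x\<in>S. rot G x \<in> S) \<longleftrightarrow> (\<forall>x\<in>S \<inter> (D - U). rot G x \<in> S \<and> \<alpha> x \<in> S)"
proof
  have fin: "finite S" using finD S finite_subset by metis
  {
    assume A: "\<forall>x\<in>S. rot G x \<in> S"
    have "rot G x \<in> S \<longleftrightarrow> x \<in> S" for x
      by (rule permutes_closed_image[OF rot_perm fin]) (use A in auto)
    then have "inv (rot G) x \<in> S" if "x \<in> S" for x using that inv_rot(2) by metis
    then show "\<forall>x\<in>S \<inter> (D - U). rot G x \<in> S \<and> \<alpha> x \<in> S" using A S(2) by auto
  }
  assume A: "\<forall>x\<in>S \<inter> (D - U). rot G x \<in> S \<and> \<alpha> x \<in> S"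
  define a where "a = (\<lambda>x. if x \<in> D - U then \<alpha> x else x)"
  have a: "a permutes D - U" unfolding a_def by (rule permutes_if_bij_betw[OF \<alpha>_bij])
  have a_iff: "a x \<in> S \<inter> (D - U) \<longleftrightarrow> x \<in> S \<inter> (D - U)" for x
    by (rule permutes_closed_image[OF a])
      (use fin A \<alpha>_bij in \<open>auto simp: a_def dest: bij_betwE\<close>)
  show "\<forall>x\<in>S. rot G x \<in> S"
  proof
    fix x assume x: "x \<in> S"
    then have xD: "x \<in> D" using S by auto
    show "rot G x \<in> S"
    proof (cases "x \<in> U")
      case True
      \<comment> \<open>At a black vertex the rotation is the inverse of \<open>\<alpha>\<close>,
        conjugated by \<open>i\<close>.\<close>
      have "a (i (rot G x)) = i x" using True xD by (simp add: a_def i_U rot_U)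
      then have "a (i (rot G x)) \<in> S \<inter> (D - U)" using S(2)[OF x] True xD by (simp add: i_U)
      then have "i (rot G x) \<in> S" unfolding a_iff by simp
      then show ?thesis using S(2)[of "i (rot G x)"] by simp
    qed (use A x xD in auto)
  qed
qed

end

text \<open>The split structure is the one for the dual levels, so the darts leaving white vertices
  play the role of \<open>U\<close>. In this way \<open>U\<close>, \<open>R\<close> and
  \<open>lab\<close> themselves mean the same as for hypermaps.\<close>

locale mobile_map = a: bicoloured_map G D U i +
  s: split_map D "D - U" i R "\<lambda>d. - lab d" "rot G" "\<lambda>d. i (inv (rot G) (i d))"
    "\<lambda>d. face_next G (face_next G d)"
  for G :: "('a, 'z) comb_map_scheme" and D U i R lab
begin

lemma primal: "level_map D U i R lab"
proof -
  have "D - (D - U) = U" using a.U_D by auto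
  then show ?thesis using s.dual by simp
qed

lemma transitive: "transitive_on D (rot G) i \<longleftrightarrow> transitive_on D R i"
  by (rule transitive_on_cong) (simp only: s.closed_iff a.rot_closed_iff)

lemma missing: "{T \<in> orbit R ` D. T \<inter> (D - U) = {}} = {T \<in> orbit R ` D. T \<subseteq> U}"
  using permutes_orbit_subset[OF s.R_perm] by blast

text \<open>In the dual, \<open>light_bij\<close> matches the faces of the mobile with the local
  minima of \<open>B\<close>. If there is one face, it replaces in Euler's formula the vertex of
  \<open>B\<close> that is not a white vertex.\<close>

lemma plane_tree_iff:
  assumes "D \<noteq> {}"
  shows "plane_tree G \<longleftrightarrow> transitive_on D R i \<and>
    card (orbit R ` D) + card (orbit (\<lambda>d. R (i d)) ` D) = card U + 2 \<and>
    card {T \<in> orbit R ` D. T \<subseteq> U} = 1"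
proof -
  have "card (face_of G ` D) = card {T \<in> orbit R ` D. T \<subseteq> U}"
    unfolding a.card_verts_faces missing[symmetric] using s.light_bij by (rule bij_betw_same_card)
  moreover have "faces G = face_of G ` D" using assms by (simp add: faces_def a.D_def)
  ultimately show ?thesis
    unfolding plane_tree_def a.planar_map_iff[OF assms] transitive
    using a.card_verts_faces s.card_vertices_faces by auto
qed

lemma vertex_R: "x \<in> D - U \<Longrightarrow> vertex_of G x = orbit R x \<inter> (D - U)"
  using s.\<nu>_orbit by (simp add: vertex_of_def)

end

text \<open>The mobile fixes the labels of the darts leaving white vertices; a dart of
  \<open>U\<close> is one lower than the white vertex it points to.\<close>

definition mob_code :: "('a, 'z) mobile_scheme \<Rightarrow> 'a set \<Rightarrow> ('a \<Rightarrow> int) \<Rightarrow> ('a \<Rightarrow> 'a) \<Rightarrow> bool" where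
  "mob_code M U lab R \<longleftrightarrow> mobile_map M (darts M) U (opp M) R lab \<and>
     U = {d \<in> darts M. vertex_of M d \<in> black M} \<and>
     (\<forall>d\<in>darts M - U. lab d = label M (vertex_of M d))"

lemma mobile_bicoloured:
  assumes "is_mobile M"
  shows "bicoloured_map M (darts M) {d \<in> darts M. vertex_of M d \<in> black M} (opp M)"
proof -
  define U where "U = {d \<in> darts M. vertex_of M d \<in> black M}"
  have pm: "finite (darts M)" "rot M permutes darts M" "opp M permutes darts M"
    "\<And>d. d \<in> darts M \<Longrightarrow> opp M (opp M d) = d"
    using assms by (auto simp: is_mobile_def plane_tree_def planar_map_def)
  have col: "\<And>d. d \<in> darts M \<Longrightarrow> vertex_of M d \<in> black M \<longleftrightarrow> vertex_of M (opp M d) \<notin> black M"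
    using assms unfolding is_mobile_def by blast
  have inD: "opp M d \<in> darts M \<longleftrightarrow> d \<in> darts M" "rot M d \<in> darts M \<longleftrightarrow> d \<in> darts M" for d
    using permutes_in_image[OF pm(2)] permutes_in_image[OF pm(3)] by auto
  interpret dart_map M "darts M" U "opp M"
  proof
    show "opp M d \<in> U \<longleftrightarrow> d \<notin> U" if "d \<in> darts M" for d
      using that col[OF that] by (simp add: U_def inD)
  qed (use pm in \<open>simp_all add: U_def\<close>)
  show ?thesis unfolding U_def[symmetric]
    by unfold_locales (simp add: U_def inD vertex_rot)
qed

lemma mobile_slope:
  assumes M: "is_mobile M" and d: "d \<in> darts M" "vertex_of M d \<in> black M"
  shows "neighbour_label M (inv (rot M) d) \<ge> neighbour_label M d - 1"
proof -
  interpret bicoloured_map M "darts M" "{d \<in> darts M. vertex_of M d \<in> black M}" "opp M"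
    by (rule mobile_bicoloured[OF M])
  have "\<forall>b\<in>black M. \<forall>d\<in>b. neighbour_label M (inv (rot M) d) \<ge> neighbour_label M d - 1"
    using M unfolding is_mobile_def by blast
  then show ?thesis using d vertex_self[of d] by blast
qed

lemma mob_code_exists:
  assumes M: "is_mobile M"
  shows "\<exists>U lab R. mob_code M U lab R"
proof -
  define U where "U = {d \<in> darts M. vertex_of M d \<in> black M}"
  interpret bicoloured_map M "darts M" U "opp M"
    unfolding U_def by (rule mobile_bicoloured[OF M])
  have "\<exists>R l. split_map (darts M) (darts M - U) (opp M) R l (rot M) \<alpha> \<phi> \<and>
      (\<forall>e\<in>darts M - U. l e = - label M (vertex_of M e))"
  proof (rule split_map_exists)
    fix e assume e: "e \<in> darts M - U"
    then have "opp M e \<in> U" by (simp add: i_U)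
    \<comment> \<open>After negation, the mobile inequality is the rise of at most one along
      \<open>\<alpha>\<close>.\<close>
    then have "neighbour_label M (inv (rot M) (opp M e)) \<ge> neighbour_label M (opp M e) - 1"
      using mobile_slope[OF M] by (simp add: U_def)
    then show "- label M (vertex_of M (\<alpha> e)) \<le> - label M (vertex_of M e) + 1"
      by (simp add: neighbour_label_def)
    show "\<phi> e \<in> darts M - U \<and> rot M (\<phi> e) = \<alpha> e"
      using e by (simp add: face_next_U face_next_D rot_\<phi>)
  qed (use finD i_perm i_i i_U rot_bij \<alpha>_bij vertex_rot in auto)
  then obtain R l where R: "split_map (darts M) (darts M - U) (opp M) R l (rot M) \<alpha> \<phi>"
    "\<forall>e\<in>darts M - U. l e = - label M (vertex_of M e)" by blast
  have "split_map (darts M) (darts M - U) (opp M) R (\<lambda>d. - (- l d)) (rot M) \<alpha> \<phi>" using R(1) by simp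
  then have "mobile_map M (darts M) U (opp M) R (\<lambda>d. - l d)"
    unfolding mobile_map_def using bicoloured_map_axioms by blast
  then show ?thesis using R(2) unfolding mob_code_def U_def[symmetric] by fastforce
qed

lemma mob_balanced:
  assumes M: "is_mobile M" and code: "mob_code M U lab R"
  shows "balanced (darts M) U (opp M) R lab"
proof (cases "darts M = {}")
  case ne: False
  interpret mobile_map M "darts M" U "opp M" R lab
    using code unfolding mob_code_def by blast
  interpret p: level_map "darts M" U "opp M" R lab by (rule primal)
  have U: "U = {d \<in> darts M. vertex_of M d \<in> black M}"
    and lab: "\<And>d. d \<in> darts M - U \<Longrightarrow> lab d = label M (vertex_of M d)"
    using code unfolding mob_code_def by blast+
  have white: "white M = vertex_of M ` (darts M - U)"
    using ne by (auto simp: white_def verts_def U)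
  have "\<exists>v\<in>white M. label M v = 1" "\<forall>v\<in>white M. 1 \<le> label M v"
    using M unfolding is_mobile_def by blast+
  then obtain d where d: "d \<in> darts M - U" "lab d = 1" and ge: "\<And>e. e \<in> darts M - U \<Longrightarrow> 1 \<le> lab e"
    using lab unfolding white by auto
  \<comment> \<open>One below the least white label 1 lies level 0, which is where the hypermap has
    its pointed vertex.\<close>
  have "opp M d \<in> U" "lab (opp M d) = 0" using d p.lab_i' p.i_U by auto
  moreover have "0 \<le> lab e" if "e \<in> U" for e
    using ge[of "opp M e"] that p.lab_i p.U_D p.i_U by auto
  moreover have "plane_tree M" using M by (simp add: is_mobile_def)
  ultimately show ?thesis using plane_tree_iff[OF ne] unfolding balanced_def by blast
qed (simp add: balanced_def)

lemma mob_construct_empty: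
  fixes i :: "'a \<Rightarrow> 'a"
  assumes "level_map {} U i R lab"
  shows "\<exists>M :: 'a mobile. is_mobile M \<and> darts M = {} \<and> opp M = i \<and> mob_code M U lab R"
proof -
  interpret level_map "{}" U i R lab by fact
  \<comment> \<open>The single vertex is white, and the normalisation of mobiles forces its label to
    be 1.\<close>
  define M :: "'a mobile" where "M = \<lparr>darts = {}, rot = id, opp = i, black = {}, label = \<lambda>_. 1\<rparr>"
  have U: "U = {}" using U_sub by simp
  have "is_mobile M"
    using i_perm by (simp add: is_mobile_def plane_tree_def planar_map_def M_def verts_def faces_def
      edges_def white_def)
  moreover have "mobile_map M (darts M) U (opp M) R lab"
    by unfold_locales (use i_perm R_perm in \<open>auto simp: M_def U\<close>)
  ultimately show ?thesis
    by (intro exI[of _ M]) (simp add: mob_code_def M_def U)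
qed

lemma mob_construct:
  fixes i :: "'a \<Rightarrow> 'a"
  assumes lm: "level_map D U i R lab" and bal: "balanced D U i R lab"
  shows "\<exists>M :: 'a mobile. is_mobile M \<and> darts M = D \<and> opp M = i \<and> mob_code M U lab R"
proof (cases "D = {}")
  case True
  then show ?thesis using mob_construct_empty lm by auto
next
  case ne: False
  interpret p: level_map D U i R lab by fact
  interpret level_map D "D - U" i R "\<lambda>d. - lab d" by (rule p.dual)
  define W where "W = D - U"
  have bal': "transitive_on D R i" "card (orbit R ` D) + card (orbit (\<lambda>d. R (i d)) ` D) = card U + 2"
    "card {T \<in> orbit R ` D. T \<subseteq> U} = 1" "\<And>d. d \<in> U \<Longrightarrow> 0 \<le> lab d" "\<exists>d\<in>U. lab d = 0"
    using bal ne by (auto simp: balanced_def)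
  obtain n a where n_perm: "n permutes W" and a_perm: "a permutes W"
    and n: "\<And>x. x \<in> W \<Longrightarrow> hits R W x (n x)" and a: "\<And>x. x \<in> W \<Longrightarrow> hits F W x (a x)"
    using return_maps unfolding W_def by blast
  have in_W: "n x \<in> W \<longleftrightarrow> x \<in> W" "a x \<in> W \<longleftrightarrow> x \<in> W" "inv a x \<in> W \<longleftrightarrow> x \<in> W" for x
    using permutes_in_image n_perm a_perm permutes_inv by metis+
  have inv_a [simp]: "a (inv a x) = x" "inv a (a x) = x" for x
    using permutes_inverses[OF a_perm] by auto
  have iW: "i x \<in> W \<longleftrightarrow> x \<in> U" if "x \<in> D" for x using that p.i_U by (auto simp: W_def)
  have WD: "x \<in> D" "x \<notin> U" if "x \<in> W" for x using that by (auto simp: W_def)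
  \<comment> \<open>Forced as well: the return map \<open>n\<close> at white vertices, and at black
    ones the solution of \<open>a x = i (inv rot (i x))\<close>.\<close>
  define rt where "rt = (\<lambda>d. if d \<in> W then n d else if d \<in> D then i (inv a (i d)) else d)"
  have rt_both: "(rt d \<in> U \<longleftrightarrow> d \<in> U) \<and> rt d \<in> D" if d: "d \<in> D" for d
  proof (cases "d \<in> U")
    case True
    then have "inv a (i d) \<in> W" using d iW in_W by simp
    then have "i (inv a (i d)) \<in> U" "i (inv a (i d)) \<in> D" using p.i_U WD by auto
    moreover have "rt d = i (inv a (i d))" using d True by (simp add: rt_def W_def)
    ultimately show ?thesis using True by simp
  next
    case False
    then have "n d \<in> W" using d in_W by (simp add: W_def)
    moreover have "rt d = n d" using d False by (simp add: rt_def W_def)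
    ultimately show ?thesis using False WD by simp
  qed
  then have rt_U: "\<And>d. d \<in> D \<Longrightarrow> rt d \<in> U \<longleftrightarrow> d \<in> U" and rt_D: "\<And>d. d \<in> D \<Longrightarrow> rt d \<in> D"
    by blast+
  have rt_perm: "rt permutes D"
  proof (rule inj_imp_permutes[OF _ finite_D])
    show "inj_on rt D"
    proof (rule inj_onI)
      fix x y assume xy: "x \<in> D" "y \<in> D" "rt x = rt y"
      then have "x \<in> U \<longleftrightarrow> y \<in> U" using rt_U by metis
      then consider "x \<in> W" "y \<in> W" | "x \<notin> W" "y \<notin> W" using xy by (auto simp: W_def)
      then show "x = y"
      proof cases
        case 1
        then have "n x = n y" using xy by (simp add: rt_def)
        then show ?thesis using permutes_inj[OF n_perm] by (metis injD)
      next
        case 2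
        then have "inv a (i x) = inv a (i y)" using xy by (simp add: rt_def i_inj)
        then show ?thesis using inv_a(1) i_inj by metis
      qed
    qed
  qed (use rt_D in \<open>auto simp: rt_def dest: WD\<close>)
  \<comment> \<open>Any dart of a white vertex gives the same label, since all of them lie in one
    cycle of \<open>R\<close>.\<close>
  define M0 :: "'a mobile" where "M0 = \<lparr>darts = D, rot = rt, opp = i, black = {},
    label = \<lambda>v. lab (SOME d. d \<in> v)\<rparr>"
  define M where "M = M0 \<lparr>black := vertex_of M0 ` U\<rparr>"
  have M_sel: "darts M = D" "rot M = rt" "opp M = i" "label M = (\<lambda>v. lab (SOME d. d \<in> v))"
    by (simp_all add: M_def M0_def)
  have "vertex_of M = vertex_of M0"
    by (rule ext) (simp add: vertex_of_def M_def M0_def)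
  then have black: "black M = vertex_of M ` U" by (simp add: M_def)
  interpret A: bicoloured_map M D U i
    by unfold_locales
      (use finite_D p.U_sub rt_perm i_perm p.i_i p.i_U rt_U in \<open>auto simp: M_sel\<close>)
  have inv_rt: "inv rt (i x) = i (a x)" if "x \<in> W" for x
  proof -
    have "a x \<in> W" "a x \<in> D" using that in_W WD by auto
    then have "rt (i (a x)) = i x" using iW[of "i (a x)"] WD by (simp add: rt_def iW)
    then show ?thesis using A.inv_rot(1)[of "i (a x)"] by (simp add: M_sel)
  qed
  have S: "split_map D (D - U) i R (\<lambda>d. - lab d) (rot M) (\<lambda>d. i (inv (rot M) (i d)))
      (\<lambda>d. face_next M (face_next M d))"
  proof
    fix e assume e: "e \<in> D - U"
    then have eW: "e \<in> W" by (simp add: W_def)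
    show "hits R (D - U) e (rot M e)" using n[OF eW] eW by (simp add: M_sel rt_def W_def[symmetric])
    show "hits F (D - U) e (i (inv (rot M) (i e)))"
      using a[OF eW] inv_rt[OF eW] by (simp add: M_sel W_def[symmetric])
    show "face_next M (face_next M e) \<in> D - U" using e by (simp add: A.face_next_U A.face_next_D)
    show "rot M (face_next M (face_next M e)) = i (inv (rot M) (i e))" by (rule A.rot_\<phi>)
  qed
  interpret mobile_map M D U i R lab
    using A.bicoloured_map_axioms S by (simp add: mobile_map_def)
  have black_iff: "vertex_of M d \<in> black M \<longleftrightarrow> d \<in> U" if "d \<in> D" for d
  proof
    assume "vertex_of M d \<in> black M"
    then obtain e where "e \<in> U" "vertex_of M d = vertex_of M e" by (auto simp: black)
    then show "d \<in> U" using A.vertex_sub_U(1)[of e] A.vertex_self[of d] by auto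
  qed (simp add: black)
  then have U_eq: "U = {d \<in> darts M. vertex_of M d \<in> black M}" using p.U_sub by (auto simp: M_sel)
  have label: "label M (vertex_of M d) = lab d" if d: "d \<in> D - U" for d
  proof -
    have "(SOME e. e \<in> vertex_of M d) \<in> vertex_of M d" using A.vertex_self[of d] by (rule someI)
    then have "(SOME e. e \<in> vertex_of M d) \<in> orbit R d" using vertex_R[OF d] by auto
    then show ?thesis using s.lab_orbit d by (simp add: M_sel)
  qed
  have white: "white M = vertex_of M ` (D - U)"
    using ne black_iff by (auto simp: white_def verts_def M_sel)
  have "plane_tree M" using plane_tree_iff[OF ne] bal' by blast
  moreover have "black M \<subseteq> verts M" using p.U_D ne by (auto simp: black verts_def M_sel)
  moreover have "\<forall>d\<in>darts M. vertex_of M d \<in> black M \<longleftrightarrow> vertex_of M (opp M d) \<notin> black M"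
  proof
    fix d assume "d \<in> darts M"
    then show "vertex_of M d \<in> black M \<longleftrightarrow> vertex_of M (opp M d) \<notin> black M"
      using black_iff[of d] black_iff[of "i d"] p.i_U[of d] by (simp add: M_sel)
  qed
  moreover have "\<forall>v\<in>white M. 1 \<le> label M v"
  proof
    fix v assume "v \<in> white M"
    then obtain d where d: "d \<in> D - U" "v = vertex_of M d" by (auto simp: white)
    then show "1 \<le> label M v" using bal'(4)[of "i d"] label[of d] p.lab_i'[of d] p.i_U by auto
  qed
  moreover have "\<exists>v\<in>white M. label M v = 1"
  proof -
    obtain e where e: "e \<in> U" "lab e = 0" using bal'(5) by auto
    then have "i e \<in> D - U" "lab (i e) = 1" using p.lab_i p.U_D p.i_U by auto
    then show ?thesis using label by (auto simp: white)
  qed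
  moreover have "\<forall>b\<in>black M. \<forall>d\<in>b. neighbour_label M (inv (rot M) d) \<ge> neighbour_label M d - 1"
  proof (intro ballI)
    fix b d assume "b \<in> black M" "d \<in> b"
    then have dU: "d \<in> U" using A.vertex_sub_U(1) by (auto simp: black)
    have x: "i d \<in> D - U" "i (inv (rot M) d) \<in> D - U"
      using dU p.U_D[OF dU] p.i_U by (auto simp: A.inv_rot_U)
    then show "neighbour_label M (inv (rot M) d) \<ge> neighbour_label M d - 1"
      using s.lab_\<alpha>[of "i d"] label[OF x(1)] label[OF x(2)]
      by (simp add: neighbour_label_def M_sel)
  qed
  ultimately have "is_mobile M" unfolding is_mobile_def by blast
  moreover have "mob_code M U lab R"
    using mobile_map_axioms U_eq label by (simp add: mob_code_def M_sel)
  ultimately show ?thesis using M_sel by blast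
qed

section \<open>Isomorphisms\<close>

text \<open>Isomorphism of labelled bipartite maps, the common ground on which hypermap and mobile
  isomorphisms are compared.\<close>

definition code_iso where
  "code_iso h D U i R lab D' U' i' R' lab' \<longleftrightarrow> bij_betw h D D' \<and>
    (\<forall>d\<in>D. h (i d) = i' (h d) \<and> h (R d) = R' (h d) \<and> (h d \<in> U' \<longleftrightarrow> d \<in> U) \<and> lab' (h d) = lab d)"

lemma code_iso_refl: "code_iso (\<lambda>x. x) D U i R lab D U i R lab"
  unfolding code_iso_def using bij_betw_id[of D] by (auto simp: id_def)

lemma code_iso_trans:
  assumes "code_iso h D U i R lab D' U' i' R' lab'" "code_iso k D' U' i' R' lab' D'' U'' i'' R'' lab''"
  shows "code_iso (k \<circ> h) D U i R lab D'' U'' i'' R'' lab''"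
proof -
  have "h d \<in> D'" if "d \<in> D" for d using assms(1) that by (auto simp: code_iso_def dest: bij_betwE)
  then show ?thesis
    using assms by (auto simp: code_iso_def intro: bij_betw_trans)
qed

lemma code_iso_sym:
  assumes h: "code_iso h D U i R lab D' U' i' R' lab'"
    and cl: "\<And>d. d \<in> D \<Longrightarrow> i d \<in> D \<and> R d \<in> D"
  shows "code_iso (inv_into D h) D' U' i' R' lab' D U i R lab"
proof -
  have bij: "bij_betw h D D'" using h by (simp add: code_iso_def)
  have inv: "inv_into D h (h d) = d" if "d \<in> D" for d
    using bij that by (simp add: bij_betw_def)
  show ?thesis unfolding code_iso_def
  proof (intro conjI ballI)
    show "bij_betw (inv_into D h) D' D" by (rule bij_betw_inv_into[OF bij])
    fix d' assume "d' \<in> D'"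
    then obtain d where d: "d \<in> D" "d' = h d" using bij by (auto simp: bij_betw_def)
    have "i' d' = h (i d)" "R' d' = h (R d)" "d' \<in> U' \<longleftrightarrow> d \<in> U" "lab' d' = lab d"
      using h d by (auto simp: code_iso_def)
    then show "inv_into D h (i' d') = i (inv_into D h d')" "inv_into D h (R' d') = R (inv_into D h d')"
      "inv_into D h d' \<in> U \<longleftrightarrow> d' \<in> U'" "lab (inv_into D h d') = lab' d'"
      using d inv cl by simp_all
  qed
qed

lemma map_iso_inj:
  "map_iso_by h G G' \<Longrightarrow> A \<subseteq> darts G \<Longrightarrow> B \<subseteq> darts G \<Longrightarrow> h ` A = h ` B \<Longrightarrow> A = B"
  using inj_on_image_eq_iff[of h "darts G" A B] by (auto simp: map_iso_by_def bij_betw_def)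

lemma map_iso_orbit:
  assumes iso: "map_iso_by h G G'" and dm: "dart_map G (darts G) U (opp G)" "dart_map G' (darts G') U' (opp G')"
    and d: "d \<in> darts G"
  shows "vertex_of G' (h d) = h ` vertex_of G d" "face_of G' (h d) = h ` face_of G d"
proof -
  interpret A: dart_map G "darts G" U "opp G" by fact
  interpret B: dart_map G' "darts G'" U' "opp G'" by fact
  have hD: "h x \<in> darts G'" if "x \<in> darts G" for x
    using iso that by (auto simp: map_iso_by_def dest: bij_betwE)
  have rot: "h (rot G x) = rot G' (h x)" and op: "h (opp G x) = opp G' (h x)" if "x \<in> darts G" for x
    using iso that by (auto simp: map_iso_by_def)
  have face: "h (face_next G x) = face_next G' (h x)" if x: "x \<in> darts G" for x
  proof -
    have "rot G' (h (face_next G x)) = opp G' (h x)"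
      using rot[of "face_next G x"] op[OF x] x by (simp add: face_next_def)
    then show ?thesis unfolding face_next_def using B.inv_rot(1) by metis
  qed
  show "vertex_of G' (h d) = h ` vertex_of G d" unfolding vertex_of_def
    by (rule orbit_inverse[symmetric])
      (use A.vertex_self[of d] A.vertex_sub[OF d] rot in \<open>auto simp: vertex_of_def\<close>)
  show "face_of G' (h d) = h ` face_of G d" unfolding face_of_def
    by (rule orbit_inverse[symmetric])
      (use A.face_self[of d] A.face_sub[OF d] face in \<open>auto simp: face_of_def\<close>)
qed

lemma hyp_code_U_verts:
  assumes "hyp_code H U lab R" "darts H \<noteq> {}"
  shows "verts H = vertex_of H ` U"
proof -
  interpret hyper_map H "darts H" U "opp H" R lab
    using assms unfolding hyp_code_def by blast
  show ?thesis using assms(2) a.vertex_image by (simp add: verts_def)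
qed

lemma hyp_code_dark:
  assumes H: "pointed_hypermap H" and code: "hyp_code H U lab R"
  shows "dark H = face_of H ` (opp H ` U)"
proof -
  interpret hyper_map H "darts H" U "opp H" R lab
    using code unfolding hyp_code_def by blast
  have U: "U = {d \<in> darts H. face_of H (opp H d) \<in> dark H}"
    using code unfolding hyp_code_def by blast
  have H': "dark H \<subseteq> faces H" "{} \<notin> dark H" using H unfolding pointed_hypermap_def by blast+
  show ?thesis
  proof (intro equalityI subsetI)
    fix f assume f: "f \<in> dark H"
    then have "f \<in> face_of H ` darts H" using H' by (auto simp: faces_def split: if_splits)
    then obtain d where d: "d \<in> darts H" "f = face_of H d" by auto
    then have "opp H d \<in> U" using f by (subst U) (simp add: a.i_i)
    moreover have "f = face_of H (opp H (opp H d))" using d by (simp add: a.i_i)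
    ultimately show "f \<in> face_of H ` (opp H ` U)" by blast
  qed (use U in auto)
qed

text \<open>An isomorphism preserves distances, hence the labels on \<open>U\<close>, and
  \<open>split_map_unique\<close> extends this to \<open>R\<close>. For the identity it says that a
  hypermap has only one code on its darts.\<close>

lemma hypermap_code_iso:
  assumes H: "pointed_hypermap H" "pointed_hypermap H'"
    and code: "hyp_code H U lab R" "hyp_code H' U' lab' R'"
    and iso: "map_iso_by h H H'" "(`) h ` dark H = dark H'" "h ` point H = point H'"
  shows "code_iso h (darts H) U (opp H) R lab (darts H') U' (opp H') R' lab'"
proof -
  interpret A: hyper_map H "darts H" U "opp H" R lab
    using code unfolding hyp_code_def by blast
  interpret B: hyper_map H' "darts H'" U' "opp H'" R' lab'
    using code unfolding hyp_code_def by blast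
  have U: "U = {d \<in> darts H. face_of H (opp H d) \<in> dark H}"
      "U' = {d \<in> darts H'. face_of H' (opp H' d) \<in> dark H'}"
    using code unfolding hyp_code_def by blast+
  have lab: "\<And>d. d \<in> U \<Longrightarrow> lab d = int (distance (oriented_adj H) (point H) (vertex_of H d))"
    "\<And>d. d \<in> U' \<Longrightarrow> lab' d = int (distance (oriented_adj H') (point H') (vertex_of H' d))"
    using code by (auto simp: hyp_code_def geodesic_label_distance)
  have hD: "h x \<in> darts H'" if "x \<in> darts H" for x
    using iso that by (auto simp: map_iso_by_def dest: bij_betwE)
  have rot: "h (rot H x) = rot H' (h x)" and op: "h (opp H x) = opp H' (h x)" if "x \<in> darts H" for x
    using iso that by (auto simp: map_iso_by_def)
  note orb = map_iso_orbit[OF iso(1) A.a.dart_map_axioms B.a.dart_map_axioms]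
  have hU: "h d \<in> U' \<longleftrightarrow> d \<in> U" if d: "d \<in> darts H" for d
  proof -
    have "face_of H' (opp H' (h d)) = h ` face_of H (opp H d)"
      using orb(2)[of "opp H d"] op[OF d] d by simp
    moreover have "h ` face_of H (opp H d) \<in> (`) h ` dark H \<longleftrightarrow> face_of H (opp H d) \<in> dark H"
    proof
      assume "h ` face_of H (opp H d) \<in> (`) h ` dark H"
      then obtain g where g: "g \<in> dark H" "h ` face_of H (opp H d) = h ` g" by auto
      then obtain x where x: "x \<in> U" "g = face_of H (opp H x)"
        using hyp_code_dark[OF H(1) code(1)] by auto
      then have "face_of H (opp H d) = g"
        using map_iso_inj[OF iso(1) A.a.face_sub[of "opp H d"] A.a.face_sub[of "opp H x"]]
          g d A.s.U_D[OF x(1)] by simp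
      then show "face_of H (opp H d) \<in> dark H" using g by simp
    qed simp
    ultimately show ?thesis using hD[OF d] d iso(2) unfolding U by simp
  qed
  have bij: "bij_betw h (darts H) (darts H')" using iso(1) by (simp add: map_iso_by_def)
  have path: "(point H, u) \<in> oriented_adj H ^^ n \<longleftrightarrow> (point H', h ` u) \<in> oriented_adj H' ^^ n"
    if "u \<in> verts H" "darts H \<noteq> {}" for n u
    using that(1)
  proof (induction n arbitrary: u)
    case 0
    have *: "v \<subseteq> darts H" if "v \<in> verts H" for v
      using that hyp_code_U_verts[OF code(1) \<open>darts H \<noteq> {}\<close>] A.a.vertex_sub A.s.U_D by auto
    have "point H \<in> verts H" using H(1) by (simp add: pointed_hypermap_def)
    then have "point H = u \<longleftrightarrow> h ` point H = h ` u"
      using map_iso_inj[OF iso(1) *[of "point H"] *[OF 0]] by auto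
    then show ?case using iso(3) by simp
  next
    case (Suc n)
    show ?case
    proof
      assume "(point H, u) \<in> oriented_adj H ^^ Suc n"
      then obtain w where w: "(point H, w) \<in> oriented_adj H ^^ n" "(w, u) \<in> oriented_adj H" by auto
      then obtain e where e: "e \<in> U" "w = vertex_of H e" "u = vertex_of H (opp H e)"
        by (auto simp: oriented_adj_def U)
      have eD: "e \<in> darts H" using e A.s.U_D by simp
      then have "w \<in> verts H" using e by (auto simp: verts_def)
      then have "(point H', h ` w) \<in> oriented_adj H' ^^ n" using Suc.IH w by blast
      moreover have "(h ` w, h ` u) \<in> oriented_adj H'"
      proof -
        have "h ` w = vertex_of H' (h e)" "h ` u = vertex_of H' (opp H' (h e))"
          using orb(1)[OF eD] orb(1)[of "opp H e"] op[OF eD] e eD by simp_all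
        moreover have "h e \<in> U'" using hU[OF eD] e by simp
        ultimately show ?thesis unfolding oriented_adj_def U by blast
      qed
      ultimately show "(point H', h ` u) \<in> oriented_adj H' ^^ Suc n" by auto
    next
      assume "(point H', h ` u) \<in> oriented_adj H' ^^ Suc n"
      then obtain w' where w: "(point H', w') \<in> oriented_adj H' ^^ n" "(w', h ` u) \<in> oriented_adj H'" by auto
      then obtain e' where e': "e' \<in> U'" "w' = vertex_of H' e'" "h ` u = vertex_of H' (opp H' e')"
        by (auto simp: oriented_adj_def U)
      then obtain e where e: "e \<in> darts H" "e' = h e"
        using bij B.s.U_D by (metis bij_betw_imp_surj_on imageE)
      have eU: "e \<in> U" using hU e e' by simp
      have "w' = h ` vertex_of H e" using orb(1) e e' by simp
      moreover have "vertex_of H e \<in> verts H" using e by (auto simp: verts_def)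
      ultimately have p: "(point H, vertex_of H e) \<in> oriented_adj H ^^ n" using Suc.IH w by blast
      have "h ` u = h ` vertex_of H (opp H e)" using orb(1)[of "opp H e"] op e e' by simp
      moreover have "u \<subseteq> darts H"
        using Suc.prems hyp_code_U_verts[OF code(1) that(2)] A.a.vertex_sub A.s.U_D by auto
      ultimately have "u = vertex_of H (opp H e)"
        using map_iso_inj[OF iso(1) _ A.a.vertex_sub[of "opp H e"]] e by simp
      then have "(vertex_of H e, u) \<in> oriented_adj H" using eU unfolding oriented_adj_def U by blast
      then show "(point H, u) \<in> oriented_adj H ^^ Suc n" using p by auto
    qed
  qed
  have labU: "lab' (h d) = lab d" if d: "d \<in> U" for d
  proof -
    have dD: "d \<in> darts H" using A.s.U_D[OF d] .
    then have "vertex_of H d \<in> verts H" "darts H \<noteq> {}" by (auto simp: verts_def)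
    then have "distance (oriented_adj H) (point H) (vertex_of H d) =
        distance (oriented_adj H') (point H') (h ` vertex_of H d)"
      using path by (simp add: distance_def)
    then show ?thesis using lab hU[OF dD] d orb(1)[OF dD] by simp
  qed
  have r1: "h (rot H (rot H e)) = rot H' (rot H' (h e))"
    and r2: "h (rot H (opp H e)) = rot H' (opp H' (h e))" if "e \<in> U" for e
    using that A.s.U_D rot op by simp_all
  have "h (R d) = R' (h d)" "lab' (h d) = lab d" if "d \<in> darts H" for d
    using split_map_unique[OF A.s.split_map_axioms B.s.split_map_axioms bij op hU labU r1 r2 that] by blast+
  then show ?thesis using bij op hU by (simp add: code_iso_def)
qed

lemma code_iso_hits:
  assumes h: "code_iso h D U i R lab D' U' i' R' lab'" and lm: "level_map D U i R lab" and e: "e \<in> D"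
  shows "hits R U e y \<Longrightarrow> hits R' U' (h e) (h y)"
    "hits (\<lambda>d. R (i d)) U e y \<Longrightarrow> hits (\<lambda>d. R' (i' d)) U' (h e) (h y)"
    "hits R (D - U) e y \<Longrightarrow> hits R' (D' - U') (h e) (h y)"
    "hits (\<lambda>d. R (i d)) (D - U) e y \<Longrightarrow> hits (\<lambda>d. R' (i' d)) (D' - U') (h e) (h y)"
proof -
  interpret level_map D U i R lab by fact
  have "h d \<in> D'" if "d \<in> D" for d using h that by (auto simp: code_iso_def dest: bij_betwE)
  then have *: "h (R d) = R' (h d)" "h (R (i d)) = R' (i' (h d))" "h d \<in> U' \<longleftrightarrow> d \<in> U"
      "h d \<in> D' - U' \<longleftrightarrow> d \<in> D - U"
    if "d \<in> D" for d
    using h that by (auto simp: code_iso_def)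
  show "hits R' U' (h e) (h y)" if "hits R U e y"
    by (rule hits_map[OF that e]) (use * in auto)
  show "hits (\<lambda>d. R' (i' d)) U' (h e) (h y)" if "hits F U e y"
    by (rule hits_map[OF that e]) (use * in auto)
  show "hits R' (D' - U') (h e) (h y)" if "hits R (D - U) e y"
    by (rule hits_map[OF that e]) (use * in auto)
  show "hits (\<lambda>d. R' (i' d)) (D' - U') (h e) (h y)" if "hits F (D - U) e y"
    by (rule hits_map[OF that e]) (use * in auto)
qed

lemma code_iso_orbit:
  assumes h: "code_iso h D U i R lab D' U' i' R' lab'" and lm: "level_map D U i R lab" and e: "e \<in> D"
  shows "orbit R' (h e) = h ` orbit R e"
    "orbit (\<lambda>d. R' (i' d)) (h e) = h ` orbit (\<lambda>d. R (i d)) e"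
proof -
  interpret level_map D U i R lab by fact
  have *: "h (R d) = R' (h d)" "h (R (i d)) = R' (i' (h d))" if "d \<in> D" for d
    using h that by (auto simp: code_iso_def)
  show "orbit R' (h e) = h ` orbit R e"
    by (rule orbit_inverse[symmetric])
      (use permutes_self_in_orbit[OF R_perm finite_D] permutes_orbit_subset[OF R_perm e] * in auto)
  show "orbit (\<lambda>d. R' (i' d)) (h e) = h ` orbit F e"
    by (rule orbit_inverse[symmetric])
      (use permutes_self_in_orbit[OF F_perm finite_D] permutes_orbit_subset[OF F_perm e] * in auto)
qed

text \<open>The rotation is assembled from return maps, which \<open>h\<close> respects. The pointed
  vertex is recognised in \<open>B\<close> as the only local minimum.\<close>

lemma code_hypermap_iso:
  assumes H: "pointed_hypermap H" "pointed_hypermap H'"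
    and code: "hyp_code H U lab R" "hyp_code H' U' lab' R'"
    and h: "code_iso h (darts H) U (opp H) R lab (darts H') U' (opp H') R' lab'"
  shows "map_iso_by h H H'" "(`) h ` dark H = dark H'" "h ` point H = point H'"
proof -
  interpret A: hyper_map H "darts H" U "opp H" R lab
    using code unfolding hyp_code_def by blast
  interpret B: hyper_map H' "darts H'" U' "opp H'" R' lab'
    using code unfolding hyp_code_def by blast
  have bij: "bij_betw h (darts H) (darts H')" using h by (simp add: code_iso_def)
  have hD: "h d \<in> darts H'" if "d \<in> darts H" for d using bij that by (auto dest: bij_betwE)
  have hd: "h (opp H d) = opp H' (h d)" "h (R d) = R' (h d)" "h d \<in> U' \<longleftrightarrow> d \<in> U" if "d \<in> darts H" for d
    using h that by (auto simp: code_iso_def)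
  note hh = code_iso_hits[OF h A.s.level_map_axioms A.s.U_D]
  have r2: "h (rot H (opp H e)) = rot H' (opp H' (h e))" "h (rot H (rot H e)) = rot H' (rot H' (h e))"
    if e: "e \<in> U" for e
  proof -
    have "h e \<in> U'" using hd(3) e A.s.U_D by simp
    then show "h (rot H (opp H e)) = rot H' (opp H' (h e))" "h (rot H (rot H e)) = rot H' (rot H' (h e))"
      using hh(2)[OF e A.s.F_hits[OF e]] hh(1)[OF e A.s.R_hits[OF e]] B.s.F_hits B.s.R_hits hits_det
      by metis+
  qed
  have r1: "h (rot H d) = rot H' (h d)" if d: "d \<in> darts H" "d \<notin> U" for d
    using r2(1)[of "opp H d"] hd(1)[of "opp H d"] d by (simp add: A.a.i_U A.a.i_i)
  have rot: "h (rot H d) = rot H' (h d)" if d: "d \<in> darts H" for d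
  proof (cases "d \<in> U")
    case True
    then have "rot H' (h (rot H d)) = rot H' (rot H' (h d))"
      using r1[of "rot H d"] r2(2) d by (simp add: A.a.rot_U)
    then show ?thesis by (simp add: B.a.rot_inj)
  qed (use r1 d in simp)
  show iso: "map_iso_by h H H'" using bij rot hd by (simp add: map_iso_by_def)
  note orb = map_iso_orbit[OF iso A.a.dart_map_axioms B.a.dart_map_axioms]
  have hU: "h ` U = U'"
  proof (intro equalityI subsetI)
    fix x assume x: "x \<in> U'"
    then obtain d where "d \<in> darts H" "x = h d" using bij B.s.U_D by (metis bij_betw_imp_surj_on imageE)
    then show "x \<in> h ` U" using hd x by auto
  qed (use hd A.s.U_D in auto)
  have "(`) h ` dark H = (\<lambda>e. h ` face_of H (opp H e)) ` U"
    by (simp add: hyp_code_dark[OF H(1) code(1)] image_image)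
  also have "\<dots> = (\<lambda>e. face_of H' (opp H' (h e))) ` U"
  proof (rule image_cong)
    fix e assume "e \<in> U"
    then have e: "e \<in> darts H" by (rule A.s.U_D)
    then show "h ` face_of H (opp H e) = face_of H' (opp H' (h e))"
      using orb(2)[of "opp H e"] hd(1)[OF e] by simp
  qed simp
  also have "\<dots> = (\<lambda>e. face_of H' (opp H' e)) ` U'"
    unfolding hU[symmetric] by (simp add: image_image)
  also have "\<dots> = dark H'" by (simp add: hyp_code_dark[OF H(2) code(2)] image_image)
  finally show "(`) h ` dark H = dark H'" .
  show "h ` point H = point H'"
  proof (cases "darts H = {}")
    case True
    then have "darts H' = {}" using bij by (auto simp: bij_betw_def)
    then show ?thesis using True H by (auto simp: pointed_hypermap_def verts_def)
  next
    case False
    have "point H \<in> vertex_of H ` U"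
      using H(1) hyp_code_U_verts[OF code(1) False] by (auto simp: pointed_hypermap_def)
    then obtain d where d: "d \<in> U" "point H = vertex_of H d" by auto
    then have "orbit R d \<subseteq> U" using hyp_balanced(2)[OF H(1) code(1)] by auto
    moreover have "orbit R' (h d) = h ` orbit R d"
      using code_iso_orbit(1)[OF h A.s.level_map_axioms] d A.s.U_D by simp
    ultimately have "orbit R' (h d) \<subseteq> U'" using hU by auto
    then have "vertex_of H' (h d) = point H'" using hyp_balanced(2)[OF H(2) code(2)] d hU by auto
    then show ?thesis using d orb(1)[of d] A.s.U_D by simp
  qed
qed

lemma mob_code_white:
  assumes M: "mob_code M U lab R" "darts M \<noteq> {}"
  shows "white M = vertex_of M ` (darts M - U)"
  using assms by (auto simp: white_def verts_def mob_code_def)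

lemma mob_code_black:
  assumes M: "is_mobile M" "mob_code M U lab R"
  shows "black M = vertex_of M ` U"
proof (cases "darts M = {}")
  case True
  have "black M \<subseteq> verts M" "\<exists>v\<in>white M. label M v = 1"
    using M(1) unfolding is_mobile_def by blast+
  moreover have "U = {}" using M(2) True by (auto simp: mob_code_def)
  ultimately show ?thesis using True by (auto simp: verts_def white_def)
next
  case False
  have "black M \<subseteq> verts M" using M(1) unfolding is_mobile_def by blast
  then show ?thesis using M(2) False by (auto simp: mob_code_def verts_def)
qed

lemma mobile_code_iso:
  assumes M: "is_mobile M" "is_mobile M'"
    and code: "mob_code M U lab R" "mob_code M' U' lab' R'"
    and iso: "map_iso_by h M M'" "(`) h ` black M = black M'"
      "\<forall>v\<in>white M. label M' (h ` v) = label M v"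
  shows "code_iso h (darts M) U (opp M) R lab (darts M') U' (opp M') R' lab'"
proof -
  interpret A: mobile_map M "darts M" U "opp M" R lab
    using code unfolding mob_code_def by blast
  interpret B: mobile_map M' "darts M'" U' "opp M'" R' lab'
    using code unfolding mob_code_def by blast
  have U: "U = {d \<in> darts M. vertex_of M d \<in> black M}"
      "U' = {d \<in> darts M'. vertex_of M' d \<in> black M'}"
    using code unfolding mob_code_def by blast+
  have bij: "bij_betw h (darts M) (darts M')" using iso(1) by (simp add: map_iso_by_def)
  have hD: "h x \<in> darts M'" if "x \<in> darts M" for x using bij that by (auto dest: bij_betwE)
  have rot: "h (rot M x) = rot M' (h x)" and op: "h (opp M x) = opp M' (h x)" if "x \<in> darts M" for x
    using iso that by (auto simp: map_iso_by_def)
  note orb = map_iso_orbit[OF iso(1) A.a.dart_map_axioms B.a.dart_map_axioms]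
  have hU: "h d \<in> U' \<longleftrightarrow> d \<in> U" if d: "d \<in> darts M" for d
  proof -
    have "h ` vertex_of M d \<in> (`) h ` black M \<longleftrightarrow> vertex_of M d \<in> black M"
    proof
      assume "h ` vertex_of M d \<in> (`) h ` black M"
      then obtain g where g: "g \<in> black M" "h ` vertex_of M d = h ` g" by auto
      then obtain e where "e \<in> darts M" "g = vertex_of M e"
        using mob_code_black[OF M(1) code(1)] A.a.U_D by auto
      then have "vertex_of M d = g"
        using map_iso_inj[OF iso(1) A.a.vertex_sub[of d] A.a.vertex_sub[of e]] g d by simp
      then show "vertex_of M d \<in> black M" using g by simp
    qed simp
    then show ?thesis using orb(1)[OF d] hD[OF d] d iso(2) unfolding U by simp
  qed
  have hU': "h d \<in> darts M' - U' \<longleftrightarrow> d \<in> darts M - U" if d: "d \<in> darts M" for d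
    using hU[OF d] hD[OF d] d by auto
  have lab: "- lab' (h d) = - lab d" if d: "d \<in> darts M - U" for d
  proof -
    have "darts M \<noteq> {}" using d by auto
    then have "label M' (h ` vertex_of M d) = label M (vertex_of M d)"
      using iso(3) mob_code_white[OF code(1)] d by auto
    moreover have "lab d = label M (vertex_of M d)" "lab' (h d) = label M' (vertex_of M' (h d))"
      using code d hU' unfolding mob_code_def by blast+
    ultimately show ?thesis using orb(1) d by simp
  qed
  have inv: "h (inv (rot M) x) = inv (rot M') (h x)" if "x \<in> darts M" for x
    using rot[of "inv (rot M) x"] that A.a.inv_rot(2) B.a.inv_rot(1) A.a.inv_rot_D by metis
  have r1: "h (rot M e) = rot M' (h e)"
    and r2: "h (opp M (inv (rot M) (opp M e))) = opp M' (inv (rot M') (opp M' (h e)))"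
    if "e \<in> darts M - U" for e
    using that rot op inv by simp_all
  have "h (R d) = R' (h d)" "- lab' (h d) = - lab d" if "d \<in> darts M" for d
    using split_map_unique[OF A.s.split_map_axioms B.s.split_map_axioms bij op hU' lab r1 r2 that] by blast+
  then show ?thesis using bij op hU by (simp add: code_iso_def)
qed

lemma code_mobile_iso:
  assumes M: "is_mobile M" "is_mobile M'"
    and code: "mob_code M U lab R" "mob_code M' U' lab' R'"
    and h: "code_iso h (darts M) U (opp M) R lab (darts M') U' (opp M') R' lab'"
  shows "map_iso_by h M M'" "(`) h ` black M = black M'"
      "\<forall>v\<in>white M. label M' (h ` v) = label M v"
proof -
  interpret A: mobile_map M "darts M" U "opp M" R lab
    using code unfolding mob_code_def by blast
  interpret B: mobile_map M' "darts M'" U' "opp M'" R' lab'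
    using code unfolding mob_code_def by blast
  have bij: "bij_betw h (darts M) (darts M')" using h by (simp add: code_iso_def)
  have hD: "h d \<in> darts M'" if "d \<in> darts M" for d using bij that by (auto dest: bij_betwE)
  have hd: "h (opp M d) = opp M' (h d)" "h (R d) = R' (h d)" "h d \<in> U' \<longleftrightarrow> d \<in> U" "lab' (h d) = lab d"
    if "d \<in> darts M" for d
    using h that by (auto simp: code_iso_def)
  note hh = code_iso_hits[OF h A.primal]
  have r: "h (rot M e) = rot M' (h e)"
      "h (opp M (inv (rot M) (opp M e))) = opp M' (inv (rot M') (opp M' (h e)))"
    if e: "e \<in> darts M - U" for e
  proof -
    have he: "h e \<in> darts M' - U'" using hd(3) hD e by simp
    show "h (rot M e) = rot M' (h e)"
      using hh(3)[OF _ A.s.R_hits[OF e]] e B.s.R_hits[OF he] hits_det by auto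
    show "h (opp M (inv (rot M) (opp M e))) = opp M' (inv (rot M') (opp M' (h e)))"
      using hh(4)[OF _ A.s.F_hits[OF e]] e B.s.F_hits[OF he] hits_det by auto
  qed
  have rot: "h (rot M d) = rot M' (h d)" if d: "d \<in> darts M" for d
  proof (cases "d \<in> U")
    case True
    \<comment> \<open>Chosen so that \<open>\<alpha>\<close> sends \<open>e\<close> to
      \<open>opp M d\<close>; this reads the rotation at a black vertex off the return map.\<close>
    define e where "e = opp M (rot M d)"
    have e: "e \<in> darts M - U" using True d by (simp add: e_def A.a.rot_U A.a.i_U)
    have "h (opp M d) = opp M' (inv (rot M') (opp M' (h e)))" using r(2)[OF e] by (simp add: e_def)
    moreover have "opp M' (h e) = h (rot M d)" using hd(1)[of e] e by (simp add: e_def)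
    ultimately have "opp M' (h d) = opp M' (inv (rot M') (h (rot M d)))" using hd(1)[OF d] by simp
    then have "h d = inv (rot M') (h (rot M d))" by (simp add: B.a.i_inj)
    then show ?thesis using B.a.inv_rot(2) by metis
  qed (use r d in simp)
  show iso: "map_iso_by h M M'" using bij rot hd by (simp add: map_iso_by_def)
  note orb = map_iso_orbit[OF iso A.a.dart_map_axioms B.a.dart_map_axioms]
  have hU: "h ` U = U'"
  proof (intro equalityI subsetI)
    fix x assume x: "x \<in> U'"
    then obtain d where "d \<in> darts M" "x = h d" using bij B.a.U_D by (metis bij_betw_imp_surj_on imageE subsetD)
    then show "x \<in> h ` U" using hd x by auto
  qed (use hd A.a.U_D in auto)
  have "(`) h ` black M = (\<lambda>e. h ` vertex_of M e) ` U"
    by (simp add: mob_code_black[OF M(1) code(1)] image_image)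
  also have "\<dots> = (\<lambda>e. vertex_of M' (h e)) ` U"
    using A.a.U_D orb(1) by (intro image_cong) auto
  also have "\<dots> = vertex_of M' ` U'"
    unfolding hU[symmetric] by (simp add: image_image)
  also have "\<dots> = black M'" by (simp add: mob_code_black[OF M(2) code(2)])
  finally show "(`) h ` black M = black M'" .
  show "\<forall>v\<in>white M. label M' (h ` v) = label M v"
  proof (cases "darts M = {}")
    case True
    then have "darts M' = {}" using bij by (auto simp: bij_betw_def)
    moreover have "\<exists>v\<in>white M. label M v = 1" "\<exists>v\<in>white M'. label M' v = 1"
      using M unfolding is_mobile_def by blast+
    ultimately show ?thesis using True by (auto simp: white_def verts_def)
  next
    case False
    show ?thesis
    proof
      fix v assume "v \<in> white M"
      then obtain d where d: "d \<in> darts M - U" "v = vertex_of M d"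
        using mob_code_white[OF code(1) False] by auto
      then have "h d \<in> darts M' - U'" using hd hD by simp
      then have "lab d = label M (vertex_of M d)" "lab' (h d) = label M' (vertex_of M' (h d))"
        using code d unfolding mob_code_def by blast+
      then show "label M' (h ` v) = label M v" using d orb(1) hd(4) by simp
    qed
  qed
qed

section \<open>Types of faces and vertices\<close>

text \<open>Like \<open>hits\<close>, the list starts with \<open>f x\<close>; over a full cycle its
  last entry is \<open>x\<close>.\<close>

primrec trace :: "('a \<Rightarrow> 'a) \<Rightarrow> nat \<Rightarrow> 'a \<Rightarrow> 'a list" where
  "trace f 0 x = []"
| "trace f (Suc n) x = f x # trace f n (f x)"

lemma trace_conv_map: "trace f n x = map (\<lambda>k. (f ^^ Suc k) x) [0..<n]"
proof (induction n arbitrary: x)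
  case (Suc n)
  have "[0..<Suc n] = 0 # map Suc [0..<n]" by (simp add: upt_conv_Cons map_Suc_upt del: upt_Suc)
  then show ?case using Suc by (simp add: funpow_swap1 comp_def del: upt_Suc)
qed simp

lemma length_trace [simp]: "length (trace f n x) = n"
  by (induction n arbitrary: x) auto

text \<open>List form of \<open>orbit_hits\<close>: it keeps the order of the visits to
  \<open>A\<close>, which the cyclic types depend on.\<close>

lemma filter_trace:
  assumes g: "\<And>a. a \<in> A \<Longrightarrow> hits f A a (g a)" and "hits f A x y"
  shows "filter (\<lambda>z. z \<in> A) (trace f n x) = [] \<or>
    (\<exists>m. filter (\<lambda>z. z \<in> A) (trace f n x) = y # trace g m y)"
  using assms(2)
proof (induction n arbitrary: x y)
  case (Suc n)
  show ?case
  proof (cases "f x \<in> A")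
    case True
    then have y: "y = f x" using Suc.prems by (subst (asm) hits_iff) auto
    from Suc.IH[OF g[OF True]] show ?thesis
    proof
      assume "filter (\<lambda>z. z \<in> A) (trace f n (f x)) = []"
      then show ?thesis using True y by (auto intro!: exI[of _ 0])
    next
      assume "\<exists>m. filter (\<lambda>z. z \<in> A) (trace f n (f x)) = g (f x) # trace g m (g (f x))"
      then obtain m where "filter (\<lambda>z. z \<in> A) (trace f n (f x)) = trace g (Suc m) (f x)" by auto
      then show ?thesis using True y by (auto intro!: exI[of _ "Suc m"])
    qed
  next
    case False
    then have "hits f A (f x) y" using Suc.prems by (subst (asm) hits_iff) auto
    then show ?thesis using Suc.IH False by simp
  qed
qed simp

lemma trace_orbit:
  assumes "f permutes D" "finite D"
  shows "set (trace f (card (orbit f x)) x) = orbit f x" "distinct (trace f (card (orbit f x)) x)"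
    "(f ^^ card (orbit f x)) x = x" "0 < card (orbit f x)"
proof -
  have self: "x \<in> orbit f x" by (rule permutes_self_in_orbit[OF assms])
  define n where "n = funpow_dist1 f x x"
  have orb: "orbit f x = (\<lambda>k. (f ^^ k) x) ` {0..<n}"
    unfolding n_def by (rule orbit_conv_funpow_dist1[OF self])
  have inj: "inj_on (\<lambda>k. (f ^^ k) x) {0..<n}" unfolding n_def by (rule inj_on_funpow_dist1[OF self])
  have card: "card (orbit f x) = n" unfolding orb by (simp add: card_image[OF inj])
  show "(f ^^ card (orbit f x)) x = x" unfolding card n_def by (rule funpow_dist1_prop[OF self])
  show "0 < card (orbit f x)" unfolding card n_def by simp
  have "set (trace f n x) = f ` orbit f x"
    unfolding trace_conv_map orb by (simp add: image_image)
  also have "f ` orbit f x = orbit f x"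
    using finite_orbit[OF self] permutes_inj_on[OF assms(1)]
    by (intro endo_inj_surj) (auto intro: orbit.step)
  finally show set: "set (trace f (card (orbit f x)) x) = orbit f x" unfolding card .
  then have "card (set (trace f (card (orbit f x)) x)) = length (trace f (card (orbit f x)) x)"
    by (simp only: length_trace)
  then show "distinct (trace f (card (orbit f x)) x)" by (rule card_distinct)
qed

text \<open>The levels left by the down-darts between an up-dart at level \<open>j\<close> and the
  next one at level \<open>k\<close>: the walk rises to \<open>j + 1\<close> and then leaves
  \<open>j + 1\<close>, ..., \<open>k + 1\<close> downwards. There are none if
  \<open>k = j + 1\<close>.\<close>

definition down :: "int \<Rightarrow> int \<Rightarrow> int list" where
  "down j k = rev (inserted k j)"

lemma down_empty: "j < k \<Longrightarrow> down j k = []"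
  by (simp add: down_def inserted_def)

lemma down_Cons: "k \<le> j \<Longrightarrow> down j k = (j + 1) # down (j - 1) k"
  using upto_rec2[of "k + 1" "j + 1"] by (auto simp: down_def inserted_def)

lemma concat_map_upt_Suc:
  "concat (map f [0..<Suc n]) = f 0 @ concat (map (\<lambda>k. f (Suc k)) [0..<n])"
proof -
  have "[0..<Suc n] = 0 # map Suc [0..<n]" by (simp add: upt_conv_Cons map_Suc_upt del: upt_Suc)
  then show ?thesis by (simp add: comp_def del: upt_Suc)
qed

section \<open>Labels along a face of the bipartite map\<close>

context split_map
begin

text \<open>The start \<open>d\<close> is arbitrary so that the induction can pass through
  down-darts; the first block descends from \<open>lab (i d)\<close>. As the walk ends at an
  up-dart, the up-darts visited enclose one block fewer than their number.\<close>

lemma labels_trace: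
  assumes "d \<in> D" "hits F U d y" "(F ^^ n) d \<in> U" "0 < n"
  shows "map lab (filter (\<lambda>x. x \<notin> U) (trace F n d)) = down (lab (i d) - 1) (lab y) @
    concat (map (\<lambda>k. down (lab ((\<alpha> ^^ k) y)) (lab ((\<alpha> ^^ Suc k) y)))
      [0..<length (filter (\<lambda>x. x \<in> U) (trace F n d)) - 1])"
  using assms
proof (induction n arbitrary: d y)
  case (Suc n)
  have FD: "F d \<in> D" using Suc.prems by simp
  have labF: "lab (F d) = lab (i d)" using Suc.prems by (simp add: lab_R)
  have nU: "(F ^^ n) (F d) \<in> U" using Suc.prems(3) unfolding funpow_Suc_right comp_apply .
  show ?case
  proof (cases "F d \<in> U")
    case True
    then have y: "y = F d" using Suc.prems by (subst (asm) hits_iff) auto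
    have e: "down (lab (i d) - 1) (lab y) = []" using labF y by (intro down_empty) simp
    show ?thesis
    proof (cases "n = 0")
      case False
      define m where "m = length (filter (\<lambda>x. x \<in> U) (trace F n y))"
      have "(F ^^ n) y \<in> set (filter (\<lambda>x. x \<in> U) (trace F n y))"
      proof -
        obtain k where "n = Suc k" using False by (cases n) auto
        then have "(F ^^ n) y \<in> set (trace F n y)" unfolding trace_conv_map by force
        moreover have "(F ^^ n) y \<in> U" using nU y by simp
        ultimately show ?thesis by simp
      qed
      then obtain m' where m': "m = Suc m'" unfolding m_def by (cases "filter (\<lambda>x. x \<in> U) (trace F n y)") auto
      have "map lab (filter (\<lambda>x. x \<notin> U) (trace F n y)) = down (lab (i y) - 1) (lab (\<alpha> y)) @
          concat (map (\<lambda>k. down (lab ((\<alpha> ^^ k) (\<alpha> y))) (lab ((\<alpha> ^^ Suc k) (\<alpha> y)))) [0..<m - 1])"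
        unfolding m_def
        using nU False FD True y F_hits by (intro Suc.IH) auto
      also have "\<dots> = concat (map (\<lambda>k. down (lab ((\<alpha> ^^ k) y)) (lab ((\<alpha> ^^ Suc k) y))) [0..<m])"
        unfolding m' concat_map_upt_Suc using True y lab_i[of y] by (simp add: funpow_swap1)
      finally show ?thesis using True y e m_def by simp
    qed (use True e in simp)
  next
    case False
    then have h: "hits F U (F d) y" using Suc.prems by (subst (asm) hits_iff) auto
    have n: "0 < n" using Suc.prems False by (cases n) auto
    have labiF: "lab (i (F d)) = lab (i d) - 1" using lab_i'[OF FD False] labF by simp
    have "lab y \<le> lab (i d) - 1" using hits_F_lab[OF h FD] labiF by simp
    then have "down (lab (i d) - 1) (lab y) = lab (F d) # down (lab (i (F d)) - 1) (lab y)"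
      using down_Cons[of "lab y" "lab (i d) - 1"] labF labiF by simp
    moreover have "map lab (filter (\<lambda>x. x \<notin> U) (trace F n (F d))) = down (lab (i (F d)) - 1) (lab y) @
      concat (map (\<lambda>k. down (lab ((\<alpha> ^^ k) y)) (lab ((\<alpha> ^^ Suc k) y)))
        [0..<length (filter (\<lambda>x. x \<in> U) (trace F n (F d))) - 1])"
      by (intro Suc.IH FD h n nU)
    ultimately show ?thesis using False by simp
  qed
qed simp

lemma labels_cycle:
  assumes "z \<in> U"
  shows "map lab (filter (\<lambda>x. x \<notin> U) (trace F (card (orbit F z)) z)) =
    concat (map (\<lambda>k. down (lab ((\<alpha> ^^ k) z)) (lab ((\<alpha> ^^ Suc k) z))) [0..<card (orbit \<alpha> z)])"
proof -
  note tr = trace_orbit[OF F_perm finite_D, of z]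
  define n where "n = card (orbit F z)"
  have "length (filter (\<lambda>x. x \<in> U) (trace F n z)) = card (set (filter (\<lambda>x. x \<in> U) (trace F n z)))"
    using tr(2) by (intro distinct_card[symmetric]) (simp add: n_def)
  also have "set (filter (\<lambda>x. x \<in> U) (trace F n z)) = orbit \<alpha> z"
    using tr(1) \<alpha>_orbit[OF assms] by (auto simp: n_def)
  finally have len: "length (filter (\<lambda>x. x \<in> U) (trace F n z)) = card (orbit \<alpha> z)" .
  have fin: "finite (orbit \<alpha> z)"
    using \<alpha>_orbit[OF assms] finite_U by simp
  then have "card (orbit \<alpha> z) \<noteq> 0" using orbit_nonempty[of \<alpha> z] by simp
  then obtain m where m: "card (orbit \<alpha> z) = Suc m" by (cases "card (orbit \<alpha> z)") auto
  have "map lab (filter (\<lambda>x. x \<notin> U) (trace F n z)) = down (lab (i z) - 1) (lab (\<alpha> z)) @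
    concat (map (\<lambda>k. down (lab ((\<alpha> ^^ k) (\<alpha> z))) (lab ((\<alpha> ^^ Suc k) (\<alpha> z))))
      [0..<length (filter (\<lambda>x. x \<in> U) (trace F n z)) - 1])"
    by (rule labels_trace) (use tr assms U_D F_hits in \<open>auto simp: n_def\<close>)
  then show ?thesis
    unfolding len m concat_map_upt_Suc using lab_i[OF assms]
    by (simp add: funpow_swap1 n_def)
qed

end

text \<open>\<open>g\<close> follows \<open>\<alpha>\<close>, clockwise around a dark face, so the
  counterclockwise type reads it backwards. The reversal in the upper complement restores the
  direction and turns each block of inserted elements into a descent.\<close>

lemma upper_complement_cycle:
  assumes n: "0 < n" and g: "g n = g 0"
  shows "upper_complement (map (\<lambda>k. g (n - k)) [0..<n]) = concat (map (\<lambda>k. down (g k) (g (Suc k))) [0..<n])"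
proof -
  define \<tau> where "\<tau> = map (\<lambda>k. g (n - k)) [0..<n]"
  have block: "map fst (filter snd ((j, False) # map (\<lambda>k. (k, True)) xs)) = xs" for j :: int and xs
    by (induction xs) auto
  have "map2 f \<tau> (rotate1 \<tau>) = map (\<lambda>m. f (g (n - m)) (g (n - Suc m))) [0..<n]"
    for f :: "int \<Rightarrow> int \<Rightarrow> (int \<times> bool) list"
  proof (rule nth_equalityI)
    fix m assume "m < length (map2 f \<tau> (rotate1 \<tau>))"
    then have m: "m < n" by (simp add: \<tau>_def)
    have "rotate1 \<tau> ! m = g (n - Suc m)"
    proof (cases "Suc m < n")
      case True then show ?thesis using m by (simp add: nth_rotate1 \<tau>_def)
    next
      case False
      then have "Suc m = n" using m by simp
      then show ?thesis using m g n by (simp add: nth_rotate1 \<tau>_def)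
    qed
    then show "map2 f \<tau> (rotate1 \<tau>) ! m = map (\<lambda>m. f (g (n - m)) (g (n - Suc m))) [0..<n] ! m"
      using m by (simp add: \<tau>_def)
  qed (simp add: \<tau>_def)
  then have "upper_completion \<tau> = concat (map (\<lambda>m. (g (n - m), False) #
      map (\<lambda>k. (k, True)) (inserted (g (n - m)) (g (n - Suc m)))) [0..<n])"
    by (simp add: upper_completion_def)
  then have "map fst (filter snd (upper_completion \<tau>)) =
      concat (map (\<lambda>m. inserted (g (n - m)) (g (n - Suc m))) [0..<n])"
    by (simp add: filter_concat map_concat comp_def block del: filter.simps)
  then have "upper_complement \<tau> = concat (rev (map (\<lambda>m. down (g (n - Suc m)) (g (n - m))) [0..<n]))"
    by (simp add: upper_complement_def rev_concat rev_map comp_def down_def)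
  also have "rev (map (\<lambda>m. down (g (n - Suc m)) (g (n - m))) [0..<n]) =
      map (\<lambda>k. down (g k) (g (Suc k))) [0..<n]"
    by (rule nth_equalityI) (auto simp: rev_nth Suc_diff_Suc)
  finally show ?thesis by (simp add: \<tau>_def)
qed

text \<open>The middle term between both types: the upper complement of the type of a dark face, and
  the clockwise type of the black vertex, from a common starting position.\<close>

definition cycle_labels where
  "cycle_labels U R i lab z = map lab (filter (\<lambda>x. x \<notin> U)
     (trace (\<lambda>d. R (i d)) (card (orbit (\<lambda>d. R (i d)) z)) z))"

text \<open>The vertices incident to a light face are the initial vertices of its edges, and its tip
  is the upper end of a highest edge, hence one level above their maximum.\<close>

lemma hyp_code_light:
  assumes H: "pointed_hypermap H" "darts H \<noteq> {}" and code: "hyp_code H U lab R"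
  shows "\<exists>\<beta>. bij_betw \<beta> (light H) {T \<in> orbit R ` darts H. T \<inter> U = {}} \<and>
    (\<forall>f\<in>light H. \<forall>x\<in>\<beta> f. lab x = max_label H f + 1)"
proof -
  interpret hyper_map H "darts H" U "opp H" R lab
    using code unfolding hyp_code_def by blast
  have lab: "geodesic_label H (vertex_of H d) = lab d" if "d \<in> U" for d
    using code that by (auto simp: hyp_code_def)
  have faces: "faces H = face_of H ` U \<union> face_of H ` (opp H ` U)"
    using H(2) a.dart_cases by (metis faces_def image_Un)
  have "face_of H e \<notin> dark H" if "e \<in> U" for e
  proof
    assume "face_of H e \<in> dark H"
    then obtain d where "d \<in> U" "face_of H e = face_of H (opp H d)"
      using hyp_code_dark[OF H(1) code] by auto
    then show False
      using that a.face_\<phi>_sub(1)[of e] a.face_\<phi>_sub(1)[of "opp H d"] s.U_D a.i_U by auto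
  qed
  then have light: "light H = orbit (face_next H) ` U"
    unfolding light_def faces using hyp_code_dark[OF H(1) code] by (auto simp: face_of_def)
  define \<beta> where "\<beta> = (\<lambda>f. opp H ` {x \<in> f. lab x = Max (lab ` f)})"
  have "lab x = max_label H f + 1" if f: "f \<in> light H" and x: "x \<in> \<beta> f" for f x
  proof -
    obtain e where e: "e \<in> U" "f = face_of H e" using f light by (auto simp: face_of_def)
    have fU: "f \<subseteq> U" using e a.face_\<phi>_sub(1) s.U_D by simp
    have "{v. incident H v f} = vertex_of H ` f"
    proof (intro equalityI subsetI)
      fix v assume "v \<in> {v. incident H v f}"
      then obtain d y where "v = vertex_of H d" "y \<in> v" "y \<in> f"
        using H(2) by (auto simp: incident_def verts_def)
      then show "v \<in> vertex_of H ` f" using a.vertex_eq[of d y] by auto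
    next
      fix v assume "v \<in> vertex_of H ` f"
      then obtain y where y: "y \<in> f" "v = vertex_of H y" by auto
      then have "y \<in> v \<inter> f" using a.vertex_self by simp
      moreover have "v \<in> verts H" using y fU s.U_D by (auto simp: verts_def)
      moreover have "f \<in> faces H" using e s.U_D by (auto simp: faces_def)
      ultimately show "v \<in> {v. incident H v f}" by (auto simp: incident_def)
    qed
    moreover have "geodesic_label H ` vertex_of H ` f = lab ` f"
      unfolding image_image using fU lab by (intro image_cong) auto
    ultimately have "max_label H f = Max (lab ` f)" by (simp only: max_label_def)
    moreover have "lab x = Max (lab ` f) + 1"
      by (rule s.noose.lab_light) (use f x light in \<open>simp_all only: \<beta>_def\<close>)
    ultimately show ?thesis by simp
  qed
  moreover have "bij_betw \<beta> (light H) {T \<in> orbit R ` darts H. T \<inter> U = {}}"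
    unfolding \<beta>_def light by (rule s.light_bij)
  ultimately show ?thesis by blast
qed

text \<open>The vertices of \<open>B\<close> left over by the hypermap are the local maxima, which
  are tips of light faces; the pointed vertex is the local minimum. The rest is mixed.\<close>

lemma hyp_code_vertices:
  assumes H: "pointed_hypermap H" "darts H \<noteq> {}" and code: "hyp_code H U lab R"
  shows "\<exists>\<gamma>. bij_betw \<gamma> (verts H - {point H}) {T \<in> orbit R ` darts H. T \<inter> U \<noteq> {} \<and> \<not> T \<subseteq> U} \<and>
    (\<forall>v\<in>verts H - {point H}. \<forall>x\<in>\<gamma> v. lab x = geodesic_label H v)"
proof -
  interpret hyper_map H "darts H" U "opp H" R lab
    using code unfolding hyp_code_def by blast
  have lab: "geodesic_label H (vertex_of H d) = lab d" if "d \<in> U" for d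
    using code that by (auto simp: hyp_code_def)
  define S where "S = {d \<in> U. \<not> orbit R d \<subseteq> U}"
  have pt: "vertex_of H d = point H \<longleftrightarrow> orbit R d \<subseteq> U" if "d \<in> U" for d
    using hyp_balanced(2)[OF H(1) code that] .
  have v: "verts H - {point H} = vertex_of H ` S"
    unfolding hyp_code_U_verts[OF code H(2)]
  proof (intro equalityI subsetI)
    fix v assume "v \<in> vertex_of H ` U - {point H}"
    then obtain d where d: "d \<in> U" "v = vertex_of H d" "v \<noteq> point H" by blast
    then have "d \<in> S" using pt[OF d(1)] by (simp add: S_def)
    then show "v \<in> vertex_of H ` S" using d by blast
  next
    fix v assume "v \<in> vertex_of H ` S"
    then obtain d where d: "d \<in> S" "v = vertex_of H d" by blast
    then have "d \<in> U" "v \<noteq> point H" using pt[of d] by (simp_all add: S_def)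
    then show "v \<in> vertex_of H ` U - {point H}" using d by blast
  qed
  have m: "{T \<in> orbit R ` darts H. T \<inter> U \<noteq> {} \<and> \<not> T \<subseteq> U} = orbit R ` S"
  proof (intro equalityI subsetI)
    fix T assume "T \<in> {T \<in> orbit R ` darts H. T \<inter> U \<noteq> {} \<and> \<not> T \<subseteq> U}"
    then obtain d x where "T = orbit R d" "x \<in> orbit R d" "x \<in> U" "\<not> orbit R d \<subseteq> U" by auto
    then show "T \<in> orbit R ` S" using s.R_orbit_eq[of d x] by (auto simp: S_def)
  qed (use s.U_D s.R_orbit_self in \<open>auto simp: S_def\<close>)
  have "\<exists>\<gamma>. bij_betw \<gamma> (vertex_of H ` S) (orbit R ` S) \<and> (\<forall>x\<in>S. \<gamma> (vertex_of H x) = orbit R x)"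
    by (rule bij_betw_images) (auto simp: S_def vertex_eq_R)
  then obtain \<gamma> where \<gamma>: "bij_betw \<gamma> (vertex_of H ` S) (orbit R ` S)"
    "\<And>x. x \<in> S \<Longrightarrow> \<gamma> (vertex_of H x) = orbit R x" by blast
  have "lab x = geodesic_label H v" if v: "v \<in> vertex_of H ` S" and x: "x \<in> \<gamma> v" for v x
  proof -
    obtain d where d: "d \<in> S" "v = vertex_of H d" using v by auto
    then show ?thesis using \<gamma>(2) x s.lab_orbit[of x d] s.U_D lab by (auto simp: S_def)
  qed
  then show ?thesis using \<gamma>(1) unfolding v m by blast
qed

lemma hyp_code_faces:
  assumes H: "pointed_hypermap H" and code: "hyp_code H U lab R"
  shows "\<exists>\<delta>. bij_betw \<delta> (dark H) (orbit (\<lambda>d. R (opp H d)) ` darts H) \<and>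
    (\<forall>f\<in>dark H. card f = card (\<delta> f \<inter> U) \<and>
      (\<forall>\<tau>\<in>ccw_type H f. \<exists>z\<in>\<delta> f \<inter> U. upper_complement \<tau> = cycle_labels U R (opp H) lab z))"
proof -
  interpret hyper_map H "darts H" U "opp H" R lab
    using code unfolding hyp_code_def by blast
  have lab: "geodesic_label H (vertex_of H d) = lab d" if "d \<in> U" for d
    using code that by (auto simp: hyp_code_def)
  let ?F = "\<lambda>d. R (opp H d)" and ?\<alpha> = "\<lambda>d. rot H (opp H d)"
  have dark: "dark H = (\<lambda>e. face_of H (opp H e)) ` U"
    using hyp_code_dark[OF H code] by (simp add: image_image)
  have "\<exists>\<delta>. bij_betw \<delta> ((\<lambda>e. face_of H (opp H e)) ` U) (orbit ?F ` U) \<and>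
      (\<forall>e\<in>U. \<delta> (face_of H (opp H e)) = orbit ?F e)"
  proof (rule bij_betw_images)
    fix x y assume xy: "x \<in> U" "y \<in> U"
    have "face_of H (opp H x) = face_of H (opp H y) \<longleftrightarrow> orbit ?\<alpha> x = orbit ?\<alpha> y"
      using a.face_\<alpha>[OF xy(1)] a.face_\<alpha>[OF xy(2)] permutes_inj[OF a.i_perm]
      by (simp add: inj_image_eq_iff)
    then show "face_of H (opp H x) = face_of H (opp H y) \<longleftrightarrow> orbit ?F x = orbit ?F y"
      using s.\<alpha>_orbit_eq[OF xy] by simp
  qed
  then obtain \<delta> where \<delta>: "bij_betw \<delta> ((\<lambda>e. face_of H (opp H e)) ` U) (orbit ?F ` U)"
    "\<And>e. e \<in> U \<Longrightarrow> \<delta> (face_of H (opp H e)) = orbit ?F e" by blast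
  have "card f = card (\<delta> f \<inter> U) \<and>
      (\<forall>\<tau>\<in>ccw_type H f. \<exists>z\<in>\<delta> f \<inter> U. upper_complement \<tau> = cycle_labels U R (opp H) lab z)"
    if f: "f \<in> dark H" for f
  proof -
    obtain e where e: "e \<in> U" "f = face_of H (opp H e)" using f dark by auto
    have f\<alpha>: "f = opp H ` orbit ?\<alpha> e" using e a.face_\<alpha> by simp
    have card: "card f = card (orbit ?\<alpha> e)"
      unfolding f\<alpha> using permutes_inj_on[OF a.i_perm] by (rule card_image)
    have \<delta>f: "\<delta> f \<inter> U = orbit ?\<alpha> e" using \<delta>(2) e s.\<alpha>_orbit by simp
    have "\<exists>z\<in>\<delta> f \<inter> U. upper_complement \<tau> = cycle_labels U R (opp H) lab z"
      if \<tau>: "\<tau> \<in> ccw_type H f" for \<tau>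
    proof -
      define n where "n = card f"
      obtain d where d: "d \<in> f" "\<tau> = map (\<lambda>k. geodesic_label H (vertex_of H ((face_next H ^^ k) d))) [0..<n]"
        using \<tau> by (auto simp: ccw_type_def n_def)
      have f_eq: "f = face_of H d" using d(1) e(2) a.face_eq by metis
      have dD: "d \<in> darts H" using d(1) e a.face_sub[of "opp H e"] s.U_D by auto
      have dU: "d \<notin> U" using d(1) e(2) a.face_\<phi>_sub(2)[of "opp H e"] e(1) s.U_D a.i_U by auto
      have fn: "(face_next H ^^ k) d \<in> darts H - U" for k
        by (induction k) (use dD dU a.face_next_U permutes_in_image[OF a.face_next_perm] in auto)
      note tr = trace_orbit[OF a.face_next_perm a.finD, of d]
      have per: "(face_next H ^^ n) d = d" and n0: "0 < n"
        using tr(3,4) f_eq by (simp_all add: n_def face_of_def)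
      \<comment> \<open>The up-dart at the same vertex as \<open>d\<close>. From here
        \<open>\<alpha>\<close> runs clockwise and \<open>face_next\<close> counterclockwise, whence
        the index \<open>n - m\<close> below.\<close>
      define z where "z = rot H d"
      have step: "?\<alpha> (rot H (face_next H x)) = rot H x" if "x \<in> darts H" for x
        using that by (simp add: face_next_def a.i_i)
      have iter: "(?\<alpha> ^^ m) z = rot H ((face_next H ^^ (n - m)) d)" if "m \<le> n" for m
        using that
      proof (induction m)
        case (Suc m)
        have "n - m = Suc (n - Suc m)" using Suc.prems by simp
        then have "(?\<alpha> ^^ m) z = rot H (face_next H ((face_next H ^^ (n - Suc m)) d))"
          using Suc by simp
        then show ?case using step fn[of "n - Suc m"] by simp
      qed (simp add: z_def per)
      have labk: "geodesic_label H (vertex_of H ((face_next H ^^ k) d)) = lab ((?\<alpha> ^^ (n - k)) z)"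
        if "k < n" for k
      proof -
        have "(?\<alpha> ^^ (n - k)) z = rot H ((face_next H ^^ k) d)" using iter[of "n - k"] that by simp
        moreover have "rot H ((face_next H ^^ k) d) \<in> U" using fn[of k] a.rot_U by auto
        ultimately show ?thesis using lab a.vertex_rot by metis
      qed
      have zU: "z \<in> U" using dD dU by (simp add: z_def a.rot_U)
      obtain x where x: "x \<in> orbit ?\<alpha> e" "d = opp H x" using d(1) f\<alpha> by auto
      then have "x \<in> U" using \<delta>f by auto
      then have ide: "opp H d \<in> orbit ?\<alpha> e" using x a.i_i s.U_D by simp
      have "z = ?\<alpha> (opp H d)" using dD by (simp add: z_def a.i_i)
      then have z\<delta>: "z \<in> orbit ?\<alpha> e" using ide by (metis orbit.step)
      have "orbit ?\<alpha> z = orbit ?\<alpha> e"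
      proof -
        have "orbit ?F e = orbit ?F z"
          using z\<delta> s.\<alpha>_orbit[OF e(1)] s.F_orbit_eq[of e z] by auto
        then show ?thesis using s.\<alpha>_orbit_eq[OF e(1) zU] by simp
      qed
      then have cz: "card (orbit ?\<alpha> z) = n" using card by (simp add: n_def)
      have "\<tau> = map (\<lambda>k. lab ((?\<alpha> ^^ (n - k)) z)) [0..<n]"
        unfolding d(2) by (rule map_cong) (use labk in auto)
      then have "upper_complement \<tau> =
          concat (map (\<lambda>k. down (lab ((?\<alpha> ^^ k) z)) (lab ((?\<alpha> ^^ Suc k) z))) [0..<n])"
        using upper_complement_cycle[OF n0, of "\<lambda>k. lab ((?\<alpha> ^^ k) z)"] iter[of n] by (simp add: z_def)
      also have "\<dots> = cycle_labels U R (opp H) lab z"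
        using s.labels_cycle[OF zU] by (simp add: cycle_labels_def cz)
      finally show ?thesis using z\<delta> \<delta>f by auto
    qed
    then show ?thesis using card \<delta>f by simp
  qed
  moreover have "bij_betw \<delta> (dark H) (orbit ?F ` darts H)"
    using \<delta>(1) unfolding dark s.F_orbits_U .
  ultimately show ?thesis by blast
qed

section \<open>White and black vertices in the bipartite map\<close>

context mobile_map
begin

lemma vertex_eq_R: "x \<in> D - U \<Longrightarrow> y \<in> D - U \<Longrightarrow> vertex_of G x = vertex_of G y \<longleftrightarrow> orbit R x = orbit R y"
  using vertex_R[of x] a.vertex_eq[of x y] s.R_orbit_eq[of x y] by auto

text \<open>A drop from \<open>x\<close> to \<open>\<alpha> x\<close> means
  \<open>R (i x) = \<alpha> x\<close>, by \<open>up_step\<close> for the negated labels. So a higher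
  right neighbour shows up as an up-dart of \<open>B\<close> at the vertex of
  \<open>y\<close>.\<close>

lemma descent_iff:
  assumes y: "y \<in> D - U"
  shows "(\<exists>x\<in>D - U. vertex_of G (i (inv (rot G) (i x))) = vertex_of G y \<and>
      lab (i (inv (rot G) (i x))) < lab x) \<longleftrightarrow> orbit R y \<inter> U \<noteq> {}"
proof
  let ?\<alpha> = "\<lambda>x. i (inv (rot G) (i x))"
  assume "\<exists>x\<in>D - U. vertex_of G (?\<alpha> x) = vertex_of G y \<and> lab (?\<alpha> x) < lab x"
  then obtain x where x: "x \<in> D - U" "vertex_of G (?\<alpha> x) = vertex_of G y" "lab (?\<alpha> x) < lab x" by blast
  have "- lab (?\<alpha> x) = - lab x + 1" using x(3) s.lab_\<alpha>[OF x(1)] by simp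
  then have "R (i x) = ?\<alpha> x" using s.up_step[OF x(1)] by simp
  moreover have "?\<alpha> x \<in> orbit R y"
    using x(2) vertex_eq_R[OF y s.\<alpha>_U[OF x(1)]] s.R_orbit_eq[of y "?\<alpha> x"] by simp
  ultimately have "i x \<in> orbit R y"
    using cyclic_on_f_in[OF s.R_perm cyclic_on_orbit[OF s.R_perm s.finite_D]] by metis
  moreover have "i x \<in> U" using x(1) by (simp add: a.i_U)
  ultimately show "orbit R y \<inter> U \<noteq> {}" by auto
next
  let ?\<alpha> = "\<lambda>x. i (inv (rot G) (i x))"
  assume "orbit R y \<inter> U \<noteq> {}"
  then obtain e where e: "e \<in> orbit R y" "e \<in> U" by auto
  have ye: "y \<in> orbit R e" using e(1) s.R_orbit_eq[of y e] s.R_orbit_self[of y] by auto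
  then obtain y' where y': "hits R (D - U) e y'" using hits_ex y by metis
  obtain z where z: "z \<notin> D - U" "R z = y'" "z = e \<or> z \<in> orbit R e"
    using hits_last[OF y'] e(2) by auto
  have zy: "z \<in> orbit R y" using z(3) e(1) orbit_trans by metis
  then have zD: "z \<in> D" using permutes_orbit_subset[OF s.R_perm] y by auto
  then have zU: "z \<in> U" using z(1) by simp
  define x where "x = i z"
  have x: "x \<in> D - U" using zD zU by (simp add: x_def a.i_U)
  have y'W: "y' \<in> D - U" using hits_in[OF y'] .
  have "?\<alpha> x = y'"
    using s.F_hits[OF x] y'W z(2) by (subst (asm) hits_iff) (auto simp: x_def)
  moreover have "y' \<in> orbit R y" using z(2) zy by (auto intro: orbit.step)
  then have "vertex_of G y' = vertex_of G y"
    using vertex_eq_R[OF y y'W] s.R_orbit_eq[of y y'] by simp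
  moreover have "lab y' < lab x"
    using level_map.lab_i[OF primal zU] level_map.lab_R[OF primal zD] z(2) by (simp add: x_def)
  ultimately show "\<exists>x\<in>D - U. vertex_of G (?\<alpha> x) = vertex_of G y \<and> lab (?\<alpha> x) < lab x"
    using x by blast
qed

end

lemma right_local_max_iff:
  assumes M: "is_mobile M" and code: "mob_code M U lab R" and y: "y \<in> darts M - U"
  shows "right_local_max M (vertex_of M y) \<longleftrightarrow> orbit R y \<inter> U = {}"
proof -
  interpret mobile_map M "darts M" U "opp M" R lab
    using code unfolding mob_code_def by blast
  let ?\<alpha> = "\<lambda>x. opp M (inv (rot M) (opp M x))"
  have lab: "label M (vertex_of M d) = lab d" if "d \<in> darts M - U" for d
    using code that by (auto simp: mob_code_def)
  \<comment> \<open>The pair is parametrised by a dart \<open>x\<close> leaving the right neighbour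
    \<open>v\<close>; then \<open>?\<alpha> x\<close> leaves \<open>u\<close>.\<close>
  have nb: "right_neighbour M u v \<longleftrightarrow> (\<exists>x\<in>darts M - U. u = vertex_of M (?\<alpha> x) \<and> v = vertex_of M x)" for u v
  proof
    assume "right_neighbour M u v"
    then obtain b d where bd: "b \<in> black M" "d \<in> b" "u = vertex_of M (opp M d)"
      "v = vertex_of M (opp M (rot M d))"
      by (auto simp: right_neighbour_def)
    then have d: "d \<in> U" using mob_code_black[OF M code] a.vertex_sub_U(1) by auto
    then have "opp M (rot M d) \<in> darts M - U" using a.U_D by (auto simp: a.i_U a.rot_U)
    then show "\<exists>x\<in>darts M - U. u = vertex_of M (?\<alpha> x) \<and> v = vertex_of M x"
      using bd by (intro bexI[of _ "opp M (rot M d)"]) simp_all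
  next
    assume "\<exists>x\<in>darts M - U. u = vertex_of M (?\<alpha> x) \<and> v = vertex_of M x"
    then obtain x where x: "x \<in> darts M - U" "u = vertex_of M (?\<alpha> x)" "v = vertex_of M x" by auto
    define d where "d = inv (rot M) (opp M x)"
    have "d \<in> U" using x by (simp add: d_def a.inv_rot_U a.i_U)
    then have "vertex_of M d \<in> black M" using mob_code_black[OF M code] by simp
    moreover have "u = vertex_of M (opp M d)" "v = vertex_of M (opp M (rot M d))"
      using x by (simp_all add: d_def)
    ultimately show "right_neighbour M u v" unfolding right_neighbour_def using a.vertex_self by blast
  qed
  have "darts M \<noteq> {}" using y by auto
  then have white: "vertex_of M y \<in> white M" using mob_code_white[OF code] y by simp
  have "right_local_max M (vertex_of M y) \<longleftrightarrow> (\<forall>x\<in>darts M - U.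
      vertex_of M y = vertex_of M (?\<alpha> x) \<longrightarrow> label M (vertex_of M x) \<le> label M (vertex_of M y))"
    unfolding right_local_max_def nb using white by blast
  also have "\<dots> \<longleftrightarrow> \<not> (\<exists>x\<in>darts M - U.
      vertex_of M (?\<alpha> x) = vertex_of M y \<and> label M (vertex_of M y) < label M (vertex_of M x))"
    by (metis not_le)
  also have "\<dots> \<longleftrightarrow> \<not> (\<exists>x\<in>darts M - U. vertex_of M (?\<alpha> x) = vertex_of M y \<and> lab (?\<alpha> x) < lab x)"
    using lab s.\<alpha>_U by (metis (no_types, lifting))
  finally show ?thesis using descent_iff[OF y] by simp
qed

text \<open>At a right local maximum no darts are lost between the mobile and \<open>B\<close>: the
  white vertex is a whole cycle of \<open>R\<close>, so the sets coincide and no intermediate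
  bijection appears.\<close>

lemma mob_code_maxima:
  assumes M: "is_mobile M" "darts M \<noteq> {}" and code: "mob_code M U lab R"
  shows "{u. right_local_max M u} = {T \<in> orbit R ` darts M. T \<inter> U = {}}"
    "right_local_max M u \<Longrightarrow> x \<in> u \<Longrightarrow> label M u = lab x"
proof -
  interpret mobile_map M "darts M" U "opp M" R lab
    using code unfolding mob_code_def by blast
  note iff = right_local_max_iff[OF M(1) code]
  have ve: "vertex_of M y = orbit R y" if "y \<in> darts M - U" "orbit R y \<inter> U = {}" for y
    using vertex_R[OF that(1)] that permutes_orbit_subset[OF s.R_perm, of y] by auto
  have RLM: "\<exists>y\<in>darts M - U. u = vertex_of M y \<and> orbit R y \<inter> U = {}" if "right_local_max M u" for u
  proof -
    have "u \<in> white M" using that by (simp add: right_local_max_def)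
    then show ?thesis using that iff mob_code_white[OF code M(2)] by auto
  qed
  show "{u. right_local_max M u} = {T \<in> orbit R ` darts M. T \<inter> U = {}}"
  proof (intro equalityI subsetI)
    fix T assume "T \<in> {T \<in> orbit R ` darts M. T \<inter> U = {}}"
    then obtain d where d: "d \<in> darts M" "T = orbit R d" "orbit R d \<inter> U = {}" by auto
    then have "d \<in> darts M - U" using s.R_orbit_self[of d] by auto
    then show "T \<in> {u. right_local_max M u}" using iff[of d] ve[of d] d by simp
  next
    fix u assume "u \<in> {u. right_local_max M u}"
    then obtain y where "y \<in> darts M - U" "u = vertex_of M y" "orbit R y \<inter> U = {}" using RLM by auto
    then show "u \<in> {T \<in> orbit R ` darts M. T \<inter> U = {}}" using ve by auto
  qed
  show "label M u = lab x" if u: "right_local_max M u" "x \<in> u"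
  proof -
    obtain y where y: "y \<in> darts M - U" "u = vertex_of M y" "orbit R y \<inter> U = {}"
      using RLM[OF u(1)] by blast
    then have "lab x = lab y" using ve s.lab_orbit[of x y] u(2) by auto
    then show ?thesis using code y by (auto simp: mob_code_def)
  qed
qed

lemma mob_code_vertices:
  assumes M: "is_mobile M" "darts M \<noteq> {}" and code: "mob_code M U lab R"
  shows "\<exists>\<gamma>. bij_betw \<gamma> {T \<in> orbit R ` darts M. T \<inter> U \<noteq> {} \<and> \<not> T \<subseteq> U}
      {u \<in> white M. \<not> right_local_max M u} \<and>
    (\<forall>T\<in>{T \<in> orbit R ` darts M. T \<inter> U \<noteq> {} \<and> \<not> T \<subseteq> U}. \<forall>x\<in>T. label M (\<gamma> T) = lab x)"
proof -
  interpret mobile_map M "darts M" U "opp M" R lab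
    using code unfolding mob_code_def by blast
  note iff = right_local_max_iff[OF M(1) code]
  define S where "S = {x \<in> darts M - U. orbit R x \<inter> U \<noteq> {}}"
  have m: "{T \<in> orbit R ` darts M. T \<inter> U \<noteq> {} \<and> \<not> T \<subseteq> U} = orbit R ` S"
  proof (intro equalityI subsetI)
    fix T assume "T \<in> {T \<in> orbit R ` darts M. T \<inter> U \<noteq> {} \<and> \<not> T \<subseteq> U}"
    then obtain d x where *: "T = orbit R d" "d \<in> darts M" "x \<in> orbit R d" "x \<notin> U" "orbit R d \<inter> U \<noteq> {}"
      by auto
    then have "x \<in> S" "T = orbit R x"
      using s.R_orbit_eq[of d x] permutes_orbit_subset[OF s.R_perm *(2)] by (auto simp: S_def)
    then show "T \<in> orbit R ` S" by blast
  next
    fix T assume "T \<in> orbit R ` S"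
    then show "T \<in> {T \<in> orbit R ` darts M. T \<inter> U \<noteq> {} \<and> \<not> T \<subseteq> U}"
      using s.R_orbit_self by (auto simp: S_def)
  qed
  have w: "{u \<in> white M. \<not> right_local_max M u} = vertex_of M ` S"
    using iff mob_code_white[OF code M(2)] by (auto simp: S_def)
  have "\<exists>\<gamma>. bij_betw \<gamma> (orbit R ` S) (vertex_of M ` S) \<and> (\<forall>x\<in>S. \<gamma> (orbit R x) = vertex_of M x)"
    by (rule bij_betw_images) (auto simp: S_def vertex_eq_R)
  then obtain \<gamma> where \<gamma>: "bij_betw \<gamma> (orbit R ` S) (vertex_of M ` S)"
    "\<And>x. x \<in> S \<Longrightarrow> \<gamma> (orbit R x) = vertex_of M x" by blast
  have "label M (\<gamma> T) = lab x" if T: "T \<in> orbit R ` S" and x: "x \<in> T" for T x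
  proof -
    obtain d where d: "d \<in> S" "T = orbit R d" using T by auto
    then have "label M (\<gamma> T) = lab d" using \<gamma>(2) code by (auto simp: S_def mob_code_def)
    then show ?thesis using x d s.lab_orbit[of x d] by (auto simp: S_def)
  qed
  then show ?thesis using \<gamma>(1) unfolding m w by blast
qed

text \<open>The down-darts of a face of \<open>B\<close>, in the order of \<open>F\<close>, leave
  the neighbours of one black vertex in clockwise order.\<close>

lemma mob_code_faces:
  assumes M: "is_mobile M" and code: "mob_code M U lab R"
  shows "\<exists>\<delta>. bij_betw \<delta> (orbit (\<lambda>d. R (opp M d)) ` darts M) (black M) \<and>
    (\<forall>T\<in>orbit (\<lambda>d. R (opp M d)) ` darts M. card (\<delta> T) = card (T - U) \<and>
      (\<forall>z\<in>T \<inter> U. cycle_labels U R (opp M) lab z \<in> cw_type M (\<delta> T)))"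
proof -
  interpret mobile_map M "darts M" U "opp M" R lab
    using code unfolding mob_code_def by blast
  have lab: "label M (vertex_of M d) = lab d" if "d \<in> darts M - U" for d
    using code that by (auto simp: mob_code_def)
  let ?F = "\<lambda>d. R (opp M d)" and ?\<alpha> = "\<lambda>x. opp M (inv (rot M) (opp M x))" and ?W = "darts M - U"
  have black: "black M = (\<lambda>x. vertex_of M (opp M x)) ` ?W"
    unfolding mob_code_black[OF M code] by (subst a.U_i_image) (simp add: image_image)
  have "\<exists>\<delta>. bij_betw \<delta> (orbit ?F ` ?W) ((\<lambda>x. vertex_of M (opp M x)) ` ?W) \<and>
      (\<forall>x\<in>?W. \<delta> (orbit ?F x) = vertex_of M (opp M x))"
  proof (rule bij_betw_images)
    fix x y assume xy: "x \<in> ?W" "y \<in> ?W"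
    have "vertex_of M (opp M x) = vertex_of M (opp M y) \<longleftrightarrow> orbit ?\<alpha> x = orbit ?\<alpha> y"
      using permutes_inj[OF a.i_perm] by (simp add: a.vertex_i inj_image_eq_iff)
    then show "orbit ?F x = orbit ?F y \<longleftrightarrow> vertex_of M (opp M x) = vertex_of M (opp M y)"
      using s.\<alpha>_orbit_eq[OF xy] by simp
  qed
  then obtain \<delta> where \<delta>: "bij_betw \<delta> (orbit ?F ` ?W) ((\<lambda>x. vertex_of M (opp M x)) ` ?W)"
    "\<And>x. x \<in> ?W \<Longrightarrow> \<delta> (orbit ?F x) = vertex_of M (opp M x)" by blast
  have "card (\<delta> T) = card (T - U) \<and> (\<forall>z\<in>T \<inter> U. cycle_labels U R (opp M) lab z \<in> cw_type M (\<delta> T))"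
    if T: "T \<in> orbit ?F ` ?W" for T
  proof -
    obtain x where x: "x \<in> ?W" "T = orbit ?F x" using T by auto
    have sub: "T \<subseteq> darts M" using x permutes_orbit_subset[OF s.F_perm] by auto
    have cardW: "card (\<delta> (orbit ?F x)) = card (orbit ?F x - U)" if "x \<in> ?W" for x
    proof -
      have "card (\<delta> (orbit ?F x)) = card (orbit ?\<alpha> x)"
        using \<delta>(2)[OF that] permutes_inj_on[OF a.i_perm] by (simp add: a.vertex_i card_image)
      also have "orbit ?\<alpha> x = orbit ?F x - U"
        using s.\<alpha>_orbit[OF that] permutes_orbit_subset[OF s.F_perm, of x] that by auto
      finally show ?thesis .
    qed
    have "cycle_labels U R (opp M) lab z \<in> cw_type M (\<delta> T)" if z: "z \<in> T \<inter> U" for z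
    proof -
      have Tz: "T = orbit ?F z" using z x s.F_orbit_eq[of x z] by auto
      define l where "l = filter (\<lambda>y. y \<in> ?W) (trace ?F (card T) z)"
      note tr = trace_orbit[OF s.F_perm s.finite_D, of z, folded Tz]
      have l': "filter (\<lambda>y. y \<notin> U) (trace ?F (card T) z) = l"
        unfolding l_def by (rule filter_cong) (use tr(1) sub in auto)
      have set_l: "set l = T - U" using tr(1) sub by (auto simp: l_def)
      have len: "length l = card (T - U)"
        using tr(2) set_l distinct_card[of l] by (simp add: l_def)
      \<comment> \<open>The first down-dart after \<open>z\<close> fixes the position at which the
        clockwise type has to be read.\<close>
      obtain x' where x': "hits ?F ?W z x'" using s.F_meets_U[of z] z sub by auto
      have x'W: "x' \<in> ?W" using hits_in[OF x'] .
      have "x' \<in> T" using hits_orbit[OF x'] Tz by simp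
      then have Tx': "T = orbit ?F x'" using x s.F_orbit_eq[of x x'] by auto
      have "l \<noteq> []" using set_l x s.F_orbit_self[of x] by auto
      then obtain m where m: "l = x' # trace ?\<alpha> m x'"
        using filter_trace[of ?W ?F ?\<alpha> z x' "card T"] s.F_hits x' unfolding l_def by blast
      have l_map: "l = map (\<lambda>k. (?\<alpha> ^^ k) x') [0..<Suc m]"
      proof -
        have "[0..<Suc m] = 0 # map Suc [0..<m]" by (simp add: upt_conv_Cons map_Suc_upt del: upt_Suc)
        then show ?thesis unfolding m trace_conv_map by (simp del: upt_Suc)
      qed
      have \<alpha>W: "(?\<alpha> ^^ k) x' \<in> ?W" for k
        by (induction k) (use x'W s.\<alpha>_U in auto)
      have inv_pow: "opp M ((inv (rot M) ^^ k) (opp M x')) = (?\<alpha> ^^ k) x'" for k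
      proof (induction k)
        case (Suc k)
        have "(inv (rot M) ^^ k) (opp M x') = opp M ((?\<alpha> ^^ k) x')"
          using Suc a.i_i_all by metis
        then show ?case by simp
      qed simp
      have card: "card (\<delta> T) = Suc m"
        using cardW[OF x'W] len Tx' unfolding l_map by simp
      have mem: "opp M x' \<in> \<delta> T" using \<delta>(2)[OF x'W] Tx' a.vertex_self by simp
      have "map lab l = map (\<lambda>k. neighbour_label M ((inv (rot M) ^^ k) (opp M x'))) [0..<card (\<delta> T)]"
        unfolding l_map card map_map
        by (rule map_cong) (use lab[OF \<alpha>W] in \<open>auto simp: neighbour_label_def inv_pow\<close>)
      then have "map lab l \<in> cw_type M (\<delta> T)" unfolding cw_type_def using mem by blast
      then show ?thesis unfolding cycle_labels_def Tz[symmetric] l' .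
    qed
    then show ?thesis using cardW[OF x(1)] x(2) by simp
  qed
  then show ?thesis using \<delta>(1) unfolding black s.F_orbits_U by blast
qed

lemma code_iso_bij:
  assumes h: "code_iso h D U i R lab D' U' i' R' lab'"
    and lm: "level_map D U i R lab" "level_map D' U' i' R' lab'"
  shows "bij_betw ((`) h) (orbit R ` D) (orbit R' ` D')"
    "bij_betw ((`) h) (orbit (\<lambda>d. R (i d)) ` D) (orbit (\<lambda>d. R' (i' d)) ` D')"
    "T \<subseteq> D \<Longrightarrow> h ` T \<inter> U' = h ` (T \<inter> U)" "T \<subseteq> D \<Longrightarrow> h ` T - U' = h ` (T - U)"
    "z \<in> D \<Longrightarrow> cycle_labels U' R' i' lab' (h z) = cycle_labels U R i lab z"
proof -
  interpret A: level_map D U i R lab by fact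
  interpret B: level_map D' U' i' R' lab' by fact
  have bij: "bij_betw h D D'" using h by (simp add: code_iso_def)
  then have inj: "inj_on h D" and img: "h ` D = D'" by (auto simp: bij_betw_def)
  have hd: "h (i d) = i' (h d)" "h (R d) = R' (h d)" "h d \<in> U' \<longleftrightarrow> d \<in> U" "lab' (h d) = lab d"
    if "d \<in> D" for d using h that by (auto simp: code_iso_def)
  have "inj_on ((`) h) (Pow D)" using inj by (rule inj_on_image_Pow)
  then have inj': "inj_on ((`) h) (orbit R ` D)" "inj_on ((`) h) (orbit (\<lambda>d. R (i d)) ` D)"
    using permutes_orbit_subset[OF A.R_perm] permutes_orbit_subset[OF A.F_perm]
    by (auto elim!: inj_on_subset)
  have "(`) h ` orbit R ` D = orbit R' ` h ` D"
    unfolding image_image using code_iso_orbit(1)[OF h lm(1)] by (intro image_cong) auto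
  then show "bij_betw ((`) h) (orbit R ` D) (orbit R' ` D')"
    using inj'(1) img by (simp add: bij_betw_def)
  have "(`) h ` orbit (\<lambda>d. R (i d)) ` D = orbit (\<lambda>d. R' (i' d)) ` h ` D"
    unfolding image_image using code_iso_orbit(2)[OF h lm(1)] by (intro image_cong) auto
  then show "bij_betw ((`) h) (orbit (\<lambda>d. R (i d)) ` D) (orbit (\<lambda>d. R' (i' d)) ` D')"
    using inj'(2) img by (simp add: bij_betw_def)
  show "h ` T \<inter> U' = h ` (T \<inter> U)" "h ` T - U' = h ` (T - U)" if "T \<subseteq> D"
    using hd(3) that by auto
  have tr: "trace (\<lambda>d. R' (i' d)) n (h z) = map h (trace (\<lambda>d. R (i d)) n z) \<and> set (trace (\<lambda>d. R (i d)) n z) \<subseteq> D"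
    if "z \<in> D" for n z
    using that by (induction n arbitrary: z) (auto simp: hd[symmetric])
  show "cycle_labels U' R' i' lab' (h z) = cycle_labels U R i lab z" if z: "z \<in> D"
  proof -
    define n where "n = card (orbit (\<lambda>d. R (i d)) z)"
    have "inj_on h (orbit (\<lambda>d. R (i d)) z)"
      using inj permutes_orbit_subset[OF A.F_perm z] by (rule inj_on_subset)
    then have n': "card (orbit (\<lambda>d. R' (i' d)) (h z)) = n"
      using code_iso_orbit(2)[OF h lm(1) z] by (simp add: n_def card_image)
    have "map lab' (filter (\<lambda>x. x \<notin> U') (map h xs)) = map lab (filter (\<lambda>x. x \<notin> U) xs)"
      if "set xs \<subseteq> D" for xs
      using that by (induction xs) (auto simp: hd)
    then show ?thesis using tr[OF z, of n] by (simp add: cycle_labels_def n' n_def[symmetric])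
  qed
qed

section \<open>The bijection\<close>

text \<open>A relation up to isomorphism of the bipartite maps, so that it is invariant under
  isomorphisms on both sides.\<close>

definition corresponds :: "('a, 'y) ptd_hypermap_scheme \<Rightarrow> ('b, 'z) mobile_scheme \<Rightarrow> bool" where
  "corresponds H M \<longleftrightarrow> (\<exists>U lab R U' lab' R' h. hyp_code H U lab R \<and> mob_code M U' lab' R' \<and>
     code_iso h (darts H) U (opp H) R lab (darts M) U' (opp M) R' lab')"

lemma hyp_code_level: "hyp_code H U lab R \<Longrightarrow> level_map (darts H) U (opp H) R lab"
  unfolding hyp_code_def hyper_map_def split_map_def by blast

lemma mob_code_level: "mob_code M U lab R \<Longrightarrow> level_map (darts M) U (opp M) R lab"
  unfolding mob_code_def using mobile_map.primal by blast

lemma level_closed: "level_map D U i R lab \<Longrightarrow> d \<in> D \<Longrightarrow> i d \<in> D \<and> R d \<in> D"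
  using level_map.i_D level_map.R_D by metis

lemma correspondence_properties:
  assumes H: "pointed_hypermap H" and M: "is_mobile M" and HM: "corresponds H M"
  shows "\<exists>\<beta>. bij_betw \<beta> (light H) {u. right_local_max M u} \<and>
      (\<forall>f\<in>light H. label M (\<beta> f) = max_label H f + 1)"
    "\<exists>\<gamma>. bij_betw \<gamma> (verts H - {point H}) {u \<in> white M. \<not> right_local_max M u} \<and>
      (\<forall>v\<in>verts H - {point H}. label M (\<gamma> v) = geodesic_label H v)"
    "\<exists>\<delta>. bij_betw \<delta> (dark H) (black M) \<and> (\<forall>f\<in>dark H. card (\<delta> f) = card f \<and>
      (\<forall>\<tau>\<in>ccw_type H f. upper_complement \<tau> \<in> cw_type M (\<delta> f)))"
proof -
  obtain U lab R U' lab' R' h where c: "hyp_code H U lab R" "mob_code M U' lab' R'"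
    and h: "code_iso h (darts H) U (opp H) R lab (darts M) U' (opp M) R' lab'"
    using HM unfolding corresponds_def by blast
  interpret A: level_map "darts H" U "opp H" R lab by (rule hyp_code_level[OF c(1)])
  interpret B: level_map "darts M" U' "opp M" R' lab' by (rule mob_code_level[OF c(2)])
  note hb = code_iso_bij[OF h A.level_map_axioms B.level_map_axioms]
  have labh: "lab' (h d) = lab d" if "d \<in> darts H" for d using h that by (auto simp: code_iso_def)
  have sub: "T \<subseteq> darts H" if "T \<in> orbit R ` darts H" for T
    using that permutes_orbit_subset[OF A.R_perm] by auto
  have orbit_ne: "T \<noteq> {}" if "T \<in> orbit R ` darts H" for T
    using that by (auto simp: orbit_nonempty)
  have DD: "darts H = {} \<longleftrightarrow> darts M = {}" using h by (auto simp: code_iso_def bij_betw_def)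
  \<comment> \<open>Without darts \<open>B\<close> has no vertices to mediate. The light face has
    maximum 0 and the white vertex has label 1, in accordance with the general rule.\<close>
  have empty: "verts H = {{}}" "faces H = {{}}" "dark H = {}" "point H = {}" "light H = {{}}"
      "max_label H {} = 0" "verts M = {{}}" "black M = {}" "white M = {{}}" "label M {} = 1"
      "right_local_max M u \<longleftrightarrow> u = {}" if e: "darts H = {}" for u
  proof -
    show H': "verts H = {{}}" "faces H = {{}}" using e by (auto simp: verts_def faces_def)
    show "dark H = {}" "point H = {}" using H H' by (auto simp: pointed_hypermap_def)
    then show "light H = {{}}" "max_label H {} = 0"
      using e H' by (auto simp: light_def max_label_def incident_def geodesic_label_distance)
    show M': "verts M = {{}}" using e DD by (simp add: verts_def)
    show b: "black M = {}" using mob_code_black[OF M c(2)] e DD B.U_sub by auto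
    then show w: "white M = {{}}" using M' by (simp add: white_def)
    have "\<exists>v\<in>white M. label M v = 1" using M unfolding is_mobile_def by blast
    then show "label M {} = 1" using w by simp
    show "right_local_max M u \<longleftrightarrow> u = {}" using w b by (auto simp: right_local_max_def right_neighbour_def)
  qed
  show "\<exists>\<beta>. bij_betw \<beta> (light H) {u. right_local_max M u} \<and>
      (\<forall>f\<in>light H. label M (\<beta> f) = max_label H f + 1)"
  proof (cases "darts H = {}")
    case True
    show ?thesis
      by (rule exI[of _ "\<lambda>_. {}"]) (simp add: empty[OF True] bij_betw_def)
  next
    case False
    obtain \<beta> where \<beta>: "bij_betw \<beta> (light H) {T \<in> orbit R ` darts H. T \<inter> U = {}}"
      "\<forall>f\<in>light H. \<forall>x\<in>\<beta> f. lab x = max_label H f + 1"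
      using hyp_code_light[OF H False c(1)] by blast
    have "bij_betw ((`) h) {T \<in> orbit R ` darts H. T \<inter> U = {}} {T \<in> orbit R' ` darts M. T \<inter> U' = {}}"
      using hb(1) by (rule bij_betw_Collect) (use hb(3)[OF sub] in auto)
    then have bij: "bij_betw ((`) h \<circ> \<beta>) (light H) {u. right_local_max M u}"
      using \<beta>(1) mob_code_maxima(1)[OF M _ c(2)] False DD by (auto intro: bij_betw_trans)
    have "label M (h ` \<beta> f) = max_label H f + 1" if f: "f \<in> light H" for f
    proof -
      have T: "\<beta> f \<in> orbit R ` darts H" using \<beta>(1) f by (auto dest: bij_betwE)
      obtain x where x: "x \<in> \<beta> f" using orbit_ne[OF T] by auto
      have "right_local_max M (h ` \<beta> f)" using bij f by (auto dest: bij_betwE)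
      then have "label M (h ` \<beta> f) = lab' (h x)"
        using mob_code_maxima(2)[OF M _ c(2)] False DD x by blast
      also have "\<dots> = lab x" using labh sub[OF T] x by auto
      finally show ?thesis using \<beta>(2) f x by simp
    qed
    then show ?thesis using bij by (intro exI[of _ "(`) h \<circ> \<beta>"]) simp
  qed
  show "\<exists>\<gamma>. bij_betw \<gamma> (verts H - {point H}) {u \<in> white M. \<not> right_local_max M u} \<and>
      (\<forall>v\<in>verts H - {point H}. label M (\<gamma> v) = geodesic_label H v)"
  proof (cases "darts H = {}")
    case True
    show ?thesis by (simp add: empty[OF True] bij_betw_def)
  next
    case False
    define X where "X = {T \<in> orbit R ` darts H. T \<inter> U \<noteq> {} \<and> \<not> T \<subseteq> U}"
    define X' where "X' = {T \<in> orbit R' ` darts M. T \<inter> U' \<noteq> {} \<and> \<not> T \<subseteq> U'}"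
    obtain \<gamma> where \<gamma>: "bij_betw \<gamma> (verts H - {point H}) X"
      "\<forall>v\<in>verts H - {point H}. \<forall>x\<in>\<gamma> v. lab x = geodesic_label H v"
      using hyp_code_vertices[OF H False c(1)] unfolding X_def by blast
    obtain \<gamma>' where \<gamma>': "bij_betw \<gamma>' X' {u \<in> white M. \<not> right_local_max M u}"
      "\<forall>T\<in>X'. \<forall>x\<in>T. label M (\<gamma>' T) = lab' x"
      using mob_code_vertices[OF M _ c(2)] False DD unfolding X'_def by blast
    have "bij_betw ((`) h) X X'" unfolding X_def X'_def
      using hb(1)
    proof (rule bij_betw_Collect)
      fix T assume "T \<in> orbit R ` darts H"
      then have *: "h ` T \<inter> U' = h ` (T \<inter> U)" "h ` T - U' = h ` (T - U)"
        using hb(3,4)[OF sub] by blast+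
      have "A \<subseteq> B \<longleftrightarrow> A - B = {}" for A B :: "'c set" by auto
      then have "h ` T \<subseteq> U' \<longleftrightarrow> T \<subseteq> U" using *(2) by auto
      then show "(h ` T \<inter> U' \<noteq> {} \<and> \<not> h ` T \<subseteq> U') = (T \<inter> U \<noteq> {} \<and> \<not> T \<subseteq> U)" using *(1) by auto
    qed
    note hX = this
    have bij: "bij_betw (\<gamma>' \<circ> ((`) h \<circ> \<gamma>)) (verts H - {point H}) {u \<in> white M. \<not> right_local_max M u}"
      using \<gamma>(1) hX \<gamma>'(1) by (blast intro: bij_betw_trans)
    have "label M (\<gamma>' (h ` \<gamma> v)) = geodesic_label H v" if v: "v \<in> verts H - {point H}" for v
    proof -
      have TX: "\<gamma> v \<in> X" using \<gamma>(1) v by (auto dest: bij_betwE)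
      then have T: "\<gamma> v \<in> orbit R ` darts H" by (simp add: X_def)
      obtain x where x: "x \<in> \<gamma> v" using orbit_ne[OF T] by auto
      have "h ` \<gamma> v \<in> X'" using hX TX by (auto dest: bij_betwE)
      then have "label M (\<gamma>' (h ` \<gamma> v)) = lab' (h x)" using \<gamma>'(2) x by blast
      also have "\<dots> = lab x" using labh sub[OF T] x by auto
      finally show ?thesis using \<gamma>(2) v x by simp
    qed
    then show ?thesis using bij by (intro exI[of _ "\<gamma>' \<circ> ((`) h \<circ> \<gamma>)"]) simp
  qed
  let ?F = "\<lambda>d. R (opp H d)" and ?F' = "\<lambda>d. R' (opp M d)"
  obtain \<delta> where \<delta>: "bij_betw \<delta> (dark H) (orbit ?F ` darts H)"
    "\<And>f. f \<in> dark H \<Longrightarrow> card f = card (\<delta> f \<inter> U)"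
    "\<And>f \<tau>. f \<in> dark H \<Longrightarrow> \<tau> \<in> ccw_type H f \<Longrightarrow> \<exists>z\<in>\<delta> f \<inter> U. upper_complement \<tau> = cycle_labels U R (opp H) lab z"
    using hyp_code_faces[OF H c(1)] by blast
  obtain \<delta>' where \<delta>': "bij_betw \<delta>' (orbit ?F' ` darts M) (black M)"
    "\<And>T. T \<in> orbit ?F' ` darts M \<Longrightarrow> card (\<delta>' T) = card (T - U')"
    "\<And>T z. T \<in> orbit ?F' ` darts M \<Longrightarrow> z \<in> T \<inter> U' \<Longrightarrow> cycle_labels U' R' (opp M) lab' z \<in> cw_type M (\<delta>' T)"
    using mob_code_faces[OF M c(2)] by blast
  have bij: "bij_betw (\<delta>' \<circ> ((`) h \<circ> \<delta>)) (dark H) (black M)"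
    using \<delta>(1) hb(2) \<delta>'(1) by (blast intro: bij_betw_trans)
  have "card (\<delta>' (h ` \<delta> f)) = card f \<and> (\<forall>\<tau>\<in>ccw_type H f. upper_complement \<tau> \<in> cw_type M (\<delta>' (h ` \<delta> f)))"
    if f: "f \<in> dark H" for f
  proof -
    have T: "\<delta> f \<in> orbit ?F ` darts H" using \<delta>(1) f by (auto dest: bij_betwE)
    then obtain d where d: "d \<in> darts H" "\<delta> f = orbit ?F d" by auto
    have sT: "\<delta> f \<subseteq> darts H" using d permutes_orbit_subset[OF A.F_perm] by auto
    have T': "h ` \<delta> f \<in> orbit ?F' ` darts M" using hb(2) T by (auto dest: bij_betwE)
    have "inj_on h (\<delta> f - U)"
      using h sT by (auto simp: code_iso_def bij_betw_def elim!: inj_on_subset)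
    then have "card (h ` \<delta> f - U') = card (\<delta> f - U)"
      using hb(4)[OF sT] by (simp add: card_image)
    \<comment> \<open>The dark face counts the up-darts of the face of \<open>B\<close>, the black
      vertex its down-darts.\<close>
    then have "card (\<delta>' (h ` \<delta> f)) = card f"
      using \<delta>'(2)[OF T'] \<delta>(2)[OF f] A.card_F_orbit[OF d(1)] d(2) by simp
    moreover have "upper_complement \<tau> \<in> cw_type M (\<delta>' (h ` \<delta> f))" if \<tau>: "\<tau> \<in> ccw_type H f" for \<tau>
    proof -
      obtain z where z: "z \<in> \<delta> f \<inter> U" "upper_complement \<tau> = cycle_labels U R (opp H) lab z"
        using \<delta>(3)[OF f \<tau>] by blast
      have "h z \<in> h ` \<delta> f \<inter> U'" using z(1) hb(3)[OF sT] by simp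
      then have "cycle_labels U' R' (opp M) lab' (h z) \<in> cw_type M (\<delta>' (h ` \<delta> f))"
        by (rule \<delta>'(3)[OF T'])
      moreover have "z \<in> darts H" using z(1) sT by auto
      ultimately show ?thesis using hb(5) z(2) by simp
    qed
    ultimately show ?thesis by blast
  qed
  then show "\<exists>\<delta>. bij_betw \<delta> (dark H) (black M) \<and> (\<forall>f\<in>dark H. card (\<delta> f) = card f \<and>
      (\<forall>\<tau>\<in>ccw_type H f. upper_complement \<tau> \<in> cw_type M (\<delta> f)))"
    using bij by (intro exI[of _ "\<delta>' \<circ> ((`) h \<circ> \<delta>)"]) simp
qed

lemma corresponding_mobile:
  fixes H :: "'a ptd_hypermap"
  assumes H: "pointed_hypermap H"
  shows "\<exists>M :: 'a mobile. is_mobile M \<and> corresponds H M"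
proof -
  obtain U lab R where c: "hyp_code H U lab R" using hyp_code_exists[OF H] by blast
  obtain M :: "'a mobile" where "is_mobile M" "darts M = darts H" "opp M = opp H" "mob_code M U lab R"
    using mob_construct[OF hyp_code_level[OF c] hyp_balanced(1)[OF H c]] by blast
  then show ?thesis using c code_iso_refl unfolding corresponds_def by metis
qed

lemma corresponding_hypermap:
  fixes M :: "'a mobile"
  assumes M: "is_mobile M"
  shows "\<exists>H :: 'a ptd_hypermap. pointed_hypermap H \<and> corresponds H M"
proof -
  obtain U lab R where c: "mob_code M U lab R" using mob_code_exists[OF M] by blast
  obtain H :: "'a ptd_hypermap" where "pointed_hypermap H" "darts H = darts M" "opp H = opp M" "hyp_code H U lab R"
    using hyp_construct[OF mob_code_level[OF c] mob_balanced[OF M c]] by blast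
  then show ?thesis using c code_iso_refl unfolding corresponds_def by metis
qed

lemma map_iso_refl: "map_iso_by (\<lambda>x. x) G G"
  using bij_betw_id[of "darts G"] by (simp add: map_iso_by_def id_def)

lemma hypermap_iso_iff:
  fixes H H' :: "'a ptd_hypermap"
  assumes H: "pointed_hypermap H" "pointed_hypermap H'" and M: "is_mobile M" and HM: "corresponds H M"
  shows "(H, H') \<in> hypermap_iso \<longleftrightarrow> corresponds H' M"
proof -
  obtain U lab R V ml S h where c: "hyp_code H U lab R" "mob_code M V ml S"
    and h: "code_iso h (darts H) U (opp H) R lab (darts M) V (opp M) S ml"
    using HM unfolding corresponds_def by blast
  show ?thesis
  proof
    assume "(H, H') \<in> hypermap_iso"
    then obtain k where k: "map_iso_by k H H'" "(`) k ` dark H = dark H'" "k ` point H = point H'"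
      by (auto simp: hypermap_iso_def)
    obtain U' lab' R' where c': "hyp_code H' U' lab' R'" using hyp_code_exists[OF H(2)] by blast
    have "code_iso k (darts H) U (opp H) R lab (darts H') U' (opp H') R' lab'"
      using hypermap_code_iso[OF H c(1) c' k] .
    from code_iso_trans[OF code_iso_sym[OF this level_closed[OF hyp_code_level[OF c(1)]]] h]
    show "corresponds H' M" unfolding corresponds_def using c(2) c' by blast
  next
    assume "corresponds H' M"
    then obtain U' lab' R' V' ml' S' h' where c': "hyp_code H' U' lab' R'" "mob_code M V' ml' S'"
      and h': "code_iso h' (darts H') U' (opp H') R' lab' (darts M) V' (opp M) S' ml'"
      unfolding corresponds_def by blast
    \<comment> \<open>The two correspondences may involve different codes of \<open>M\<close>;
      uniqueness of the code, at the identity, links them.\<close>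
    have "code_iso (\<lambda>x. x) (darts M) V (opp M) S ml (darts M) V' (opp M) S' ml'"
      by (rule mobile_code_iso[OF M M c(2) c'(2) map_iso_refl]) auto
    from code_iso_trans[OF code_iso_trans[OF h this]
        code_iso_sym[OF h' level_closed[OF hyp_code_level[OF c'(1)]]]]
    obtain k where "code_iso k (darts H) U (opp H) R lab (darts H') U' (opp H') R' lab'" by blast
    from code_hypermap_iso[OF H c(1) c'(1) this]
    show "(H, H') \<in> hypermap_iso" using H by (auto simp: hypermap_iso_def)
  qed
qed

lemma mobile_iso_iff:
  fixes M M' :: "'a mobile"
  assumes M: "is_mobile M" "is_mobile M'" and H: "pointed_hypermap H" and HM: "corresponds H M"
  shows "(M, M') \<in> mobile_iso \<longleftrightarrow> corresponds H M'"
proof -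
  obtain U lab R V ml S h where c: "hyp_code H U lab R" "mob_code M V ml S"
    and h: "code_iso h (darts H) U (opp H) R lab (darts M) V (opp M) S ml"
    using HM unfolding corresponds_def by blast
  show ?thesis
  proof
    assume "(M, M') \<in> mobile_iso"
    then obtain k where k: "map_iso_by k M M'" "(`) k ` black M = black M'"
        "\<forall>v\<in>white M. label M' (k ` v) = label M v"
      by (auto simp: mobile_iso_def)
    obtain V' ml' S' where c': "mob_code M' V' ml' S'" using mob_code_exists[OF M(2)] by blast
    have "code_iso k (darts M) V (opp M) S ml (darts M') V' (opp M') S' ml'"
      using mobile_code_iso[OF M c(2) c' k] .
    from code_iso_trans[OF h this]
    show "corresponds H M'" unfolding corresponds_def using c(1) c' by blast
  next
    assume "corresponds H M'"
    then obtain U' lab' R' V' ml' S' h' where c': "hyp_code H U' lab' R'" "mob_code M' V' ml' S'"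
      and h': "code_iso h' (darts H) U' (opp H) R' lab' (darts M') V' (opp M') S' ml'"
      unfolding corresponds_def by blast
    have "code_iso (\<lambda>x. x) (darts H) U (opp H) R lab (darts H) U' (opp H) R' lab'"
      by (rule hypermap_code_iso[OF H H c(1) c'(1) map_iso_refl]) auto
    from code_iso_trans[OF code_iso_trans[OF
          code_iso_sym[OF h level_closed[OF hyp_code_level[OF c(1)]]] this] h']
    obtain k where "code_iso k (darts M) V (opp M) S ml (darts M') V' (opp M') S' ml'" by blast
    from code_mobile_iso[OF M c(2) c'(2) this]
    show "(M, M') \<in> mobile_iso" using M by (auto simp: mobile_iso_def)
  qed
qed

lemma corresponding_degrees:
  assumes "pointed_hypermap H" "is_mobile M" "corresponds H M"
  shows "p_hypermap p H \<longleftrightarrow> p_mobile p M"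
proof -
  obtain \<delta> where \<delta>: "bij_betw \<delta> (dark H) (black M)" "\<forall>f\<in>dark H. card (\<delta> f) = card f"
    using correspondence_properties(3)[OF assms] by blast
  then have "black M = \<delta> ` dark H" by (simp add: bij_betw_def)
  then show ?thesis using \<delta>(2) assms by (simp add: p_hypermap_def p_mobile_def)
qed

theorem theorem6:
  shows "\<exists>\<Phi> :: nat ptd_hypermap set \<Rightarrow> nat mobile set.
    bij_betw \<Phi> ({H. pointed_hypermap H} // hypermap_iso) ({M. is_mobile M} // mobile_iso) \<and>
    (\<forall>H M. pointed_hypermap H \<and> M \<in> \<Phi> (hypermap_iso `` {H}) \<longrightarrow>
      (\<exists>\<beta>. bij_betw \<beta> (light H) {u. right_local_max M u} \<and>
           (\<forall>f\<in>light H. label M (\<beta> f) = max_label H f + 1)) \<and>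
      (\<exists>\<gamma>. bij_betw \<gamma> (verts H - {point H}) {u \<in> white M. \<not> right_local_max M u} \<and>
           (\<forall>v\<in>verts H - {point H}. label M (\<gamma> v) = geodesic_label H v)) \<and>
      (\<exists>\<delta>. bij_betw \<delta> (dark H) (black M) \<and>
           (\<forall>f\<in>dark H. \<forall>\<tau>\<in>ccw_type H f. upper_complement \<tau> \<in> cw_type M (\<delta> f)))) \<and>
    (\<forall>p\<ge>2. bij_betw \<Phi> ({H. p_hypermap p H} // hypermap_iso) ({M. p_mobile p M} // mobile_iso))"
proof -
  \<comment> \<open>All mobiles related to some member of the class. \<open>hypermap_iso_iff\<close>
    and \<open>mobile_iso_iff\<close> make this exactly one isomorphism class.\<close>
  define \<Phi> :: "nat ptd_hypermap set \<Rightarrow> nat mobile set" where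
    "\<Phi> X = {M. is_mobile M \<and> (\<exists>H\<in>X. corresponds H M)}" for X
  have cl_H: "hypermap_iso `` {H} = {H'. pointed_hypermap H' \<and> corresponds H' M}"
    if "pointed_hypermap H" "is_mobile M" "corresponds H M" for H :: "nat ptd_hypermap" and M :: "nat mobile"
    using hypermap_iso_iff[OF that(1) _ that(2,3)] by (auto simp: hypermap_iso_def)
  have cl_M: "mobile_iso `` {M} = {M'. is_mobile M' \<and> corresponds H M'}"
    if "pointed_hypermap H" "is_mobile M" "corresponds H M" for H :: "nat ptd_hypermap" and M :: "nat mobile"
    using mobile_iso_iff[OF that(2) _ that(1,3)] by (auto simp: mobile_iso_def)
  have \<Phi>_class: "\<Phi> (hypermap_iso `` {H}) = {M. is_mobile M \<and> corresponds H M}"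
    if H: "pointed_hypermap H" for H
  proof -
    obtain M0 :: "nat mobile" where M0: "is_mobile M0" "corresponds H M0"
      using corresponding_mobile[OF H] by blast
    have "corresponds H M" if "is_mobile M" "pointed_hypermap H'" "corresponds H' M0" "corresponds H' M"
      for H' :: "nat ptd_hypermap" and M :: "nat mobile"
      using hypermap_iso_iff[OF that(2) H that(1,4)] hypermap_iso_iff[OF that(2) H M0(1) that(3)] M0(2)
      by blast
    then show ?thesis unfolding cl_H[OF H M0] \<Phi>_def using H M0(2) by blast
  qed
  have \<Phi>_eq: "\<Phi> (hypermap_iso `` {H}) = mobile_iso `` {M}"
    if "pointed_hypermap H" "is_mobile M" "corresponds H M" for H M
    using \<Phi>_class[OF that(1)] cl_M[OF that] by simp
  \<comment> \<open>Matching properties \<open>P\<close> and \<open>Q\<close> are left general, so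
    that the full bijection and its restriction to degree \<open>p\<close> are both
    instances.\<close>
  have bij: "bij_betw \<Phi> ({H. P H} // hypermap_iso) ({M. Q M} // mobile_iso)"
    if P: "\<And>H. P H \<Longrightarrow> pointed_hypermap H" and Q: "\<And>M. Q M \<Longrightarrow> is_mobile M"
      and PQ: "\<And>H M. pointed_hypermap H \<Longrightarrow> is_mobile M \<Longrightarrow> corresponds H M \<Longrightarrow> P H \<longleftrightarrow> Q M"
    for P :: "nat ptd_hypermap \<Rightarrow> bool" and Q :: "nat mobile \<Rightarrow> bool"
  proof (rule bij_betw_imageI)
    show "inj_on \<Phi> ({H. P H} // hypermap_iso)"
    proof (rule inj_onI)
      fix X Y assume "X \<in> {H. P H} // hypermap_iso" "Y \<in> {H. P H} // hypermap_iso" and eq: "\<Phi> X = \<Phi> Y"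
      then obtain H H' where H: "P H" "X = hypermap_iso `` {H}" "P H'" "Y = hypermap_iso `` {H'}"
        by (auto simp: quotient_def)
      obtain M :: "nat mobile" where M: "is_mobile M" "corresponds H M"
        using corresponding_mobile P H by blast
      then have "M \<in> \<Phi> Y" using \<Phi>_class[OF P[OF H(1)]] eq H(2) by auto
      then have "corresponds H' M" using \<Phi>_class[OF P[OF H(3)]] H(4) by auto
      then show "X = Y" using cl_H[of H M] cl_H[of H' M] H M P by simp
    qed
    show "\<Phi> ` ({H. P H} // hypermap_iso) = {M. Q M} // mobile_iso"
    proof (intro equalityI subsetI)
      fix Y assume "Y \<in> \<Phi> ` ({H. P H} // hypermap_iso)"
      then obtain H where H: "P H" "Y = \<Phi> (hypermap_iso `` {H})" by (auto simp: quotient_def)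
      obtain M :: "nat mobile" where M: "is_mobile M" "corresponds H M"
        using corresponding_mobile P H by blast
      then have "Y = mobile_iso `` {M}" "Q M" using \<Phi>_eq PQ P H by blast+
      then show "Y \<in> {M. Q M} // mobile_iso" by (auto simp: quotient_def)
    next
      fix Y assume "Y \<in> {M. Q M} // mobile_iso"
      then obtain M where M: "Q M" "Y = mobile_iso `` {M}" by (auto simp: quotient_def)
      obtain H :: "nat ptd_hypermap" where H: "pointed_hypermap H" "corresponds H M"
        using corresponding_hypermap Q M by blast
      then have "Y = \<Phi> (hypermap_iso `` {H})" "P H" using \<Phi>_eq PQ Q M by blast+
      then show "Y \<in> \<Phi> ` ({H. P H} // hypermap_iso)" by (auto simp: quotient_def)
    qed
  qed
  show ?thesis
  proof (intro exI[of _ \<Phi>] conjI allI impI)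
    show "bij_betw \<Phi> ({H. pointed_hypermap H} // hypermap_iso) ({M. is_mobile M} // mobile_iso)"
      by (rule bij) auto
    show "bij_betw \<Phi> ({H. p_hypermap p H} // hypermap_iso) ({M. p_mobile p M} // mobile_iso)" for p
    proof (rule bij)
      show "p_hypermap p H \<longleftrightarrow> p_mobile p M"
        if "pointed_hypermap H" "is_mobile M" "corresponds H M"
        for H :: "nat ptd_hypermap" and M :: "nat mobile"
        using that by (rule corresponding_degrees)
    qed (simp_all add: p_hypermap_def p_mobile_def)
    fix H :: "nat ptd_hypermap" and M :: "nat mobile"
    assume "pointed_hypermap H \<and> M \<in> \<Phi> (hypermap_iso `` {H})"
    then have HM: "pointed_hypermap H" "is_mobile M" "corresponds H M" using \<Phi>_class by auto
    note props = correspondence_properties[OF HM]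
    show "\<exists>\<beta>. bij_betw \<beta> (light H) {u. right_local_max M u} \<and>
        (\<forall>f\<in>light H. label M (\<beta> f) = max_label H f + 1)" by (rule props(1))
    show "\<exists>\<gamma>. bij_betw \<gamma> (verts H - {point H}) {u \<in> white M. \<not> right_local_max M u} \<and>
        (\<forall>v\<in>verts H - {point H}. label M (\<gamma> v) = geodesic_label H v)" by (rule props(2))
    show "\<exists>\<delta>. bij_betw \<delta> (dark H) (black M) \<and>
        (\<forall>f\<in>dark H. \<forall>\<tau>\<in>ccw_type H f. upper_complement \<tau> \<in> cw_type M (\<delta> f))"
      using props(3) by blast
  qed
qed

end
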